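(* Let $n\ge 2$ and $k\ge 1$ be natural numbers. Then there are a subgroup $\Gamma\le\mathrm{Aut}(F_n)$ of finite index and a representation (group homomorphism) $$\rho:\Gamma\to\prod_{i=1}^k \mathrm{SL}((n-1)i,\mathbb{Z})$$ such that $\rho(\Gamma)$ is of finite index in $\prod_{i=1}^k \mathrm{SL}((n-1)i,\mathbb{Z})$.
   Context: $F_n$ is the free group of rank $n$ and $\mathrm{Aut}(F_n)$ its automorphism group. *)

theory Defs
  imports "HOL-Algebra.Algebra" "Jordan_Normal_Form.Determinant"
begin

section \<open>Free groups\<close>

text \<open>A letter \<open>(x, True)\<close> stands for the generator \<open>x\<close>, and \<open>(x, False)\<close> for its
  formal inverse. The free group on \<open>S\<close> consists of the freely reduced words over \<open>S\<close>.\<close>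

type_synonym 'a letter = "'a \<times> bool"

definition inv_letter :: "'a letter \<Rightarrow> 'a letter" where
  "inv_letter a = (fst a, \<not> snd a)"

fun reduced :: "'a letter list \<Rightarrow> bool" where
  "reduced [] = True"
| "reduced [a] = True"
| "reduced (a # b # w) = (b \<noteq> inv_letter a \<and> reduced (b # w))"

fun cancel_cons :: "'a letter \<Rightarrow> 'a letter list \<Rightarrow> 'a letter list" where
  "cancel_cons a [] = [a]"
| "cancel_cons a (b # w) = (if b = inv_letter a then w else a # b # w)"

definition reduce :: "'a letter list \<Rightarrow> 'a letter list" where
  "reduce w = foldr cancel_cons w []"

definition free_group :: "'a set \<Rightarrow> 'a letter list monoid" where
  "free_group S =
    \<lparr>carrier = {w. reduced w \<and> fst ` set w \<subseteq> S},
     monoid.mult = (\<lambda>u v. reduce (u @ v)),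
     one = []\<rparr>"

lemma inv_letter_inv_letter [simp]: "inv_letter (inv_letter a) = a"
  by (simp add: inv_letter_def)

lemma reduced_ConsD: "reduced (a # w) \<Longrightarrow> reduced w"
  by (cases w) auto

lemma reduced_cancel_cons: "reduced w \<Longrightarrow> reduced (cancel_cons a w)"
  by (cases w) (auto dest: reduced_ConsD)

lemma reduced_foldr: "reduced v \<Longrightarrow> reduced (foldr cancel_cons u v)"
  by (induction u) (auto intro: reduced_cancel_cons)

lemma reduced_reduce: "reduced (reduce w)"
  by (simp add: reduce_def reduced_foldr)

lemma reduce_reduced: "reduced w \<Longrightarrow> reduce w = w"
proof (induction w)
  case (Cons a w)
  then show ?case by (cases w) (auto simp: reduce_def dest: reduced_ConsD)
qed (simp add: reduce_def)

lemma cancel_cons_inverse: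
  "reduced w \<Longrightarrow> cancel_cons a (cancel_cons (inv_letter a) w) = w"
  by (cases w rule: reduced.cases) auto

lemma foldr_cancel_cons:
  assumes "reduced w"
  shows "foldr cancel_cons (cancel_cons a u) w = cancel_cons a (foldr cancel_cons u w)"
  using assms by (cases u) (auto simp: cancel_cons_inverse reduced_foldr)

lemma foldr_reduce:
  "reduced w \<Longrightarrow> foldr cancel_cons (reduce u) w = foldr cancel_cons u w"
  by (induction u) (auto simp: reduce_def foldr_cancel_cons)

lemma reduce_append_reduce1: "reduce (reduce u @ v) = reduce (u @ v)"
  using foldr_reduce[of "reduce v" u] reduced_reduce[of v] by (simp add: reduce_def)

lemma reduce_append_reduce2: "reduce (u @ reduce v) = reduce (u @ v)"
  using reduce_reduced[OF reduced_reduce[of v]] by (simp add: reduce_def)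

lemma set_cancel_cons: "set (cancel_cons a w) \<subseteq> insert a (set w)"
  by (cases w) auto

lemma set_reduce: "set (reduce w) \<subseteq> set w"
  using set_cancel_cons by (induction w) (fastforce simp: reduce_def)+

lemma reduce_inverse: "reduce (rev (map inv_letter w) @ w) = []"
proof (induction w)
  case (Cons a w)
  have "reduce (rev (map inv_letter (a # w)) @ a # w)
      = foldr cancel_cons (rev (map inv_letter w)) (cancel_cons (inv_letter a) (cancel_cons a (reduce w)))"
    by (simp add: reduce_def)
  also have "cancel_cons (inv_letter a) (cancel_cons a (reduce w)) = reduce w"
    using cancel_cons_inverse[of "reduce w" "inv_letter a"] reduced_reduce[of w] by simp
  finally show ?case using Cons by (simp add: reduce_def)
qed (simp add: reduce_def)

lemma group_free_group: "group (free_group S)"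
proof (rule groupI)
  fix u v assume "u \<in> carrier (free_group S)" "v \<in> carrier (free_group S)"
  then show "u \<otimes>\<^bsub>free_group S\<^esub> v \<in> carrier (free_group S)"
    using set_reduce[of "u @ v"] by (fastforce simp: free_group_def reduced_reduce)
next
  fix u v w
  show "u \<otimes>\<^bsub>free_group S\<^esub> v \<otimes>\<^bsub>free_group S\<^esub> w = u \<otimes>\<^bsub>free_group S\<^esub> (v \<otimes>\<^bsub>free_group S\<^esub> w)"
    by (simp add: free_group_def reduce_append_reduce1 reduce_append_reduce2)
next
  fix w assume w: "w \<in> carrier (free_group S)"
  then show "\<one>\<^bsub>free_group S\<^esub> \<otimes>\<^bsub>free_group S\<^esub> w = w"
    by (simp add: free_group_def reduce_reduced)
  let ?v = "reduce (rev (map inv_letter w))"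
  have "fst ` set ?v \<subseteq> fst ` set w"
    using set_reduce[of "rev (map inv_letter w)"] by (force simp: inv_letter_def)
  with w have "?v \<in> carrier (free_group S)"
    by (auto simp: free_group_def reduced_reduce)
  moreover have "?v \<otimes>\<^bsub>free_group S\<^esub> w = \<one>\<^bsub>free_group S\<^esub>"
    by (simp add: free_group_def reduce_append_reduce1 reduce_inverse)
  ultimately show "\<exists>v\<in>carrier (free_group S). v \<otimes>\<^bsub>free_group S\<^esub> w = \<one>\<^bsub>free_group S\<^esub>" ..
qed (simp add: free_group_def)

definition eval_letter :: "('b, 'c) monoid_scheme \<Rightarrow> ('a \<Rightarrow> 'b) \<Rightarrow> 'a letter \<Rightarrow> 'b" where
  "eval_letter H f a = (if snd a then f (fst a) else inv\<^bsub>H\<^esub> f (fst a))"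

definition eval_word :: "('b, 'c) monoid_scheme \<Rightarrow> ('a \<Rightarrow> 'b) \<Rightarrow> 'a letter list \<Rightarrow> 'b" where
  "eval_word H f w = foldr (\<lambda>a h. eval_letter H f a \<otimes>\<^bsub>H\<^esub> h) w \<one>\<^bsub>H\<^esub>"

context group
begin

lemma eval_word_simps [simp]:
  "eval_word G f [] = \<one>"
  "eval_word G f (a # w) = eval_letter G f a \<otimes> eval_word G f w"
  by (simp_all add: eval_word_def)

lemma eval_letter_closed: "f \<in> S \<rightarrow> carrier G \<Longrightarrow> fst a \<in> S \<Longrightarrow> eval_letter G f a \<in> carrier G"
  by (auto simp: eval_letter_def)

lemma eval_word_closed:
  "f \<in> S \<rightarrow> carrier G \<Longrightarrow> fst ` set w \<subseteq> S \<Longrightarrow> eval_word G f w \<in> carrier G"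
  by (induction w) (auto intro: eval_letter_closed)

lemma eval_letter_inverse:
  "f \<in> S \<rightarrow> carrier G \<Longrightarrow> fst a \<in> S \<Longrightarrow> eval_letter G f a \<otimes> eval_letter G f (inv_letter a) = \<one>"
  by (auto simp: eval_letter_def inv_letter_def r_inv l_inv Pi_iff)

lemma eval_word_cancel_cons:
  assumes f: "f \<in> S \<rightarrow> carrier G" and a: "fst a \<in> S" and w: "fst ` set w \<subseteq> S"
  shows "eval_word G f (cancel_cons a w) = eval_letter G f a \<otimes> eval_word G f w"
proof (cases w)
  case (Cons b v)
  then have v: "fst ` set v \<subseteq> S" and b: "fst b \<in> S" using w by auto
  show ?thesis
    using Cons eval_letter_inverse[OF f a] eval_letter_closed[OF f a] eval_letter_closed[OF f b]
      eval_word_closed[OF f v] by (auto simp: m_assoc[symmetric])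
qed simp

lemma eval_word_reduce:
  assumes f: "f \<in> S \<rightarrow> carrier G" and "fst ` set w \<subseteq> S"
  shows "eval_word G f (reduce w) = eval_word G f w"
  using assms(2)
proof (induction w)
  case (Cons a w)
  have "fst ` set (reduce w) \<subseteq> S" using set_reduce[of w] Cons.prems by auto
  with Cons show ?case
    using eval_word_cancel_cons[OF f, of a "reduce w"] by (simp add: reduce_def)
qed (simp add: reduce_def)

lemma eval_word_append:
  assumes f: "f \<in> S \<rightarrow> carrier G" and "fst ` set u \<subseteq> S" and v: "fst ` set v \<subseteq> S"
  shows "eval_word G f (u @ v) = eval_word G f u \<otimes> eval_word G f v"
  using assms(2)
  by (induction u) (auto simp: m_assoc eval_letter_closed[OF f] eval_word_closed[OF f] eval_word_closed[OF f v])

end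

theorem free_group_universal:
  fixes H (structure)
  assumes "group H" and f: "f \<in> S \<rightarrow> carrier H"
  shows "\<exists>!\<phi>. \<phi> \<in> hom (free_group S) H \<inter> extensional (carrier (free_group S)) \<and>
    (\<forall>x\<in>S. \<phi> [(x, True)] = f x)"
proof -
  interpret H: group H by fact
  let ?F = "free_group S"
  interpret F: group ?F by (rule group_free_group)
  let ?\<phi> = "\<lambda>w\<in>carrier ?F. eval_word H f w"
  show ?thesis
  proof (rule ex1I[of _ ?\<phi>], intro conjI IntI ballI homI)
    fix u v assume u: "u \<in> carrier ?F" and v: "v \<in> carrier ?F"
    then have "eval_word H f (u \<otimes>\<^bsub>?F\<^esub> v) = eval_word H f u \<otimes> eval_word H f v"
      using H.eval_word_reduce[OF f, of "u @ v"] H.eval_word_append[OF f, of u v]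
      by (auto simp: free_group_def image_Un)
    then show "?\<phi> (u \<otimes>\<^bsub>?F\<^esub> v) = ?\<phi> u \<otimes> ?\<phi> v" using u v F.m_closed by simp
  next
    fix u assume "u \<in> carrier ?F"
    then show "?\<phi> u \<in> carrier H" using H.eval_word_closed[OF f] by (simp add: free_group_def)
  next
    fix x assume "x \<in> S"
    then show "?\<phi> [(x, True)] = f x"
      using f by (auto simp: free_group_def eval_letter_def Pi_iff)
  next
    fix \<psi>
    assume A: "\<psi> \<in> hom ?F H \<inter> extensional (carrier ?F) \<and> (\<forall>x\<in>S. \<psi> [(x, True)] = f x)"
    then interpret \<psi>: group_hom ?F H \<psi> by unfold_locales auto
    have L: "\<psi> [a] = eval_letter H f a" if "fst a \<in> S" for a
    proof -
      obtain x b where a: "a = (x, b)" by (cases a)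
      have T: "[(x, c)] \<in> carrier ?F" for c using that a by (simp add: free_group_def)
      have "[(x, False)] \<otimes>\<^bsub>?F\<^esub> [(x, True)] = \<one>\<^bsub>?F\<^esub>"
        by (simp add: free_group_def reduce_def inv_letter_def)
      then have "inv\<^bsub>?F\<^esub> [(x, True)] = [(x, False)]" using T by (rule_tac F.inv_equality) auto
      then have "\<psi> [(x, False)] = inv \<psi> [(x, True)]" using \<psi>.hom_inv[OF T[of True]] by simp
      then show ?thesis using A that a by (cases b) (auto simp: eval_letter_def)
    qed
    have "\<psi> w = eval_word H f w" if "w \<in> carrier ?F" for w
      using that
    proof (induction w)
      case Nil
      then show ?case using \<psi>.hom_one by (simp add: free_group_def)
    next
      case (Cons a w)
      then have w: "w \<in> carrier ?F" and a: "[a] \<in> carrier ?F" and aX: "fst a \<in> S"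
        by (auto simp: free_group_def dest: reduced_ConsD)
      have "[a] \<otimes>\<^bsub>?F\<^esub> w = a # w"
        using Cons.prems by (simp add: free_group_def reduce_reduced)
      then show ?case using \<psi>.hom_mult[OF a w] Cons.IH[OF w] L[OF aX] by simp
    qed
    then show "\<psi> = ?\<phi>" using A by (intro extensionalityI[of _ "carrier ?F"]) auto
  qed simp
qed

section \<open>Special linear groups\<close>

definition SL :: "nat \<Rightarrow> 'a :: comm_ring_1 mat monoid" where
  "SL m =
    \<lparr>carrier = {A \<in> carrier_mat m m. det A = 1},
     monoid.mult = (*),
     one = 1\<^sub>m m\<rparr>"

lemma group_SL: "group (SL m :: 'a :: comm_ring_1 mat monoid)"
proof (rule groupI)
  fix A :: "'a mat" assume "A \<in> carrier (SL m)"
  then have A: "A \<in> carrier_mat m m" "det A = 1" by (auto simp: SL_def)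
  have B: "adj_mat A \<in> carrier_mat m m" "adj_mat A * A = 1\<^sub>m m"
    using adj_mat[OF A(1)] A(2) by auto
  have "det (adj_mat A) = 1" using det_mult[OF B(1) A(1)] A(2) B(2) by simp
  with B show "\<exists>B\<in>carrier (SL m). B \<otimes>\<^bsub>SL m\<^esub> A = \<one>\<^bsub>SL m\<^esub>" by (auto simp: SL_def)
qed (auto simp: SL_def det_mult)

section \<open>Subgroups of finite index\<close>

definition finite_index_subgroup :: "'a set \<Rightarrow> ('a, 'b) monoid_scheme \<Rightarrow> bool" where
  "finite_index_subgroup H G \<longleftrightarrow> subgroup H G \<and> finite (rcosets\<^bsub>G\<^esub> H)"

end

theory Submission
  imports Defs "HOL-Computational_Algebra.Primes" "HOL-Number_Theory.Cong"
begin

text \<open>The subgroup and the representation come from finite covers of the rose with \<open>n\<close> petals. Let \<open>F\<close> be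
free on the trivial generators \<open>0, \<dots>, t - 1\<close>, the shift generator \<open>t\<close> and the sign generator \<open>t + 1\<close>, so that
\<open>n = t + 2\<close>. For each \<open>i\<close> let \<open>F\<close> act on \<open>\<int>/i\<close> by signed permutations: the shift generator rotates, the
sign generator changes the sign at the point \<open>0\<close>, and the trivial generators fix everything.
A cocycle for this action is a family \<open>f w s\<close> of integers with
\<open>f (u w) s = f u s \<plusminus> f w (s + disp u)\<close>. Modulo coboundaries the cocycles form, up to torsion, a free abelian group
of rank \<open>(n - 1) i\<close>: this is the cohomology, with coefficients twisted by a sign, of a subgroup of index \<open>i\<close>
in \<open>F\<close>, which is free of rank \<open>(n - 1) i + 1\<close>. The automorphisms that preserve the actions for
\<open>i = 1, \<dots>, k\<close> form a subgroup of finite index, and they act on these groups of cocycles by integral matrices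
\<open>rho t i\<close>. Restricting further to determinant \<open>1\<close> gives \<open>\<Gamma>\<close> and the homomorphism into the product of the
\<open>SL((n - 1) i, \<int>)\<close>.

That the image has finite index is shown with elementary matrices. If \<open>w\<close> acts trivially in all covers, then the
automorphism that multiplies a trivial generator by \<open>w\<close> acts unipotently, and its matrix is read off from the
values of the coordinate cocycles on \<open>w\<close>. Because the sign generator \<open>z\<close> changes only one sign, the passage from
\<open>w\<close> to \<open>w z w\<^sup>-\<^sup>1 z\<^sup>-\<^sup>1\<close> is twice the projection of the values onto one point; doing this, rotating by \<open>l\<close>
and doing it again gives a word whose values vanish unless \<open>i\<close> divides \<open>l\<close>. The divisibility matrix is
unitriangular, so a single cover can be isolated by integral combinations (\<open>deck_trivial_isolate\<close>). For
\<open>n \<ge> 4\<close> there are two trivial generators, and commutators then produce, for each \<open>i\<close> and each pair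
\<open>p \<noteq> q\<close>, an automorphism whose image is a nontrivial elementary matrix in the \<open>i\<close>-th factor and the identity in all
other factors.

It remains to know that a subgroup \<open>K\<close> of \<open>SL(m, \<int>)\<close>, \<open>m \<ge> 3\<close>, has finite index as soon as it contains a
nontrivial elementary matrix in each position (\<open>elementary_finite_index\<close>). If \<open>K\<close> contains the multiples of \<open>N\<close>
in all positions, then it contains all conjugates of the elementary matrices with entry in \<open>N\<^sup>2 \<int>\<close>
(\<open>conj_elem_mem\<close>). In the group generated by all elementary matrices, modulo a normal subgroup
that contains these conjugates, the congruence subgroup of level \<open>N\<^sup>2\<close> is central (\<open>principal_central\<close>); and a
group with a central subgroup of finite index that is generated by finitely many elements of finite order is finite,
by Dietzmann's lemma.

For \<open>n = 2\<close> and \<open>n = 3\<close> the case \<open>i = 1\<close> already maps a subgroup of finite index onto \<open>SL(2, \<int>)\<close> (for \<open>n = 2\<close> by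
dropping the sign generator). A subgroup of finite index in \<open>SL(2, \<int>)\<close> is free on two generators, and a subgroup
of finite index in that free group can be mapped to any given group so that the image contains any prescribed finite
set (\<open>SL2_large\<close>). It suffices to prescribe the elementary matrices of all factors.\<close>

section \<open>Subgroups of finite index\<close>

lemma (in group) inv_cancel_left:
  assumes "x \<in> carrier G" "z \<in> carrier G"
  shows "inv x \<otimes> (x \<otimes> z) = z" "x \<otimes> (inv x \<otimes> z) = z"
  using assms by (simp_all add: m_assoc[symmetric])

text \<open>A finite colouring that separates cosets is the form in which finite index is established below.\<close>

lemma (in group) finite_index_subgroupI:
  assumes H: "subgroup H G" and fin: "finite (c ` carrier G)"
    and sep: "\<And>x y. x \<in> carrier G \<Longrightarrow> y \<in> carrier G \<Longrightarrow> c x = c y \<Longrightarrow> x \<otimes> inv y \<in> H"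
  shows "finite_index_subgroup H G"
proof -
  have eq: "H #> x = H #> y" if "x \<in> carrier G" "y \<in> carrier G" "c x = c y" for x y
  proof -
    have "x = (x \<otimes> inv y) \<otimes> y" using that by (simp add: m_assoc)
    then have "x \<in> H #> y" using sep[OF that] unfolding r_coset_def by blast
    then show ?thesis using repr_independence[OF _ that(2) H] by simp
  qed
  have "rcosets H \<subseteq> (\<lambda>v. H #> (SOME x. x \<in> carrier G \<and> c x = v)) ` (c ` carrier G)"
  proof
    fix C assume "C \<in> rcosets H"
    then obtain x where x: "x \<in> carrier G" "C = H #> x" by (auto simp: RCOSETS_def)
    let ?y = "SOME y. y \<in> carrier G \<and> c y = c x"
    have "?y \<in> carrier G \<and> c ?y = c x" by (rule someI[of _ x]) (use x in auto)
    then have "C = H #> ?y" using eq[of x ?y] x by auto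
    then show "C \<in> (\<lambda>v. H #> (SOME x. x \<in> carrier G \<and> c x = v)) ` (c ` carrier G)"
      using x(1) by blast
  qed
  then show ?thesis
    using H fin finite_subset unfolding finite_index_subgroup_def by blast
qed

lemma (in group) rcos_eq_imp_quotient:
  assumes H: "subgroup H G" and x: "x \<in> carrier G" and y: "y \<in> carrier G"
    and eq: "H #> x = H #> y"
  shows "x \<otimes> inv y \<in> H"
proof -
  have "x \<in> H #> y" using rcos_self[OF x H] eq by simp
  then obtain h where h: "h \<in> H" "x = h \<otimes> y" by (auto simp: r_coset_def)
  then have "h \<in> carrier G" using subgroup.subset[OF H] by blast
  then show ?thesis using h y by (simp add: m_assoc)
qed

lemma finite_index_subgroupD: "finite_index_subgroup H G \<Longrightarrow> subgroup H G"
  by (simp add: finite_index_subgroup_def)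

lemma (in group) finite_rcos_image:
  assumes "finite_index_subgroup H G" shows "finite ((\<lambda>x. H #> x) ` carrier G)"
proof -
  have "(\<lambda>x. H #> x) ` carrier G = rcosets H" by (auto simp: RCOSETS_def)
  then show ?thesis using assms by (simp add: finite_index_subgroup_def)
qed

lemma (in group) finite_index_mono:
  assumes "finite_index_subgroup K G" "K \<subseteq> H" "subgroup H G"
  shows "finite_index_subgroup H G"
  using assms(2,3) finite_rcos_image[OF assms(1)]
    rcos_eq_imp_quotient[OF finite_index_subgroupD[OF assms(1)]]
  by (intro finite_index_subgroupI[where c = "\<lambda>x. K #> x"]) auto

text \<open>The homomorphism lives only on \<open>\<Gamma>\<close>, so the colour of \<open>x\<close> consists of its coset and of the image of its
quotient by a representative of that coset.\<close>

lemma (in group) finite_index_preimage: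
  assumes \<Gamma>: "finite_index_subgroup \<Gamma> G" and L: "group L"
    and h: "h \<in> hom (G\<lparr>carrier := \<Gamma>\<rparr>) L" and K: "finite_index_subgroup K L"
  shows "finite_index_subgroup {x \<in> \<Gamma>. h x \<in> K} G"
proof -
  interpret L: group L by (rule L)
  have \<Gamma>s: "subgroup \<Gamma> G" and Ks: "subgroup K L"
    using \<Gamma> K by (auto dest: finite_index_subgroupD)
  have \<Gamma>G: "group (G\<lparr>carrier := \<Gamma>\<rparr>)" using subgroup.subgroup_is_group[OF \<Gamma>s is_group] .
  interpret h: group_hom "G\<lparr>carrier := \<Gamma>\<rparr>" L h
    using \<Gamma>G L h by (simp add: group_hom_def group_hom_axioms_def)
  have hinv: "h (inv x) = inv\<^bsub>L\<^esub> h x" if "x \<in> \<Gamma>" for x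
    using h.hom_inv[of x] that m_inv_consistent[OF \<Gamma>s that] by simp
  have hmult: "h (x \<otimes> y) = h x \<otimes>\<^bsub>L\<^esub> h y" if "x \<in> \<Gamma>" "y \<in> \<Gamma>" for x y
    using h.hom_mult[of x y] that by simp
  have hcl: "h x \<in> carrier L" if "x \<in> \<Gamma>" for x using h.hom_closed that by simp
  have \<Gamma>sub: "x \<in> carrier G" if "x \<in> \<Gamma>" for x using subgroup.subset[OF \<Gamma>s] that by blast
  have sub: "subgroup {x \<in> \<Gamma>. h x \<in> K} G"
  proof (rule subgroupI)
    have "\<one> \<in> {x \<in> \<Gamma>. h x \<in> K}"
      using subgroup.one_closed[OF \<Gamma>s] subgroup.one_closed[OF Ks] h.hom_one by simp
    then show "{x \<in> \<Gamma>. h x \<in> K} \<noteq> {}" by blast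
  qed (use \<Gamma>sub hinv hmult subgroup.m_inv_closed[OF \<Gamma>s] subgroup.m_inv_closed[OF Ks]
      subgroup.m_closed[OF \<Gamma>s] subgroup.m_closed[OF Ks] in auto)
  define rep where "rep x = (SOME y. y \<in> carrier G \<and> \<Gamma> #> y = \<Gamma> #> x)" for x
  have rep: "rep x \<in> carrier G" "\<Gamma> #> rep x = \<Gamma> #> x" if "x \<in> carrier G" for x
    using someI[of "\<lambda>y. y \<in> carrier G \<and> \<Gamma> #> y = \<Gamma> #> x" x] that unfolding rep_def by auto
  define c where "c x = (\<Gamma> #> x, K #>\<^bsub>L\<^esub> h (x \<otimes> inv (rep x)))" for x
  have in\<Gamma>: "x \<otimes> inv (rep x) \<in> \<Gamma>" if "x \<in> carrier G" for x
    using rcos_eq_imp_quotient[OF \<Gamma>s that rep(1)[OF that]] rep(2)[OF that] by simp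
  show ?thesis
  proof (rule finite_index_subgroupI[where c = c, OF sub])
    have "c ` carrier G \<subseteq> ((\<lambda>x. \<Gamma> #> x) ` carrier G) \<times> ((\<lambda>x. K #>\<^bsub>L\<^esub> x) ` carrier L)"
      using in\<Gamma> hcl by (auto simp: c_def)
    then show "finite (c ` carrier G)"
      using finite_rcos_image[OF \<Gamma>] L.finite_rcos_image[OF K] finite_subset by blast
  next
    fix x y assume x: "x \<in> carrier G" and y: "y \<in> carrier G" and eq: "c x = c y"
    have reps: "rep x = rep y" using eq by (simp add: c_def rep_def)
    let ?a = "x \<otimes> inv (rep x)" and ?b = "y \<otimes> inv (rep x)"
    have a: "?a \<in> \<Gamma>" and b: "?b \<in> \<Gamma>" using in\<Gamma>[OF x] in\<Gamma>[OF y] reps by auto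
    have xy: "x \<otimes> inv y = ?a \<otimes> inv ?b"
      using x y rep(1)[OF x] by (simp add: inv_mult_group m_assoc inv_cancel_left)
    have "h ?a \<otimes>\<^bsub>L\<^esub> inv\<^bsub>L\<^esub> h ?b \<in> K"
      using L.rcos_eq_imp_quotient[OF Ks hcl[OF a] hcl[OF b]] eq reps by (simp add: c_def)
    then have "h (?a \<otimes> inv ?b) \<in> K"
      using hmult[OF a subgroup.m_inv_closed[OF \<Gamma>s b]] hinv[OF b] by simp
    then show "x \<otimes> inv y \<in> {x \<in> \<Gamma>. h x \<in> K}"
      using subgroup.m_closed[OF \<Gamma>s a subgroup.m_inv_closed[OF \<Gamma>s b]] xy by simp
  qed
qed

lemma (in group) finite_index_trans:
  assumes \<Gamma>: "finite_index_subgroup \<Gamma> G" and K: "finite_index_subgroup K (G\<lparr>carrier := \<Gamma>\<rparr>)"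
  shows "finite_index_subgroup K G"
proof -
  have "group (G\<lparr>carrier := \<Gamma>\<rparr>)"
    using subgroup.subgroup_is_group[OF finite_index_subgroupD[OF \<Gamma>] is_group] .
  moreover have "id \<in> hom (G\<lparr>carrier := \<Gamma>\<rparr>) (G\<lparr>carrier := \<Gamma>\<rparr>)" by (simp add: hom_def)
  ultimately have "finite_index_subgroup {x \<in> \<Gamma>. id x \<in> K} G"
    using finite_index_preimage[OF \<Gamma> _ _ K] by blast
  moreover have "K \<subseteq> \<Gamma>" using subgroup.subset[OF finite_index_subgroupD[OF K]] by simp
  ultimately show ?thesis by (simp add: Collect_conj_eq Int_absorb1)
qed

section \<open>Dietzmann's lemma and central extensions\<close>

primrec list_prod :: "('a, 'b) monoid_scheme \<Rightarrow> 'a list \<Rightarrow> 'a" where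
  "list_prod G [] = \<one>\<^bsub>G\<^esub>"
| "list_prod G (x # xs) = x \<otimes>\<^bsub>G\<^esub> list_prod G xs"

context group
begin

lemma list_prod_closed: "set xs \<subseteq> carrier G \<Longrightarrow> list_prod G xs \<in> carrier G"
  by (induction xs) auto

lemma list_prod_append:
  "set xs \<subseteq> carrier G \<Longrightarrow> set ys \<subseteq> carrier G \<Longrightarrow> list_prod G (xs @ ys) = list_prod G xs \<otimes> list_prod G ys"
  by (induction xs) (auto simp: m_assoc list_prod_closed)

lemma list_prod_conj:
  assumes "set xs \<subseteq> carrier G" "t \<in> carrier G"
  shows "list_prod G xs \<otimes> t = t \<otimes> list_prod G (map (\<lambda>x. inv t \<otimes> x \<otimes> t) xs)"
  using assms(1)
proof (induction xs)
  case (Cons a xs)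
  then have a: "a \<in> carrier G" and xs: "list_prod G xs \<in> carrier G" using list_prod_closed by auto
  have m: "list_prod G (map (\<lambda>x. inv t \<otimes> x \<otimes> t) xs) \<in> carrier G"
    using Cons.prems assms(2) by (intro list_prod_closed) auto
  have "list_prod G (a # xs) \<otimes> t = a \<otimes> (t \<otimes> list_prod G (map (\<lambda>x. inv t \<otimes> x \<otimes> t) xs))"
    using Cons a xs assms(2) by (simp add: m_assoc)
  also have "\<dots> = t \<otimes> (inv t \<otimes> a \<otimes> t \<otimes> list_prod G (map (\<lambda>x. inv t \<otimes> x \<otimes> t) xs))"
    using a m assms(2) by (simp add: m_assoc inv_cancel_left)
  finally show ?case by simp
qed (use assms in simp)

text \<open>Moving an occurrence of \<open>t\<close> to the front conjugates the letters it passes, which keeps the length of the word and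
stays in a set that is closed under conjugation.\<close>

lemma list_prod_collect:
  assumes T: "T \<subseteq> carrier G" and conj: "\<And>x t. x \<in> T \<Longrightarrow> t \<in> T \<Longrightarrow> inv t \<otimes> x \<otimes> t \<in> T"
    and t: "t \<in> T"
  shows "set xs \<subseteq> T \<Longrightarrow> r \<le> count_list xs t \<Longrightarrow>
    \<exists>ys. set ys \<subseteq> T \<and> length ys + r = length xs \<and> list_prod G xs = t [^] r \<otimes> list_prod G ys"
proof (induction r arbitrary: xs)
  case 0
  then show ?case using list_prod_closed T by (intro exI[of _ xs]) auto
next
  case (Suc r)
  have "t \<in> set xs" using Suc.prems(2) by (metis count_notin not_less_eq_eq zero_le)
  then obtain us vs where xs: "xs = us @ t # vs" "t \<notin> set us"
    using split_list_first by metis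
  let ?us = "map (\<lambda>x. inv t \<otimes> x \<otimes> t) us"
  have us: "set us \<subseteq> T" and vs: "set vs \<subseteq> T" and us': "set ?us \<subseteq> T"
    using Suc.prems(1) xs conj t by auto
  have tc: "t \<in> carrier G" using t T by blast
  have "r \<le> count_list (?us @ vs) t" using Suc.prems(2) xs by simp
  then obtain ys where ys: "set ys \<subseteq> T" "length ys + r = length (?us @ vs)"
    "list_prod G (?us @ vs) = t [^] r \<otimes> list_prod G ys"
    using Suc.IH[of "?us @ vs"] us' vs by (metis le_sup_iff set_append)
  have c: "list_prod G us \<in> carrier G" "list_prod G vs \<in> carrier G" "list_prod G ?us \<in> carrier G"
    "list_prod G ys \<in> carrier G"
    using us vs us' ys(1) T by (meson list_prod_closed order_trans)+
  have "list_prod G xs = list_prod G us \<otimes> (t \<otimes> list_prod G vs)"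
    using xs us vs T tc by (subst xs(1), subst list_prod_append) auto
  also have "\<dots> = (list_prod G us \<otimes> t) \<otimes> list_prod G vs" using c tc by (simp add: m_assoc)
  also have "\<dots> = t \<otimes> (list_prod G ?us \<otimes> list_prod G vs)"
    using list_prod_conj[of us t] us T tc c by (simp add: m_assoc)
  also have "\<dots> = t \<otimes> (t [^] r \<otimes> list_prod G ys)"
    using list_prod_append[of ?us vs] us' vs T ys(3) by auto
  also have "\<dots> = t [^] Suc r \<otimes> list_prod G ys"
    using tc c by (simp add: m_assoc[symmetric] nat_pow_Suc2[symmetric])
  finally show ?case using ys xs by (intro exI[of _ ys]) auto
qed

text \<open>A word longer than \<open>card T * N\<close> contains some letter at least \<open>N\<close> times; collecting \<open>N\<close> of its occurrences at the
front cancels them. So every element is represented by a word of bounded length.\<close>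

lemma dietzmann:
  assumes T: "T \<subseteq> carrier G" and conj: "\<And>x t. x \<in> T \<Longrightarrow> t \<in> T \<Longrightarrow> inv t \<otimes> x \<otimes> t \<in> T"
    and fin: "finite T" and tor: "\<And>t. t \<in> T \<Longrightarrow> t [^] N = \<one>" and N: "N \<ge> (1::nat)"
  shows "finite (generate G T)"
proof -
  define B where "B = card T * N"
  have short: "\<exists>ys. set ys \<subseteq> T \<and> length ys \<le> B \<and> list_prod G xs = list_prod G ys" if "set xs \<subseteq> T" for xs
    using that
  proof (induction "length xs" arbitrary: xs rule: less_induct)
    case less
    show ?case
    proof (cases "length xs \<le> B")
      case False
      have "\<exists>t\<in>T. N \<le> count_list xs t"
      proof (rule ccontr)
        assume "\<not> ?thesis"
        then have "\<And>t. t \<in> T \<Longrightarrow> count_list xs t \<le> N" by force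
        then have "(\<Sum>t\<in>T. count_list xs t) \<le> card T * N"
          using sum_bounded_above[of T "count_list xs" N] by simp
        moreover have "(\<Sum>t\<in>T. count_list xs t) = length xs"
          using sum_count_set[OF less.prems fin] .
        ultimately show False using False by (simp add: B_def)
      qed
      then obtain t where t: "t \<in> T" "N \<le> count_list xs t" by blast
      obtain ys where ys: "set ys \<subseteq> T" "length ys + N = length xs" "list_prod G xs = t [^] N \<otimes> list_prod G ys"
        using list_prod_collect[OF T conj t(1) less.prems t(2)] by blast
      have "list_prod G xs = list_prod G ys"
        using ys(3) tor[OF t(1)] list_prod_closed ys(1) T by simp
      then show ?thesis using less.hyps[of ys] ys(1,2) N by auto
    qed (use less.prems in auto)
  qed
  have "\<exists>xs. set xs \<subseteq> T \<and> g = list_prod G xs" if "g \<in> generate G T" for g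
    using that
  proof (induction rule: generate.induct)
    case one
    show ?case by (intro exI[of _ "[]"]) auto
  next
    case (incl h)
    then show ?case using T by (intro exI[of _ "[h]"]) auto
  next
    case (inv h)
    have hc: "h \<in> carrier G" using inv T by blast
    have p: "list_prod G (replicate k h) = h [^] k" for k
      using hc by (induction k) (auto simp: nat_pow_Suc2[symmetric])
    have "h [^] (N - 1) \<otimes> h = h [^] N" using N hc nat_pow_Suc[of h "N - 1"] by simp
    then have "inv h = h [^] (N - 1)"
      using tor[OF inv] hc by (simp add: inv_equality)
    then show ?case using p inv by (intro exI[of _ "replicate (N - 1) h"]) auto
  next
    case (eng h1 h2)
    then obtain xs ys where "set xs \<subseteq> T" "h1 = list_prod G xs" "set ys \<subseteq> T" "h2 = list_prod G ys" by blast
    then show ?case using T list_prod_append[of xs ys] by (intro exI[of _ "xs @ ys"]) auto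
  qed
  then have "generate G T \<subseteq> list_prod G ` {ys. set ys \<subseteq> T \<and> length ys \<le> B}"
    using short by blast
  then show ?thesis using finite_lists_length_le[OF fin] finite_subset by blast
qed

text \<open>If the image of \<open>K\<close> in the quotient by \<open>E\<close> commutes with the generators, a conjugate of a generator depends only
on the coset of \<open>K\<close> of the conjugating element. The conjugates of the generators are then a finite set, to which
Dietzmann's lemma applies.\<close>

lemma finite_index_of_central_quotient:
  assumes E: "E \<lhd> G" and K: "finite_index_subgroup K G"
    and S: "S \<subseteq> carrier G" "finite S" and gen: "generate G S = carrier G"
    and central: "\<And>k s. k \<in> K \<Longrightarrow> s \<in> S \<Longrightarrow> k \<otimes> s \<otimes> inv k \<otimes> inv s \<in> E"
    and tor: "\<And>s. s \<in> S \<Longrightarrow> s [^] (N::nat) \<in> E" and N: "N \<ge> 1"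
  shows "finite_index_subgroup E G"
proof -
  interpret E: normal E G by (rule E)
  let ?Q = "G Mod E"
  interpret Q: group ?Q by (rule E.factorgroup_is_group)
  interpret h: group_hom G ?Q "\<lambda>a. E #> a"
    using E.r_coset_hom_Mod by unfold_locales
  have Ks: "subgroup K G" using K by (rule finite_index_subgroupD)
  define T where "T = (\<lambda>(g, s). E #> (g \<otimes> s \<otimes> inv g)) ` (carrier G \<times> S)"
  have Tsub: "T \<subseteq> carrier ?Q"
    unfolding T_def using S by (auto intro!: h.hom_closed)
  have conj: "inv\<^bsub>?Q\<^esub> t \<otimes>\<^bsub>?Q\<^esub> x \<otimes>\<^bsub>?Q\<^esub> t \<in> T" if x: "x \<in> T" and t: "t \<in> T" for x t
  proof -
    obtain a b where ab: "a \<in> carrier G" "b \<in> S" "t = E #> (a \<otimes> b \<otimes> inv a)"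
      using t by (auto simp: T_def)
    then obtain u where u: "u \<in> carrier G" "t = E #> u"
      using S by (metis inv_closed m_closed subsetD)
    obtain g s where gs: "g \<in> carrier G" "s \<in> S" "x = E #> (g \<otimes> s \<otimes> inv g)"
      using x by (auto simp: T_def)
    have s: "s \<in> carrier G" using gs S by blast
    have "inv\<^bsub>?Q\<^esub> t \<otimes>\<^bsub>?Q\<^esub> x \<otimes>\<^bsub>?Q\<^esub> t = E #> (inv u \<otimes> (g \<otimes> s \<otimes> inv g) \<otimes> u)"
      using u gs s h.hom_mult h.hom_inv by (metis inv_closed m_closed)
    also have "inv u \<otimes> (g \<otimes> s \<otimes> inv g) \<otimes> u = (inv u \<otimes> g) \<otimes> s \<otimes> inv (inv u \<otimes> g)"
      using u gs s by (simp add: inv_mult_group m_assoc)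
    finally show ?thesis using u gs by (auto simp: T_def intro!: image_eqI[of _ _ "(inv u \<otimes> g, s)"])
  qed
  have fin: "finite T"
  proof -
    have key: "E #> (g \<otimes> s \<otimes> inv g) = E #> (g' \<otimes> s \<otimes> inv g')"
      if "g \<in> carrier G" "g' \<in> carrier G" "s \<in> S" "K #> inv g = K #> inv g'" for g g' s
    proof -
      have s: "s \<in> carrier G" using that S by blast
      define k where "k = inv g \<otimes> g'"
      have k: "k \<in> K" using rcos_eq_imp_quotient[OF Ks _ _ that(4)] that by (simp add: k_def)
      have kc: "k \<in> carrier G" using that by (simp add: k_def)
      have g': "g' = g \<otimes> k" using that by (simp add: k_def inv_cancel_left)
      let ?e = "k \<otimes> s \<otimes> inv k \<otimes> inv s"
      have e: "g \<otimes> ?e \<otimes> inv g \<in> E" using E.inv_op_closed2[OF that(1) central[OF k that(3)]] .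
      have "g' \<otimes> s \<otimes> inv g' = g \<otimes> (k \<otimes> s \<otimes> inv k) \<otimes> inv g"
        using that s kc by (simp add: g' inv_mult_group m_assoc)
      also have "k \<otimes> s \<otimes> inv k = ?e \<otimes> s" using kc s by (simp add: m_assoc)
      also have "g \<otimes> (?e \<otimes> s) \<otimes> inv g = (g \<otimes> ?e \<otimes> inv g) \<otimes> (g \<otimes> s \<otimes> inv g)"
      proof -
        have ec: "?e \<in> carrier G" using kc s by simp
        show ?thesis using that s kc by (simp add: m_assoc inv_cancel_left)
      qed
      finally have mem: "g' \<otimes> s \<otimes> inv g' \<in> E #> (g \<otimes> s \<otimes> inv g)"
        using e unfolding r_coset_def by blast
      have c: "g \<otimes> s \<otimes> inv g \<in> carrier G" using that s by simp
      show ?thesis by (rule repr_independence[OF mem c E.is_subgroup])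
    qed
    have "T \<subseteq> (\<lambda>(C, s). E #> ((SOME g. g \<in> carrier G \<and> K #> inv g = C) \<otimes> s
        \<otimes> inv (SOME g. g \<in> carrier G \<and> K #> inv g = C))) ` (((\<lambda>x. K #> x) ` carrier G) \<times> S)"
    proof
      fix x assume "x \<in> T"
      then obtain g s where gs: "g \<in> carrier G" "s \<in> S" "x = E #> (g \<otimes> s \<otimes> inv g)"
        by (auto simp: T_def)
      let ?P = "\<lambda>g'. g' \<in> carrier G \<and> K #> inv g' = K #> inv g"
      have "?P (SOME g'. ?P g')" by (rule someI[of ?P g]) (use gs in auto)
      then have "x = E #> ((SOME g'. ?P g') \<otimes> s \<otimes> inv (SOME g'. ?P g'))"
        using key[of g "SOME g'. ?P g'" s] gs by auto
      then show "x \<in> (\<lambda>(C, s). E #> ((SOME g. g \<in> carrier G \<and> K #> inv g = C) \<otimes> s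
        \<otimes> inv (SOME g. g \<in> carrier G \<and> K #> inv g = C))) ` (((\<lambda>x. K #> x) ` carrier G) \<times> S)"
        using gs by (intro image_eqI[of _ _ "(K #> inv g, s)"]) auto
    qed
    then show ?thesis using finite_rcos_image[OF K] S(2) by (meson finite_SigmaI finite_imageI finite_subset)
  qed
  have one: "E #> a = \<one>\<^bsub>?Q\<^esub>" if "a \<in> E" for a
    using E.is_subgroup that coset_join2[OF _ E.is_subgroup] E.subset by (auto simp: FactGroup_def)
  have torT: "t [^]\<^bsub>?Q\<^esub> N = \<one>\<^bsub>?Q\<^esub>" if tT: "t \<in> T" for t
  proof -
    obtain g s where gs: "g \<in> carrier G" "s \<in> S" "t = E #> (g \<otimes> s \<otimes> inv g)"
      using tT by (auto simp: T_def)
    have s: "s \<in> carrier G" using gs S by blast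
    have p: "(g \<otimes> s \<otimes> inv g) [^] n = g \<otimes> s [^] n \<otimes> inv g" for n :: nat
    proof (induction n)
      case (Suc n)
      then show ?case using gs s by (simp add: m_assoc inv_cancel_left)
    qed (use gs in simp)
    have "t [^]\<^bsub>?Q\<^esub> N = E #> ((g \<otimes> s \<otimes> inv g) [^] N)"
      using h.hom_nat_pow[of "g \<otimes> s \<otimes> inv g" N] gs s by simp
    then show ?thesis using p E.inv_op_closed2[OF gs(1) tor[OF gs(2)]] one by simp
  qed
  have "carrier ?Q = (\<lambda>a. E #> a) ` generate G S" unfolding gen by (auto simp: FactGroup_def RCOSETS_def)
  also have "\<dots> = generate ?Q ((\<lambda>a. E #> a) ` S)" using h.generate_img[OF S(1)] by (rule sym)
  also have "\<dots> \<subseteq> generate ?Q T"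
  proof (rule Q.mono_generate)
    have "E #> s \<in> T" if "s \<in> S" for s
      using that S by (auto simp: T_def intro!: image_eqI[of _ _ "(\<one>, s)"])
    then show "(\<lambda>a. E #> a) ` S \<subseteq> T" by blast
  qed
  finally have "finite (carrier ?Q)"
    using Q.dietzmann[OF Tsub conj fin torT N] finite_subset by blast
  then show ?thesis using E.is_subgroup by (simp add: finite_index_subgroup_def FactGroup_def)
qed

end

section \<open>Elementary matrices and transvections\<close>

definition dot :: "nat \<Rightarrow> (nat \<Rightarrow> int) \<Rightarrow> (nat \<Rightarrow> int) \<Rightarrow> int" where
  "dot m v u = (\<Sum>k<m. v k * u k)"

definition unit_vec_fun :: "nat \<Rightarrow> nat \<Rightarrow> int" where
  "unit_vec_fun p i = (if i = p then 1 else 0)"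

text \<open>The matrix \<open>1 + u v\<^sup>T\<close>.\<close>

definition transv :: "nat \<Rightarrow> (nat \<Rightarrow> int) \<Rightarrow> (nat \<Rightarrow> int) \<Rightarrow> int mat" where
  "transv m u v = mat m m (\<lambda>(i, j). (if i = j then 1 else 0) + u i * v j)"

definition emat :: "nat \<Rightarrow> nat \<Rightarrow> nat \<Rightarrow> int \<Rightarrow> int mat" where
  "emat m p q x = mat m m (\<lambda>(i, j). (if i = j then 1 else 0) + (if i = p \<and> j = q then x else 0))"

lemma mat_mult_index:
  assumes "A \<in> carrier_mat m m" "B \<in> carrier_mat m m" "i < m" "j < m"
  shows "(A * B) $$ (i, j) = (\<Sum>k<m. A $$ (i, k) * B $$ (k, j))"
  using assms by (auto simp: scalar_prod_def lessThan_atLeast0 intro!: sum.cong)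

text \<open>Entries of products are computed by explicit sums over indices, through \<open>mat_mult_index\<close>.\<close>

declare index_mult_mat(1) [simp del]

lemma sum_delta_mult [simp]:
  fixes f :: "nat \<Rightarrow> int" assumes "i < m"
  shows "(\<Sum>k<m. f k * (if i = k then 1 else 0)) = f i" "(\<Sum>k<m. f k * (if k = i then 1 else 0)) = f i"
    "(\<Sum>k<m. (if i = k then 1 else 0) * f k) = f i" "(\<Sum>k<m. (if k = i then 1 else 0) * f k) = f i"
proof -
  have *: "f k * (if i = k then 1 else 0) = (if k = i then f k else 0)"
    "f k * (if k = i then 1 else 0) = (if k = i then f k else 0)"
    "(if i = k then 1 else 0) * f k = (if k = i then f k else 0)"
    "(if k = i then 1 else 0) * f k = (if k = i then f k else 0)" for k by auto
  show "(\<Sum>k<m. f k * (if i = k then 1 else 0)) = f i" "(\<Sum>k<m. f k * (if k = i then 1 else 0)) = f i"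
    "(\<Sum>k<m. (if i = k then 1 else 0) * f k) = f i" "(\<Sum>k<m. (if k = i then 1 else 0) * f k) = f i"
    unfolding * using assms by simp_all
qed

lemma square_mat_eqI:
  assumes "A \<in> carrier_mat m m" "B \<in> carrier_mat m m"
    and "\<And>i j. i < m \<Longrightarrow> j < m \<Longrightarrow> A $$ (i, j) = B $$ (i, j)"
  shows "A = B"
  using assms by (intro eq_matI) auto

lemma square_mult_closed [simp]: "A \<in> carrier_mat m m \<Longrightarrow> B \<in> carrier_mat m m \<Longrightarrow> A * B \<in> carrier_mat m m"
  by (rule mult_carrier_mat)

lemma transv_carrier [simp]: "transv m u v \<in> carrier_mat m m"
  by (simp add: transv_def)

lemma elem_carrier [simp]: "emat m p q x \<in> carrier_mat m m"
  by (simp add: emat_def)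

lemma transv_index: "i < m \<Longrightarrow> j < m \<Longrightarrow> transv m u v $$ (i, j) = (if i = j then 1 else 0) + u i * v j"
  by (simp add: transv_def)

lemma elem_index: "i < m \<Longrightarrow> j < m \<Longrightarrow>
    emat m p q x $$ (i, j) = (if i = j then 1 else 0) + (if i = p \<and> j = q then x else 0)"
  by (simp add: emat_def)

lemma elem_eq_transv: "emat m p q x = transv m (\<lambda>i. x * unit_vec_fun p i) (unit_vec_fun q)"
  by (rule eq_matI) (auto simp: emat_def transv_def unit_vec_fun_def)

lemma elem_eq_transv': "emat m p q x = transv m (unit_vec_fun p) (\<lambda>i. x * unit_vec_fun q i)"
  by (rule eq_matI) (auto simp: emat_def transv_def unit_vec_fun_def)

lemma elem_zero [simp]: "emat m p q 0 = 1\<^sub>m m"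
  by (rule eq_matI) (auto simp: emat_def)

lemma transv_mult_index:
  assumes A: "A \<in> carrier_mat m m" and ij: "i < m" "j < m"
  shows "(transv m u v * A) $$ (i, j) = A $$ (i, j) + u i * dot m v (\<lambda>k. A $$ (k, j))"
proof -
  have "(transv m u v * A) $$ (i, j) = (\<Sum>k<m. (if k = i then A $$ (k, j) else 0) + u i * (v k * A $$ (k, j)))"
    using assms by (subst mat_mult_index[of _ m]) (auto simp: transv_index algebra_simps intro!: sum.cong)
  also have "\<dots> = A $$ (i, j) + u i * dot m v (\<lambda>k. A $$ (k, j))"
    using ij by (simp add: sum.distrib dot_def sum_distrib_left)
  finally show ?thesis .
qed

lemma dot_unit [simp]: "p < m \<Longrightarrow> dot m (unit_vec_fun p) u = u p" "p < m \<Longrightarrow> dot m u (unit_vec_fun p) = u p"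
  by (simp_all add: dot_def unit_vec_fun_def if_distrib[of "\<lambda>x. x * _"] if_distrib[of "\<lambda>x. _ * x"] cong: if_cong)

lemma elem_mult_index:
  assumes A: "A \<in> carrier_mat m m" and ij: "i < m" "j < m" and q: "q < m"
  shows "(emat m p q x * A) $$ (i, j) = A $$ (i, j) + (if i = p then x * A $$ (q, j) else 0)"
  unfolding elem_eq_transv using transv_mult_index[OF A ij] q by (simp add: unit_vec_fun_def[of p])

lemma transv_mult:
  "transv m u v * transv m u' v' =
   mat m m (\<lambda>(i, j). (if i = j then 1 else 0) + u i * v j + u' i * v' j + dot m v u' * u i * v' j)"
proof (rule eq_matI, goal_cases)
  case (1 i j)
  then have ij: "i < m" "j < m" by auto
  have "dot m v (\<lambda>k. transv m u' v' $$ (k, j)) = (\<Sum>k<m. (if k = j then v j else 0) + v k * u' k * v' j)"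
    unfolding dot_def using ij by (auto simp: transv_index algebra_simps intro!: sum.cong)
  also have "\<dots> = v j + dot m v u' * v' j"
    using ij by (simp add: sum.distrib dot_def sum_distrib_right)
  finally show ?case
    using ij by (simp add: transv_mult_index[OF transv_carrier ij] transv_index algebra_simps)
qed (auto simp: transv_def)

lemma transv_mult_same_left:
  assumes "dot m v u = 0"
  shows "transv m u v * transv m u v' = transv m u (\<lambda>i. v i + v' i)"
  unfolding transv_mult using assms by (intro eq_matI) (auto simp: transv_def algebra_simps)

lemma transv_mult_same_right:
  assumes "dot m v u' = 0"
  shows "transv m u v * transv m u' v = transv m (\<lambda>i. u i + u' i) v"
  unfolding transv_mult using assms by (intro eq_matI) (auto simp: transv_def algebra_simps)

lemma elem_add: "p \<noteq> q \<Longrightarrow> q < m \<Longrightarrow> emat m p q x * emat m p q y = emat m p q (x + y)"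
  by (rule square_mat_eqI[of _ m]) (auto simp: elem_mult_index elem_index intro!: square_mult_closed)

lemma det_elem: "p \<noteq> q \<Longrightarrow> det (emat m p q x) = 1"
proof -
  assume "p \<noteq> q"
  moreover have "emat m p q x = addrow_mat m x p q"
    by (rule eq_matI) (auto simp: emat_def)
  ultimately show ?thesis by (simp add: det_addrow_mat)
qed

section \<open>Subgroups of SL(m,Z) that contain elementary matrices\<close>

abbreviation SLZ :: "nat \<Rightarrow> int mat monoid" where "SLZ m \<equiv> SL m"

lemma SL_carrierD: "A \<in> carrier (SL m) \<Longrightarrow> A \<in> carrier_mat m m"
  by (simp add: SL_def)

lemma SL_mult [simp]: "A \<otimes>\<^bsub>SL m\<^esub> B = A * B"
  by (simp add: SL_def)

lemma SL_one [simp]: "\<one>\<^bsub>SL m\<^esub> = 1\<^sub>m m"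
  by (simp add: SL_def)

lemma elem_SL: "p \<noteq> q \<Longrightarrow> emat m p q x \<in> carrier (SLZ m)"
  by (simp add: SL_def det_elem)

lemma SL_inv:
  assumes "A \<in> carrier (SLZ m)"
  shows "inv\<^bsub>SL m\<^esub> A \<in> carrier_mat m m" "inv\<^bsub>SL m\<^esub> A * A = 1\<^sub>m m" "A * inv\<^bsub>SL m\<^esub> A = 1\<^sub>m m"
  using group.inv_closed[OF group_SL assms] group.l_inv[OF group_SL assms] group.r_inv[OF group_SL assms]
  by (simp_all add: SL_def)

lemma inv_elem: "p \<noteq> q \<Longrightarrow> q < m \<Longrightarrow> inv\<^bsub>SLZ m\<^esub> (emat m p q x) = emat m p q (- x)"
  by (rule group.inv_equality[OF group_SL]) (auto simp: elem_SL elem_add)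

lemma elem_pow:
  assumes "p \<noteq> q" "q < m" shows "emat m p q x [^]\<^bsub>SLZ m\<^esub> (n :: nat) = emat m p q (int n * x)"
proof -
  interpret group "SLZ m" by (rule group_SL)
  show ?thesis using assms by (induction n) (auto simp: elem_add algebra_simps)
qed

lemma elem_multiple_mem:
  assumes H: "subgroup H (SLZ m)" and pq: "p \<noteq> q" "q < m" and x: "emat m p q x \<in> H"
  shows "emat m p q (c * x) \<in> H"
proof -
  interpret group "SLZ m" by (rule group_SL)
  have n: "emat m p q (int n * x) \<in> H" for n
  proof (induction n)
    case 0
    show ?case using subgroup.one_closed[OF H] by simp
  next
    case (Suc n)
    then show ?case using subgroup.m_closed[OF H x Suc] elem_add[OF pq, of x "int n * x"]
      by (simp add: algebra_simps)
  qed
  show ?thesis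
  proof (cases "c \<ge> 0")
    case True
    then show ?thesis using n[of "nat c"] by simp
  next
    case False
    then show ?thesis using subgroup.m_inv_closed[OF H n[of "nat (- c)"]] inv_elem[OF pq] by simp
  qed
qed

lemma elem_commutator_mem:
  assumes H: "subgroup H (SLZ m)" and dist: "p \<noteq> q" "q \<noteq> r" "p \<noteq> r" and lt: "p < m" "q < m" "r < m"
    and x: "emat m p q x \<in> H" and y: "emat m q r y \<in> H"
  shows "emat m p r (x * y) \<in> H"
proof -
  interpret group "SLZ m" by (rule group_SL)
  let ?X = "emat m p q x" and ?Y = "emat m q r y" and ?Z = "emat m p r (x * y)"
  have c: "?X \<in> carrier (SLZ m)" "?Y \<in> carrier (SLZ m)" "?Z \<in> carrier (SLZ m)"
    using dist by (auto intro: elem_SL)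
  have "?X * ?Y = ?Z * (?Y * ?X)"
    using dist lt
    by (intro square_mat_eqI[of _ m])
      (auto simp: elem_mult_index[of _ m] square_mult_closed elem_index)
  then have "?X \<otimes>\<^bsub>SL m\<^esub> ?Y = ?Z \<otimes>\<^bsub>SL m\<^esub> (?Y \<otimes>\<^bsub>SL m\<^esub> ?X)" by simp
  then have "?Z = (?X \<otimes>\<^bsub>SL m\<^esub> ?Y) \<otimes>\<^bsub>SL m\<^esub> inv\<^bsub>SL m\<^esub> (?Y \<otimes>\<^bsub>SL m\<^esub> ?X)"
    using c by (metis inv_solve_right m_closed)
  then show ?thesis
    using subgroup.m_closed[OF H] subgroup.m_inv_closed[OF H] x y by metis
qed

lemma row_transv_mem:
  assumes H: "subgroup H (SLZ m)" and k: "k < m" "v k = 0"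
    and el: "\<And>j. j < m \<Longrightarrow> j \<noteq> k \<Longrightarrow> emat m k j (v j) \<in> H"
  shows "transv m (unit_vec_fun k) v \<in> H"
proof -
  have "transv m (unit_vec_fun k) (\<lambda>j. if j < r then v j else 0) \<in> H" if "r \<le> m" for r
    using that
  proof (induction r)
    case 0
    have "transv m (unit_vec_fun k) (\<lambda>j. if j < 0 then v j else 0) = 1\<^sub>m m"
      by (rule eq_matI) (auto simp: transv_def)
    then show ?case using subgroup.one_closed[OF H] by simp
  next
    case (Suc r)
    have "emat m k r (v r) \<in> H"
      using el[of r] Suc.prems k subgroup.one_closed[OF H] by (cases "r = k") auto
    then have "transv m (unit_vec_fun k) (\<lambda>j. if j < r then v j else 0) * emat m k r (v r) \<in> H"
      using subgroup.m_closed[OF H Suc.IH] Suc.prems by simp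
    moreover have "transv m (unit_vec_fun k) (\<lambda>j. if j < r then v j else 0) * emat m k r (v r)
        = transv m (unit_vec_fun k) (\<lambda>j. if j < Suc r then v j else 0)"
      unfolding elem_eq_transv' using k
      by (subst transv_mult_same_left)
        (auto simp: unit_vec_fun_def[of r] less_Suc_eq intro!: arg_cong[of _ _ "transv m _"])
    ultimately show ?case by simp
  qed
  from this[of m] have "transv m (unit_vec_fun k) (\<lambda>j. if j < m then v j else 0) \<in> H" by simp
  moreover have "transv m (unit_vec_fun k) (\<lambda>j. if j < m then v j else 0) = transv m (unit_vec_fun k) v"
    by (rule eq_matI) (auto simp: transv_def)
  ultimately show ?thesis by simp
qed

lemma column_transv_mem:
  assumes H: "subgroup H (SLZ m)" and k: "k < m" "u k = 0"
    and el: "\<And>j. j < m \<Longrightarrow> j \<noteq> k \<Longrightarrow> emat m j k (u j) \<in> H"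
  shows "transv m u (unit_vec_fun k) \<in> H"
proof -
  have "transv m (\<lambda>j. if j < r then u j else 0) (unit_vec_fun k) \<in> H" if "r \<le> m" for r
    using that
  proof (induction r)
    case 0
    have "transv m (\<lambda>j. if j < 0 then u j else 0) (unit_vec_fun k) = 1\<^sub>m m"
      by (rule eq_matI) (auto simp: transv_def)
    then show ?case using subgroup.one_closed[OF H] by simp
  next
    case (Suc r)
    have e: "emat m r k (u r) \<in> H"
      using el[of r] Suc.prems k subgroup.one_closed[OF H] by (cases "r = k") auto
    then have "transv m (\<lambda>j. if j < r then u j else 0) (unit_vec_fun k) * emat m r k (u r) \<in> H"
      using subgroup.m_closed[OF H Suc.IH] Suc.prems by simp
    moreover have "transv m (\<lambda>j. if j < r then u j else 0) (unit_vec_fun k) * emat m r k (u r)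
        = transv m (\<lambda>j. if j < Suc r then u j else 0) (unit_vec_fun k)"
      unfolding elem_eq_transv using k
      by (subst transv_mult_same_right)
        (auto simp: unit_vec_fun_def[of r] less_Suc_eq intro!: arg_cong[of _ _ "\<lambda>u. transv m u _"])
    ultimately show ?case by simp
  qed
  from this[of m] have "transv m (\<lambda>j. if j < m then u j else 0) (unit_vec_fun k) \<in> H" by simp
  moreover have "transv m (\<lambda>j. if j < m then u j else 0) (unit_vec_fun k) = transv m u (unit_vec_fun k)"
    by (rule eq_matI) (auto simp: transv_def)
  ultimately show ?thesis by simp
qed

section \<open>Transvections along unimodular vectors\<close>

text \<open>Since \<open>v\<close> vanishes at \<open>k\<close>, the part \<open>u'\<close> of \<open>u\<close> away from \<open>k\<close> is still orthogonal to \<open>v\<close>, and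
\<open>1 + N\<^sup>2 u' v\<^sup>T\<close> is the commutator of the column matrix \<open>1 + N u' e\<^sub>k\<^sup>T\<close> and the row matrix
\<open>1 + N e\<^sub>k v\<^sup>T\<close>. The part of \<open>u\<close> at \<open>k\<close> contributes another row matrix.\<close>

lemma transv_mem_zero_coord:
  fixes N :: int
  assumes H: "subgroup H (SLZ m)"
    and el: "\<And>p q x. p < m \<Longrightarrow> q < m \<Longrightarrow> p \<noteq> q \<Longrightarrow> emat m p q (N * x) \<in> H"
    and k: "k < m" "v k = 0" and orth: "dot m v u = 0"
  shows "transv m (\<lambda>i. N * N * u i) v \<in> H"
proof -
  interpret group "SLZ m" by (rule group_SL)
  define u' where "u' i = (if i = k then 0 else u i)" for i
  have u'k: "u' k = 0" by (simp add: u'_def)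
  have orth': "dot m v u' = 0"
  proof -
    have "dot m v u' = dot m v u" unfolding dot_def using k by (intro sum.cong) (auto simp: u'_def)
    then show ?thesis using orth by simp
  qed
  let ?A = "transv m (\<lambda>i. N * u' i) (unit_vec_fun k)" and ?B = "transv m (unit_vec_fun k) (\<lambda>i. N * v i)"
  let ?X = "transv m (\<lambda>i. N * N * u' i) v" and ?Y = "transv m (\<lambda>i. N * N * u k * unit_vec_fun k i) v"
  have A: "?A \<in> H" by (rule column_transv_mem[OF H k(1)]) (use u'k k el in auto)
  have B: "?B \<in> H" by (rule row_transv_mem[OF H k(1)]) (use k el in auto)
  have cA: "?A \<in> carrier (SL m)" and cB: "?B \<in> carrier (SL m)" using A B subgroup.subset[OF H] by auto
  have dsc: "dot m (\<lambda>i. a * f i) g = a * dot m f g" "dot m f (\<lambda>i. a * g i) = a * dot m f g" for a f g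
    by (simp_all add: dot_def sum_distrib_left algebra_simps)
  have BA: "?B * ?A = mat m m (\<lambda>(i,j). (if i = j then 1 else 0) + unit_vec_fun k i * (N * v j)
      + N * u' i * unit_vec_fun k j)"
    unfolding transv_mult using orth' by (simp add: dsc)
  have AB: "?A * ?B = mat m m (\<lambda>(i,j). (if i = j then 1 else 0) + N * u' i * unit_vec_fun k j
      + unit_vec_fun k i * (N * v j) + N * u' i * (N * v j))"
    unfolding transv_mult using k(1) by (simp add: unit_vec_fun_def[of k k])
  have "?X * (?B * ?A) = ?A * ?B"
  proof (rule eq_matI)
    fix i j assume "i < dim_row (?A * ?B)" "j < dim_col (?A * ?B)"
    then have ij: "i < m" "j < m" by (auto simp: transv_def)
    have "dot m v (\<lambda>l. (?B * ?A) $$ (l, j)) = dot m v (\<lambda>l. unit_vec_fun j l)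
       + dot m v (\<lambda>l. N * v j * unit_vec_fun k l) + dot m v (\<lambda>l. N * unit_vec_fun k j * u' l)"
      unfolding dot_def sum.distrib[symmetric] using ij
      by (intro sum.cong) (auto simp: BA unit_vec_fun_def algebra_simps)
    also have "\<dots> = v j" using ij k orth' by (simp add: dsc)
    finally have d: "dot m v (\<lambda>l. (?B * ?A) $$ (l, j)) = v j" .
    have c: "?B * ?A \<in> carrier_mat m m" by (simp add: BA)
    show "(?X * (?B * ?A)) $$ (i, j) = (?A * ?B) $$ (i, j)"
      unfolding transv_mult_index[OF c ij] d using ij by (simp add: BA AB algebra_simps)
  qed (auto simp: transv_def)
  then have "?X * (?B * ?A) * inv\<^bsub>SL m\<^esub> (?B * ?A) = ?A * ?B * inv\<^bsub>SL m\<^esub> (?B * ?A)" by simp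
  moreover have BAc: "?B * ?A \<in> carrier (SL m)" using m_closed[OF cB cA] by simp
  have "?X * (?B * ?A) * inv\<^bsub>SL m\<^esub> (?B * ?A) = ?X"
    using SL_inv[OF BAc] SL_carrierD[OF BAc] by (metis assoc_mult_mat right_mult_one_mat transv_carrier)
  ultimately have X: "?X \<in> H"
    using subgroup.m_closed[OF H] subgroup.m_inv_closed[OF H] A B by (metis SL_mult)
  have "?Y = transv m (unit_vec_fun k) (\<lambda>i. N * (N * u k * v i))"
    by (rule eq_matI) (auto simp: transv_def algebra_simps)
  then have Y: "?Y \<in> H" using row_transv_mem[OF H k(1)] el k by simp
  have "?X * ?Y = transv m (\<lambda>i. N * N * u' i + N * N * u k * unit_vec_fun k i) v"
    by (rule transv_mult_same_right) (use k in \<open>simp add: dsc\<close>)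
  also have "(\<lambda>i. N * N * u' i + N * N * u k * unit_vec_fun k i) = (\<lambda>i. N * N * u i)"
    by (auto simp: u'_def unit_vec_fun_def)
  finally show ?thesis using subgroup.m_closed[OF H X Y] by simp
qed

text \<open>A vector orthogonal to a unimodular \<open>u\<close> is a combination of the vectors \<open>u\<^sub>i e\<^sub>j - u\<^sub>j e\<^sub>i\<close>. For \<open>m \<ge> 3\<close> each
of these has a zero coordinate, and transvections with the same \<open>u\<close> multiply by adding the second vectors.\<close>

lemma transv_mem:
  fixes N :: int
  assumes m: "m \<ge> 3" and H: "subgroup H (SLZ m)"
    and el: "\<And>p q x. p < m \<Longrightarrow> q < m \<Longrightarrow> p \<noteq> q \<Longrightarrow> emat m p q (N * x) \<in> H"
    and uni: "dot m a u = 1" and orth: "dot m v u = 0"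
  shows "transv m (\<lambda>i. N * N * u i) v \<in> H"
proof -
  let ?P = "\<lambda>v. dot m v u = 0 \<and> transv m (\<lambda>i. N * N * u i) v \<in> H"
  have add: "?P (\<lambda>i. v i + w i)" if "?P v" "?P w" for v w
  proof
    show "dot m (\<lambda>i. v i + w i) u = 0"
      using that by (simp add: dot_def algebra_simps sum.distrib)
    have "dot m v (\<lambda>i. N * N * u i) = N * N * dot m v u"
      by (simp add: dot_def sum_distrib_left algebra_simps)
    then have "transv m (\<lambda>i. N * N * u i) v * transv m (\<lambda>i. N * N * u i) w
        = transv m (\<lambda>i. N * N * u i) (\<lambda>i. v i + w i)"
      using that by (intro transv_mult_same_left) simp
    then show "transv m (\<lambda>i. N * N * u i) (\<lambda>i. v i + w i) \<in> H"
      using that subgroup.m_closed[OF H] by (metis SL_mult)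
  qed
  have zero: "?P (\<lambda>i. 0)"
  proof -
    have "transv m (\<lambda>i. N * N * u i) (\<lambda>i. 0) = 1\<^sub>m m" by (rule eq_matI) (auto simp: transv_def)
    then show ?thesis using subgroup.one_closed[OF H] by (simp add: dot_def)
  qed
  define b where "b = (\<lambda>(i, j) l. a i * v j * (u i * unit_vec_fun j l - u j * unit_vec_fun i l))"
  have b: "?P (b (i, j))" if ij: "i < m" "j < m" for i j
  proof -
    have d: "dot m (b (i, j)) u = a i * v j * (u i * dot m (unit_vec_fun j) u - u j * dot m (unit_vec_fun i) u)"
      by (simp add: b_def dot_def sum_distrib_left sum_subtractf algebra_simps)
    then have d0: "dot m (b (i, j)) u = 0" using ij by simp
    have "card {i, j} < card {..<m}" using m card_insert_le_m1[of 2 "{j}" i] by simp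
    then obtain k where k: "k < m" "k \<notin> {i, j}"
      by (metis card_mono finite.emptyI finite_insert lessThan_iff not_le subsetI)
    then have "b (i, j) k = 0" by (auto simp: b_def unit_vec_fun_def)
    then show ?thesis using transv_mem_zero_coord[OF H el k(1) _ d0] d0 by blast
  qed
  have "?P (\<lambda>l. \<Sum>ij\<in>S. b ij l)" if "finite S" "S \<subseteq> {..<m} \<times> {..<m}" for S
    using that
  proof (induction S rule: finite_induct)
    case (insert x S)
    then have "?P (b x)" using b[of "fst x" "snd x"] by auto
    with insert show ?case using add[of "b x" "\<lambda>l. \<Sum>ij\<in>S. b ij l"] by simp
  qed (use zero in simp)
  from this[of "{..<m} \<times> {..<m}"]
  have "transv m (\<lambda>i. N * N * u i) (\<lambda>l. \<Sum>ij\<in>{..<m} \<times> {..<m}. b ij l) \<in> H" by simp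
  moreover have "(\<Sum>ij\<in>{..<m} \<times> {..<m}. b ij l) = v l" if "l < m" for l
  proof -
    have "(\<Sum>ij\<in>{..<m} \<times> {..<m}. b ij l) = (\<Sum>i<m. \<Sum>j<m. b (i, j) l)"
      by (simp add: sum.cartesian_product)
    also have "\<dots> = (\<Sum>i<m. \<Sum>j<m. (a i * u i) * (v j * unit_vec_fun l j) - (a i * unit_vec_fun l i) * (v j * u j))"
      by (intro sum.cong) (auto simp: b_def unit_vec_fun_def algebra_simps)
    also have "\<dots> = (\<Sum>i<m. \<Sum>j<m. (a i * u i) * (v j * unit_vec_fun l j)) - (\<Sum>i<m. \<Sum>j<m. (a i * unit_vec_fun l i) * (v j * u j))"
      by (simp only: sum_subtractf)
    also have "\<dots> = dot m a u * dot m v (unit_vec_fun l) - dot m a (unit_vec_fun l) * dot m v u"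
      by (simp add: dot_def sum_product)
    finally show ?thesis using uni orth that by simp
  qed
  then have "transv m (\<lambda>i. N * N * u i) (\<lambda>l. \<Sum>ij\<in>{..<m} \<times> {..<m}. b ij l) = transv m (\<lambda>i. N * N * u i) v"
    by (intro eq_matI) (auto simp: transv_def)
  ultimately show ?thesis by simp
qed

lemma conj_elem:
  assumes A: "A \<in> carrier_mat m m" and B: "B \<in> carrier_mat m m" and AB: "A * B = 1\<^sub>m m"
    and st: "s < m" "t < m"
  shows "A * emat m s t x * B = transv m (\<lambda>i. x * A $$ (i, s)) (\<lambda>j. B $$ (t, j))"
proof (rule eq_matI)
  fix i j assume "i < dim_row (transv m (\<lambda>i. x * A $$ (i, s)) (\<lambda>j. B $$ (t, j)))"
    "j < dim_col (transv m (\<lambda>i. x * A $$ (i, s)) (\<lambda>j. B $$ (t, j)))"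
  then have ij: "i < m" "j < m" by (auto simp: transv_def)
  have "(A * emat m s t x * B) $$ (i, j) = (A * (emat m s t x * B)) $$ (i, j)"
    using A B by (subst assoc_mult_mat[of _ m m _ m _ m]) auto
  also have "\<dots> = (\<Sum>k<m. A $$ (i, k) * (B $$ (k, j) + (if k = s then x * B $$ (t, j) else 0)))"
    using A B ij st by (subst mat_mult_index[of _ m]) (auto simp: elem_mult_index square_mult_closed intro!: sum.cong)
  also have "\<dots> = (\<Sum>k<m. A $$ (i, k) * B $$ (k, j)) + (\<Sum>k<m. if k = s then A $$ (i, s) * (x * B $$ (t, j)) else 0)"
    unfolding sum.distrib[symmetric] by (intro sum.cong) (auto simp: algebra_simps)
  also have "(\<Sum>k<m. A $$ (i, k) * B $$ (k, j)) = (A * B) $$ (i, j)"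
    using A B ij by (simp add: mat_mult_index[of _ m])
  finally show "(A * emat m s t x * B) $$ (i, j) = transv m (\<lambda>i. x * A $$ (i, s)) (\<lambda>j. B $$ (t, j)) $$ (i, j)"
    using AB ij st by (simp add: transv_index)
qed (use A B in \<open>auto simp: transv_def\<close>)

text \<open>A conjugate of an elementary matrix is the transvection given by a column of \<open>g\<close> and a row of its inverse. The
factor \<open>N\<^sup>2\<close> instead of \<open>N\<close> is what allows \<open>H\<close> to be an arbitrary, not necessarily normal, subgroup.\<close>

lemma conj_elem_mem:
  fixes N :: int
  assumes m: "m \<ge> 3" and H: "subgroup H (SLZ m)"
    and el: "\<And>p q x. p < m \<Longrightarrow> q < m \<Longrightarrow> p \<noteq> q \<Longrightarrow> emat m p q (N * x) \<in> H"
    and g: "g \<in> carrier (SLZ m)" and st: "s < m" "t < m" "s \<noteq> t"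
  shows "g * emat m s t (N * N * x) * inv\<^bsub>SL m\<^esub> g \<in> H"
proof -
  let ?W = "inv\<^bsub>SL m\<^esub> g"
  have gc: "g \<in> carrier_mat m m" using g by (rule SL_carrierD)
  have Wg: "dot m (\<lambda>k. ?W $$ (r, k)) (\<lambda>k. g $$ (k, s)) = (if r = s then 1 else 0)" if "r < m" for r
    using mat_mult_index[OF SL_inv(1)[OF g] gc that st(1)] SL_inv(2)[OF g] that st by (simp add: dot_def)
  have "transv m (\<lambda>i. N * N * g $$ (i, s)) (\<lambda>j. x * ?W $$ (t, j)) \<in> H"
  proof (rule transv_mem[OF m H el])
    show "dot m (\<lambda>k. ?W $$ (s, k)) (\<lambda>k. g $$ (k, s)) = 1" using Wg[OF st(1)] by simp
    have "dot m (\<lambda>j. x * ?W $$ (t, j)) (\<lambda>k. g $$ (k, s)) = x * dot m (\<lambda>j. ?W $$ (t, j)) (\<lambda>k. g $$ (k, s))"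
      by (simp add: dot_def sum_distrib_left algebra_simps)
    then show "dot m (\<lambda>j. x * ?W $$ (t, j)) (\<lambda>k. g $$ (k, s)) = 0" using Wg[OF st(2)] st by simp
  qed
  moreover have "g * emat m s t (N * N * x) * ?W = transv m (\<lambda>i. N * N * g $$ (i, s)) (\<lambda>j. x * ?W $$ (t, j))"
    unfolding conj_elem[OF gc SL_inv(1)[OF g] SL_inv(3)[OF g] st(1,2)]
    by (rule eq_matI) (auto simp: transv_def algebra_simps)
  ultimately show ?thesis by simp
qed

section \<open>The group generated by elementary matrices\<close>

definition elem_group :: "nat \<Rightarrow> int mat set" where
  "elem_group m = generate (SL m) {emat m p q 1 | p q. p < m \<and> q < m \<and> p \<noteq> q}"

lemma elem_group_subgroup: "subgroup (elem_group m) (SL m)"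
  unfolding elem_group_def
  by (rule group.generate_is_subgroup[OF group_SL]) (auto intro: elem_SL)

lemma elem_group_elem: "p < m \<Longrightarrow> q < m \<Longrightarrow> p \<noteq> q \<Longrightarrow> emat m p q x \<in> elem_group m"
proof -
  assume pq: "p < m" "q < m" "p \<noteq> q"
  then have "emat m p q 1 \<in> elem_group m" unfolding elem_group_def by (intro generate.incl) blast
  then show ?thesis using elem_multiple_mem[OF elem_group_subgroup pq(3,2), of 1 x] by simp
qed

lemma elem_group_SL: "E \<in> elem_group m \<Longrightarrow> E \<in> carrier (SL m)"
  using subgroup.subset[OF elem_group_subgroup] by blast

lemma elem_group_carrier: "E \<in> elem_group m \<Longrightarrow> E \<in> carrier_mat m m"
  using elem_group_SL SL_carrierD by blast

lemma elem_group_mult: "E \<in> elem_group m \<Longrightarrow> F \<in> elem_group m \<Longrightarrow> E * F \<in> elem_group m"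
  using subgroup.m_closed[OF elem_group_subgroup] by simp

text \<open>The Euclidean algorithm on the rows from \<open>r\<close> on. Columns that vanish in these rows are not touched, so that columns
reduced earlier stay reduced.\<close>

lemma euclid_column:
  assumes A: "A \<in> carrier_mat m m" and c: "c < m" and r: "r < m"
  shows "\<exists>E\<in>elem_group m. (\<forall>j. r < j \<longrightarrow> j < m \<longrightarrow> (E * A) $$ (j, c) = 0) \<and>
    (\<forall>c'<m. (\<forall>j. r \<le> j \<longrightarrow> j < m \<longrightarrow> A $$ (j, c') = 0) \<longrightarrow> (\<forall>i<m. (E * A) $$ (i, c') = A $$ (i, c')))"
  using A
proof (induction "\<Sum>j\<in>{r..<m}. nat \<bar>A $$ (j, c)\<bar>" arbitrary: A rule: less_induct)
  case less
  note A = less.prems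
  have one: "1\<^sub>m m \<in> elem_group m" using subgroup.one_closed[OF elem_group_subgroup] by simp
  have op: "(emat m p q x * B) $$ (i, c') = B $$ (i, c')"
    if "B \<in> carrier_mat m m" "\<forall>j. r \<le> j \<longrightarrow> j < m \<longrightarrow> B $$ (j, c') = 0" "r \<le> q" "q < m" "i < m" "c' < m" for B p q x i c'
    using that by (simp add: elem_mult_index)
  show ?case
  proof (cases "\<exists>p q. r \<le> p \<and> p < m \<and> r \<le> q \<and> q < m \<and> p \<noteq> q \<and> A $$ (p, c) \<noteq> 0 \<and> A $$ (q, c) \<noteq> 0")
    case True
    then obtain p q where pq: "r \<le> p" "p < m" "r \<le> q" "q < m" "p \<noteq> q"
      "A $$ (p, c) \<noteq> 0" "A $$ (q, c) \<noteq> 0" "\<bar>A $$ (q, c)\<bar> \<le> \<bar>A $$ (p, c)\<bar>"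
      by (metis linear)
    define x where "x = - sgn (A $$ (p, c)) * sgn (A $$ (q, c))"
    define B where "B = emat m p q x * A"
    have Bc: "B \<in> carrier_mat m m" using A by (auto simp: B_def)
    have Bi: "B $$ (i, j) = A $$ (i, j) + (if i = p then x * A $$ (q, j) else 0)" if "i < m" "j < m" for i j
      using elem_mult_index[OF A that pq(4)] by (simp add: B_def)
    have lt: "nat \<bar>B $$ (p, c)\<bar> < nat \<bar>A $$ (p, c)\<bar>"
      using pq c by (auto simp: Bi x_def sgn_if)
    have "(\<Sum>j\<in>{r..<m}. nat \<bar>B $$ (j, c)\<bar>) < (\<Sum>j\<in>{r..<m}. nat \<bar>A $$ (j, c)\<bar>)"
    proof (rule sum_strict_mono_ex1)
      show "\<forall>j\<in>{r..<m}. nat \<bar>B $$ (j, c)\<bar> \<le> nat \<bar>A $$ (j, c)\<bar>"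
        using lt Bi c by auto
      show "\<exists>j\<in>{r..<m}. nat \<bar>B $$ (j, c)\<bar> < nat \<bar>A $$ (j, c)\<bar>"
        using lt pq by (intro bexI[of _ p]) auto
    qed simp
    from less.hyps[OF this Bc] obtain E where E: "E \<in> elem_group m"
      "\<And>j. r < j \<Longrightarrow> j < m \<Longrightarrow> (E * B) $$ (j, c) = 0"
      "\<And>c' i. c' < m \<Longrightarrow> (\<forall>j. r \<le> j \<longrightarrow> j < m \<longrightarrow> B $$ (j, c') = 0) \<Longrightarrow> i < m \<Longrightarrow> (E * B) $$ (i, c') = B $$ (i, c')"
      by blast
    have EB: "E * B = E * emat m p q x * A"
      unfolding B_def using elem_group_carrier[OF E(1)] A by (subst assoc_mult_mat[of _ m m _ m _ m]) auto
    show ?thesis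
    proof (intro bexI[of _ "E * emat m p q x"] conjI allI impI)
      show "E * emat m p q x \<in> elem_group m"
        using elem_group_mult[OF E(1) elem_group_elem[of p m q]] pq by simp
      show "(E * emat m p q x * A) $$ (j, c) = 0" if "r < j" "j < m" for j
        using E(2)[OF that] EB by simp
      fix c' i assume z: "c' < m" "\<forall>j. r \<le> j \<longrightarrow> j < m \<longrightarrow> A $$ (j, c') = 0" "i < m"
      have B0: "B $$ (i', c') = A $$ (i', c')" if "i' < m" for i'
        using Bi[OF that z(1)] z(2) pq by simp
      show "(E * emat m p q x * A) $$ (i, c') = A $$ (i, c')"
        unfolding EB[symmetric] using E(3)[OF z(1) _ z(3)] B0 z by simp
    qed
  next
    case False
    show ?thesis
    proof (cases "\<exists>p. r < p \<and> p < m \<and> A $$ (p, c) \<noteq> 0")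
      case False
      then show ?thesis using one A by (intro bexI[of _ "1\<^sub>m m"]) auto
    next
      case True
      then obtain p where p: "r < p" "p < m" "A $$ (p, c) \<noteq> 0" by blast
      have z: "A $$ (j, c) = 0" if "r \<le> j" "j < m" "j \<noteq> p" for j
        using False p that by (meson less_imp_le)
      define B where "B = emat m r p 1 * A"
      have Bc: "B \<in> carrier_mat m m" using A by (auto simp: B_def)
      have EB: "emat m p r (-1) * B = emat m p r (-1) * emat m r p 1 * A"
        unfolding B_def using A by (subst assoc_mult_mat[of _ m m _ m _ m]) auto
      have Bi: "B $$ (i, j) = A $$ (i, j) + (if i = r then A $$ (p, j) else 0)" if "i < m" "j < m" for i j
        using elem_mult_index[OF A that p(2)] by (simp add: B_def)
      have Ci: "(emat m p r (-1) * B) $$ (i, j) = B $$ (i, j) - (if i = p then B $$ (r, j) else 0)" if "i < m" "j < m" for i j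
        using elem_mult_index[OF Bc that r] by simp
      show ?thesis
      proof (intro bexI[of _ "emat m p r (-1) * emat m r p 1"] conjI allI impI)
        show "emat m p r (-1) * emat m r p 1 \<in> elem_group m"
          using p r by (intro elem_group_mult elem_group_elem) auto
        show "(emat m p r (-1) * emat m r p 1 * A) $$ (j, c) = 0" if "r < j" "j < m" for j
          unfolding EB[symmetric] using that c r p z by (simp add: Ci Bi)
        fix c' i assume "c' < m" "\<forall>j. r \<le> j \<longrightarrow> j < m \<longrightarrow> A $$ (j, c') = 0" "i < m"
        then show "(emat m p r (-1) * emat m r p 1 * A) $$ (i, c') = A $$ (i, c')"
          unfolding EB[symmetric] using r p by (simp add: Ci Bi)
      qed
    qed
  qed
qed

text \<open>The pivot is a unit because row \<open>r\<close> of the inverse matrix vanishes at the columns reduced before, so its product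
with column \<open>r\<close> has a single term, and this term is \<open>1\<close>.\<close>

lemma elem_group_reduce:
  assumes A: "A \<in> carrier (SLZ m)"
  shows "r \<le> m \<Longrightarrow> \<exists>E\<in>elem_group m. \<forall>j<r. \<forall>i<m.
    if i = j then \<bar>(E * A) $$ (i, j)\<bar> = 1 else (E * A) $$ (i, j) = 0"
proof (induction r)
  case 0
  show ?case using subgroup.one_closed[OF elem_group_subgroup] by auto
next
  case (Suc r)
  then have r: "r < m" by simp
  obtain E where E: "E \<in> elem_group m"
    "\<And>i j. j < r \<Longrightarrow> i < m \<Longrightarrow> i \<noteq> j \<Longrightarrow> (E * A) $$ (i, j) = 0"
    "\<And>j. j < r \<Longrightarrow> \<bar>(E * A) $$ (j, j)\<bar> = 1"
    using Suc by (metis Suc_leD less_le_trans)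
  have Ac: "A \<in> carrier_mat m m" using A by (rule SL_carrierD)
  define B where "B = E * A"
  have Bc: "B \<in> carrier_mat m m" using elem_group_carrier[OF E(1)] Ac by (auto simp: B_def)
  obtain F where F: "F \<in> elem_group m"
    "\<And>j. r < j \<Longrightarrow> j < m \<Longrightarrow> (F * B) $$ (j, r) = 0"
    "\<And>c' i. c' < m \<Longrightarrow> (\<forall>j. r \<le> j \<longrightarrow> j < m \<longrightarrow> B $$ (j, c') = 0) \<Longrightarrow> i < m \<Longrightarrow> (F * B) $$ (i, c') = B $$ (i, c')"
    using euclid_column[OF Bc r r] by blast
  define C where "C = F * B"
  have Cc: "C \<in> carrier_mat m m" using elem_group_carrier[OF F(1)] Bc by (auto simp: C_def)
  have CSL: "C \<in> carrier (SLZ m)"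
  proof -
    interpret group "SLZ m" by (rule group_SL)
    show ?thesis using m_closed[OF elem_group_SL[OF F(1)] m_closed[OF elem_group_SL[OF E(1)] A]]
      by (simp add: C_def B_def)
  qed
  have Ccol: "C $$ (i, j) = B $$ (i, j)" if "j < r" "i < m" for i j
    unfolding C_def using that E(2) r by (intro F(3)) (auto simp: B_def)
  let ?W = "inv\<^bsub>SL m\<^esub> C"
  have WC: "(\<Sum>k<m. ?W $$ (r, k) * C $$ (k, j)) = (if r = j then 1 else 0)" if "j < m" for j
    using mat_mult_index[OF SL_inv(1)[OF CSL] Cc r that] SL_inv(2)[OF CSL] r that by simp
  have W0: "?W $$ (r, j) = 0" if "j < r" for j
  proof -
    have "(\<Sum>k<m. ?W $$ (r, k) * C $$ (k, j)) = (\<Sum>k<m. if k = j then ?W $$ (r, j) * C $$ (j, j) else 0)"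
      using that E(2) r Ccol by (intro sum.cong) (auto simp: B_def)
    then show ?thesis using WC[of j] that r E(3)[of j] Ccol[of j j] by (auto simp: B_def)
  qed
  have "(\<Sum>k<m. ?W $$ (r, k) * C $$ (k, r)) = (\<Sum>k<m. if k = r then ?W $$ (r, r) * C $$ (r, r) else 0)"
    using W0 F(2) by (intro sum.cong) (auto simp: C_def not_less, metis linorder_neqE_nat)
  then have "?W $$ (r, r) * C $$ (r, r) = 1" using WC[of r] r by simp
  then have d: "\<bar>C $$ (r, r)\<bar> = 1" by (metis dvd_triv_right zdvd1_eq)
  define w where "w i = (if i < r then - C $$ (r, r) * C $$ (i, r) else 0)" for i
  define T where "T = transv m w (unit_vec_fun r)"
  have T: "T \<in> elem_group m"
    unfolding T_def using subgroup.one_closed[OF elem_group_subgroup]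
    by (intro column_transv_mem[OF elem_group_subgroup r]) (auto simp: w_def r intro: elem_group_elem)
  have Ti: "(T * C) $$ (i, j) = C $$ (i, j) + w i * C $$ (r, j)" if "i < m" "j < m" for i j
    unfolding T_def transv_mult_index[OF Cc that] using r by simp
  have dd: "C $$ (r, r) * C $$ (r, r) = 1" using d by (auto simp: abs_if split: if_splits)
  have TC: "T * C = T * F * E * A"
    unfolding C_def B_def
    using elem_group_carrier[OF T] elem_group_carrier[OF F(1)] elem_group_carrier[OF E(1)] Ac
    by (simp add: assoc_mult_mat[of _ m m _ m _ m] square_mult_closed)
  show ?case
  proof (intro bexI[of _ "T * F * E"] allI impI)
    show "T * F * E \<in> elem_group m" using T F(1) E(1) by (intro elem_group_mult)
    fix j i assume ji: "j < Suc r" "i < m"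
    show "if i = j then \<bar>(T * F * E * A) $$ (i, j)\<bar> = 1 else (T * F * E * A) $$ (i, j) = 0"
    proof (cases "j = r")
      case True
      have "C $$ (i, r) + w i * C $$ (r, r) = (if i = r then C $$ (r, r) else 0)"
        using dd F(2)[of i] ji(2) by (auto simp: w_def C_def[symmetric] algebra_simps mult.assoc[symmetric])
      then show ?thesis using d True Ti[OF ji(2) r] by (auto simp: TC)
    next
      case False
      then have jr: "j < r" using ji by simp
      then have "C $$ (r, j) = 0" using Ccol[OF jr r] E(2)[OF jr r] by (simp add: B_def)
      then have "(T * F * E * A) $$ (i, j) = B $$ (i, j)"
        using Ti[of i j] ji jr r Ccol[OF jr ji(2)] by (simp add: TC)
      then show ?thesis using E(2,3) jr ji by (auto simp: B_def)
    qed
  qed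
qed

text \<open>Up to elementary matrices only the finitely many diagonal matrices with entries \<open>\<plusminus>1\<close> remain.\<close>

lemma elem_group_finite_index: "finite_index_subgroup (elem_group m) (SLZ m)"
proof -
  interpret group "SLZ m" by (rule group_SL)
  define P where "P A E \<longleftrightarrow> E \<in> elem_group m \<and> (\<forall>j<m. \<forall>i<m.
    if i = j then \<bar>(E * A) $$ (i, j)\<bar> = 1 else (E * A) $$ (i, j) = 0)" for A E :: "int mat"
  define e where "e A = (SOME E. P A E)" for A
  have e: "P A (e A)" if "A \<in> carrier (SLZ m)" for A
    unfolding e_def using elem_group_reduce[OF that, of m] by (intro someI_ex[of "P A"]) (auto simp: P_def)
  show ?thesis
  proof (rule finite_index_subgroupI[where c = "\<lambda>A. e A * A", OF elem_group_subgroup])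
    have "(\<lambda>A. e A * A) ` carrier (SLZ m) \<subseteq>
      (\<lambda>f. mat m m f) ` (({..<m} \<times> {..<m}) \<rightarrow>\<^sub>E {-1, 0, 1})"
    proof
      fix D assume "D \<in> (\<lambda>A. e A * A) ` carrier (SLZ m)"
      then obtain A where A: "A \<in> carrier (SLZ m)" "D = e A * A" by blast
      have Dc: "D \<in> carrier_mat m m"
        using e[OF A(1)] elem_group_carrier SL_carrierD[OF A(1)] by (auto simp: P_def A(2))
      have "D $$ (i, j) \<in> {-1, 0, 1}" if "i < m" "j < m" for i j
      proof (cases "i = j")
        case True
        then have "\<bar>D $$ (i, j)\<bar> = 1" using e[OF A(1)] that A(2) by (auto simp: P_def)
        then show ?thesis by auto
      next
        case False
        then have "D $$ (i, j) = 0" using e[OF A(1)] that A(2) by (auto simp: P_def)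
        then show ?thesis by auto
      qed
      then have "(\<lambda>ij\<in>{..<m} \<times> {..<m}. D $$ ij) \<in> ({..<m} \<times> {..<m}) \<rightarrow>\<^sub>E {-1, 0, 1}"
        by (intro restrict_PiE_iff[THEN iffD2]) auto
      moreover have "D = mat m m (\<lambda>ij\<in>{..<m} \<times> {..<m}. D $$ ij)"
        using Dc by (intro eq_matI) auto
      ultimately show "D \<in> (\<lambda>f. mat m m f) ` (({..<m} \<times> {..<m}) \<rightarrow>\<^sub>E {-1, 0, 1})" by blast
    qed
    then show "finite ((\<lambda>A. e A * A) ` carrier (SLZ m))"
      by (rule finite_subset) (intro finite_imageI finite_PiE; simp)
  next
    fix x y assume x: "x \<in> carrier (SLZ m)" and y: "y \<in> carrier (SLZ m)" and eq: "e x * x = e y * y"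
    have ex: "e x \<in> elem_group m" and ey: "e y \<in> elem_group m" using e[OF x] e[OF y] by (auto simp: P_def)
    have exc: "e x \<in> carrier (SLZ m)" and eyc: "e y \<in> carrier (SLZ m)"
      using ex ey elem_group_SL by auto
    have "e x \<otimes>\<^bsub>SL m\<^esub> x = e y \<otimes>\<^bsub>SL m\<^esub> y" using eq by simp
    then have "x = inv\<^bsub>SL m\<^esub> e x \<otimes>\<^bsub>SL m\<^esub> (e y \<otimes>\<^bsub>SL m\<^esub> y)"
      using inv_cancel_left(1)[OF exc x] by simp
    then have "x \<otimes>\<^bsub>SL m\<^esub> inv\<^bsub>SL m\<^esub> y = inv\<^bsub>SL m\<^esub> e x \<otimes>\<^bsub>SL m\<^esub> e y"
      using exc eyc x y by (metis inv_closed inv_solve_right' m_assoc m_closed)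
    then show "x \<otimes>\<^bsub>SL m\<^esub> inv\<^bsub>SL m\<^esub> y \<in> elem_group m"
      using subgroup.m_closed[OF elem_group_subgroup subgroup.m_inv_closed[OF elem_group_subgroup ex] ey] by simp
  qed
qed

section \<open>Principal congruence subgroups\<close>

definition mat_cong :: "nat \<Rightarrow> int \<Rightarrow> int mat \<Rightarrow> int mat \<Rightarrow> bool" where
  "mat_cong m M A B \<longleftrightarrow> (\<forall>i<m. \<forall>j<m. [A $$ (i, j) = B $$ (i, j)] (mod M))"

lemma mat_cong_mult:
  assumes "A \<in> carrier_mat m m" "A' \<in> carrier_mat m m" "B \<in> carrier_mat m m" "B' \<in> carrier_mat m m"
    and "mat_cong m M A A'" "mat_cong m M B B'"
  shows "mat_cong m M (A * B) (A' * B')"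
  unfolding mat_cong_def
proof (intro allI impI)
  fix i j assume "i < m" "j < m"
  then show "[(A * B) $$ (i, j) = (A' * B') $$ (i, j)] (mod M)"
    using assms by (simp add: mat_mult_index[of _ m]) (intro cong_sum cong_mult; simp add: mat_cong_def)
qed

lemma mat_cong_refl: "mat_cong m M A A" and
  mat_cong_sym: "mat_cong m M A B \<Longrightarrow> mat_cong m M B A"
  unfolding mat_cong_def by (auto intro: cong_sym)

definition principal :: "nat \<Rightarrow> int \<Rightarrow> int mat set" where
  "principal m M = {A \<in> carrier (SL m). mat_cong m M A (1\<^sub>m m)}"

lemma principal_finite_index:
  assumes "M > 0" shows "finite_index_subgroup (principal m M) (SLZ m)"
proof -
  interpret group "SLZ m" by (rule group_SL)
  have sub: "subgroup (principal m M) (SL m)"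
  proof (rule subgroupI)
    have "\<one>\<^bsub>SL m\<^esub> \<in> principal m M" using one_closed by (simp add: principal_def mat_cong_refl)
    then show "principal m M \<noteq> {}" by blast
  next
    fix A assume A: "A \<in> principal m M"
    then have Ac: "A \<in> carrier (SL m)" and Am: "mat_cong m M A (1\<^sub>m m)" by (auto simp: principal_def)
    have "mat_cong m M (A * inv\<^bsub>SL m\<^esub> A) (1\<^sub>m m * inv\<^bsub>SL m\<^esub> A)"
      using SL_inv[OF Ac] SL_carrierD[OF Ac] Am by (intro mat_cong_mult mat_cong_refl) auto
    then have "mat_cong m M (inv\<^bsub>SL m\<^esub> A) (1\<^sub>m m)"
      using SL_inv[OF Ac] by (simp add: mat_cong_sym)
    then show "inv\<^bsub>SL m\<^esub> A \<in> principal m M" using Ac by (simp add: principal_def)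
  next
    fix A B assume AB: "A \<in> principal m M" "B \<in> principal m M"
    then have "mat_cong m M (A * B) (1\<^sub>m m * 1\<^sub>m m)"
      using SL_carrierD by (intro mat_cong_mult) (auto simp: principal_def)
    then show "A \<otimes>\<^bsub>SL m\<^esub> B \<in> principal m M"
      using AB m_closed[of A B] by (auto simp: principal_def)
  qed (auto simp: principal_def)
  let ?c = "\<lambda>A. \<lambda>ij\<in>{..<m} \<times> {..<m}. A $$ ij mod M"
  show ?thesis
  proof (rule finite_index_subgroupI[where c = ?c, OF sub])
    have "?c ` carrier (SL m) \<subseteq> ({..<m} \<times> {..<m}) \<rightarrow>\<^sub>E {0..<M}" using assms by auto
    then show "finite (?c ` carrier (SL m))" by (rule finite_subset) (intro finite_PiE; simp)
  next
    fix x y assume x: "x \<in> carrier (SL m)" and y: "y \<in> carrier (SL m)" and eq: "?c x = ?c y"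
    have "mat_cong m M x y" unfolding mat_cong_def cong_def
      using fun_cong[OF eq] by (metis (no_types, lifting) SigmaI lessThan_iff restrict_apply')
    then have "mat_cong m M (x * inv\<^bsub>SL m\<^esub> y) (y * inv\<^bsub>SL m\<^esub> y)"
      using SL_inv[OF y] SL_carrierD[OF x] SL_carrierD[OF y] by (intro mat_cong_mult mat_cong_refl) auto
    then show "x \<otimes>\<^bsub>SL m\<^esub> inv\<^bsub>SL m\<^esub> y \<in> principal m M"
      using SL_inv[OF y] m_closed[OF x inv_closed[OF y]] by (simp add: principal_def)
  qed
qed

lemma principal_conj:
  assumes A: "A \<in> principal m M" and g: "g \<in> carrier (SLZ m)"
  shows "g * A * inv\<^bsub>SL m\<^esub> g \<in> principal m M"
proof -
  interpret group "SLZ m" by (rule group_SL)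
  have Ac: "A \<in> carrier (SL m)" using A by (simp add: principal_def)
  have "mat_cong m M (g * A * inv\<^bsub>SL m\<^esub> g) (g * 1\<^sub>m m * inv\<^bsub>SL m\<^esub> g)"
    using A SL_inv[OF g] SL_carrierD[OF g] SL_carrierD[OF Ac]
    by (intro mat_cong_mult mat_cong_refl) (auto simp: principal_def)
  then show ?thesis using SL_inv[OF g] SL_carrierD[OF g] m_closed[OF m_closed[OF g Ac] inv_closed[OF g]]
    by (simp add: principal_def)
qed

section \<open>Elementary matrices generate finite-index subgroups\<close>

text \<open>Take for \<open>t\<close> the product of the primes that divide \<open>a\<close> but not \<open>b\<close>.\<close>

lemma coprime_shift:
  fixes a b g :: int
  assumes a: "a \<noteq> 0" and no: "\<And>p. Factorial_Ring.prime p \<Longrightarrow> p dvd a \<Longrightarrow> p dvd b \<Longrightarrow> p dvd g \<Longrightarrow> False"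
  shows "\<exists>t. coprime a (b + t * g)"
proof -
  define S where "S = {p \<in> prime_factors a. \<not> p dvd b}"
  have fin: "finite S" by (simp add: S_def)
  have "coprime a (b + \<Prod>S * g)"
  proof (rule ccontr)
    assume nc: "\<not> coprime a (b + \<Prod>S * g)"
    let ?d = "gcd a (b + \<Prod>S * g)"
    have "?d \<noteq> 0" "\<not> is_unit ?d" using a nc by (auto simp: coprime_iff_gcd_eq_1)
    then obtain p where p: "Factorial_Ring.prime p" "p dvd ?d" using prime_divisor_exists by blast
    then have pa: "p dvd a" and pb: "p dvd b + \<Prod>S * g" by auto
    have pf: "p \<in> prime_factors a" using p pa a by (simp add: prime_factors_dvd)
    show False
    proof (cases "p dvd b")
      case True
      then have "p dvd \<Prod>S * g" using pb by (simp add: dvd_add_right_iff)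
      then have "p dvd \<Prod>S" using no[OF p(1) pa True] p(1) by (auto simp: prime_dvd_mult_iff)
      then obtain q where q: "q \<in> S" "p dvd q"
        using prime_dvd_prod_iff[OF fin p(1), of "\<lambda>x. x"] by auto
      then have "Factorial_Ring.prime q" by (auto simp: S_def)
      then have "p = q" using p(1) q(2) by (simp add: primes_dvd_imp_eq)
      then show False using q True by (simp add: S_def)
    next
      case False
      then have "p \<in> S" using pf by (simp add: S_def)
      then have "p dvd \<Prod>S" using fin dvd_prodI[OF fin, of p "\<lambda>x. x"] by simp
      then have "p dvd b" using pb by (metis dvd_add_left_iff dvd_mult2)
      then show False using False by simp
    qed
  qed
  then show ?thesis by blast
qed

text \<open>With \<open>m \<ge> 3\<close> there is room for two auxiliary entries: one entry \<open>p\<close> is made coprime to the pivot \<open>s\<close>, and a third entry \<open>q\<close> is then free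
to be adjusted to \<open>1 - u s\<close>, after which adding it to the pivot turns the pivot into \<open>1\<close>. That last operation has an
entry prime to \<open>M\<close>, so it is undone at the end and enters only as a conjugation.\<close>

lemma column_reduce:
  fixes M :: int
  assumes m: "m \<ge> 3" and M: "M \<ge> 2" and E: "subgroup E (SLZ m)"
    and el: "\<And>p q x. p < m \<Longrightarrow> q < m \<Longrightarrow> p \<noteq> q \<Longrightarrow> emat m p q (M * x) \<in> E"
    and conj: "\<And>g e. g \<in> elem_group m \<Longrightarrow> e \<in> E \<Longrightarrow> g * e * inv\<^bsub>SL m\<^esub> g \<in> E"
    and A: "A \<in> principal m M" and s: "s < m"
  shows "\<exists>e\<in>E. \<forall>i<m. (e * A) $$ (i, s) = unit_vec_fun s i"
proof -
  interpret group "SLZ m" by (rule group_SL)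
  have ASL: "A \<in> carrier (SL m)" and Am: "mat_cong m M A (1\<^sub>m m)" using A by (auto simp: principal_def)
  have Ac: "A \<in> carrier_mat m m" using ASL by (rule SL_carrierD)
  obtain p where p: "p < m" "p \<noteq> s"
    using m by (metis One_nat_def Suc_le_eq lessI less_trans numeral_3_eq_3 not_less zero_neq_one le0 linorder_not_le less_Suc_eq)
  have "card {s, p} < card {..<m}" using m card_insert_le_m1[of 2 "{p}" s] by simp
  then obtain q where q: "q < m" "q \<noteq> s" "q \<noteq> p"
    by (metis card_mono finite.emptyI finite_insert lessThan_iff not_le subsetI insert_iff)
  define u where "u i = A $$ (i, s)" for i
  define w where "w k = (inv\<^bsub>SL m\<^esub> A) $$ (s, k)" for k
  have wu: "(\<Sum>k<m. w k * u k) = 1"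
    using mat_mult_index[OF SL_inv(1)[OF ASL] Ac s s] SL_inv(2)[OF ASL] s by (simp add: w_def u_def)
  \<comment> \<open>The rows other than \<open>s\<close> and \<open>p\<close> enter through one combination \<open>h\<close>, with the coefficients
    of the Bezout relation given by a row of the inverse matrix.\<close>
  define c where "c k = (if k = s \<or> k = p then 0 else w k)" for k
  define h where "h = dot m c u"
  have wh: "w s * u s + w p * u p + h = 1"
  proof -
    have "(\<Sum>k<m. w k * u k) = (\<Sum>k<m. c k * u k + (if k = s then w s * u s else 0) + (if k = p then w p * u p else 0))"
      using p by (intro sum.cong) (auto simp: c_def)
    also have "\<dots> = h + w s * u s + w p * u p" using s p by (simp add: sum.distrib h_def dot_def)
    finally show ?thesis using wu by simp
  qed
  have us: "[u s = 1] (mod M)" and u0: "\<And>i. i < m \<Longrightarrow> i \<noteq> s \<Longrightarrow> M dvd u i"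
  proof -
    have c: "[A $$ (i, s) = (1\<^sub>m m) $$ (i, s)] (mod M)" if "i < m" for i
      using Am s that by (simp only: mat_cong_def)
    show "[u s = 1] (mod M)" using c[OF s] s by (simp add: u_def)
    show "M dvd u i" if "i < m" "i \<noteq> s" for i using c[OF that(1)] s that by (simp add: u_def cong_0_iff)
  qed
  have us0: "u s \<noteq> 0" using us M by (auto simp: cong_def)
  obtain x where x: "1 - u s = M * x" using us by (metis cong_iff_dvd_diff cong_sym dvdE)
  have "\<exists>t. coprime (u s) (u p + t * (M * h))"
  proof (rule coprime_shift[OF us0])
    fix r assume r: "Factorial_Ring.prime r" "r dvd u s" "r dvd u p" "r dvd M * h"
    have "\<not> r dvd M"
    proof
      assume "r dvd M"
      then have "r dvd 1 - u s" using x by simp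
      then have "r dvd 1" using r(2) by (metis dvd_add_right_iff diff_add_cancel add.commute)
      then show False using r(1) by (simp add: prime_int_iff)
    qed
    then have "r dvd h" using r by (simp add: prime_dvd_mult_iff)
    then have "r dvd w s * u s + w p * u p + h" using r by simp
    then show False using wh r(1) by (simp add: prime_int_iff)
  qed
  then obtain t where t: "coprime (u s) (u p + t * (M * h))" by blast
  define E1 where "E1 = transv m (unit_vec_fun p) (\<lambda>k. M * (t * c k))"
  have E1: "E1 \<in> E" unfolding E1_def using subgroup.one_closed[OF E] p
    by (intro row_transv_mem[OF E p(1)]) (auto simp: c_def intro: el)
  have E1c: "E1 \<in> carrier_mat m m" by (simp add: E1_def)
  define A1 where "A1 = E1 * A"
  have A1c: "A1 \<in> carrier_mat m m" using E1c Ac by (auto simp: A1_def)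
  have A1: "A1 $$ (i, s) = u i + (if i = p then t * (M * h) else 0)" if "i < m" for i
  proof -
    have "dot m (\<lambda>k. M * (t * c k)) (\<lambda>k. A $$ (k, s)) = t * (M * h)"
      by (simp add: h_def dot_def u_def sum_distrib_left algebra_simps)
    then show ?thesis unfolding A1_def E1_def transv_mult_index[OF Ac that s]
      by (simp add: u_def unit_vec_fun_def)
  qed
  obtain a b where ab: "a * u s + b * (u p + t * (M * h)) = 1"
    using t by (metis bezout_int coprime_iff_gcd_eq_1)
  obtain y where y: "u q = M * y" using u0[OF q(1,2)] by (rule dvdE)
  define z where "z = x - y"
  have z: "1 - u s - u q = M * z" using x y by (simp add: z_def algebra_simps)
  define E2 where "E2 = transv m (unit_vec_fun q) (\<lambda>k. M * (z * (a * unit_vec_fun s k + b * unit_vec_fun p k)))"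
  have E2: "E2 \<in> E" unfolding E2_def using q subgroup.one_closed[OF E]
    by (intro row_transv_mem[OF E q(1)]) (auto intro: el simp: unit_vec_fun_def)
  have E2c: "E2 \<in> carrier_mat m m" by (simp add: E2_def)
  define A2 where "A2 = E2 * A1"
  have A2c: "A2 \<in> carrier_mat m m" using E2c A1c by (auto simp: A2_def)
  have A2: "A2 $$ (i, s) = (if i = q then 1 - u s else A1 $$ (i, s))" if "i < m" for i
  proof -
    have "dot m (\<lambda>k. M * (z * (a * unit_vec_fun s k + b * unit_vec_fun p k))) (\<lambda>k. A1 $$ (k, s))
      = M * z * (a * dot m (unit_vec_fun s) (\<lambda>k. A1 $$ (k, s)) + b * dot m (unit_vec_fun p) (\<lambda>k. A1 $$ (k, s)))"
      by (simp add: dot_def sum_distrib_left algebra_simps sum.distrib)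
    also have "\<dots> = M * z" using s p ab by (simp add: A1)
    finally show ?thesis unfolding A2_def E2_def transv_mult_index[OF A1c that s]
      using z q by (simp add: unit_vec_fun_def A1)
  qed
  \<comment> \<open>The only step outside \<open>E\<close>: the pivot becomes \<open>u s + (1 - u s) = 1\<close>.\<close>
  define E3 where "E3 = emat m s q 1"
  have E3: "E3 \<in> elem_group m" using s q by (simp add: E3_def elem_group_elem)
  define A3 where "A3 = E3 * A2"
  have A3c: "A3 \<in> carrier_mat m m" using A2c by (auto simp: A3_def E3_def)
  have A3: "A3 $$ (i, s) = (if i = s then 1 else A2 $$ (i, s))" if "i < m" for i
    unfolding A3_def E3_def elem_mult_index[OF A2c that s q(1)] using s p q A1[OF s] A2[OF s] A2[OF q(1)] by simp
  have A3dvd: "M dvd A3 $$ (i, s)" if "i < m" "i \<noteq> s" for i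
    using that A3 A2 A1 u0 x by auto
  define v where "v j = (if j = s then 0 else - A3 $$ (j, s))" for j
  define E4 where "E4 = transv m v (unit_vec_fun s)"
  have E4: "E4 \<in> E" unfolding E4_def
  proof (rule column_transv_mem[OF E s])
    fix j assume j: "j < m" "j \<noteq> s"
    have "M dvd v j" using A3dvd[OF j] j by (simp add: v_def)
    then obtain l where "v j = M * l" by (rule dvdE)
    then show "emat m j s (v j) \<in> E" using el[OF j(1) s j(2)] by simp
  qed (simp add: v_def)
  have E4c: "E4 \<in> carrier_mat m m" by (simp add: E4_def)
  define A4 where "A4 = E4 * A3"
  have A4c: "A4 \<in> carrier_mat m m" using E4c A3c by (auto simp: A4_def)
  have A4: "A4 $$ (i, s) = unit_vec_fun s i" if "i < m" for i
    unfolding A4_def E4_def transv_mult_index[OF A3c that s] using s A3[OF s] A3[OF that]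
    by (simp add: v_def unit_vec_fun_def)
  define E5 where "E5 = emat m s q (-1)"
  have E5: "E5 \<in> elem_group m" using s q by (simp add: E5_def elem_group_elem)
  have A5: "(E5 * A4) $$ (i, s) = unit_vec_fun s i" if "i < m" for i
    unfolding E5_def elem_mult_index[OF A4c that s q(1)] using A4 that q by (simp add: unit_vec_fun_def)
  have inv5: "inv\<^bsub>SL m\<^esub> E5 = E3" using s q by (simp add: E5_def E3_def inv_elem)
  have "E5 * E4 * E3 \<in> E" using conj[OF E5 E4] inv5 by simp
  moreover have "E2 * E1 \<in> E" using subgroup.m_closed[OF E E2 E1] by simp
  ultimately have "E5 * E4 * E3 * (E2 * E1) \<in> E" using subgroup.m_closed[OF E] by (metis SL_mult)
  moreover have "E5 * E4 * E3 * (E2 * E1) * A = E5 * A4"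
    unfolding A4_def A3_def A2_def A1_def
    using elem_group_carrier[OF E3] elem_group_carrier[OF E5] E1c E2c E4c Ac
    by (simp add: assoc_mult_mat[of _ m m _ m _ m] square_mult_closed)
  ultimately show ?thesis using A5 by (intro bexI[of _ "E5 * E4 * E3 * (E2 * E1)"]) auto
qed

text \<open>After multiplication by an element of \<open>E\<close> the column \<open>s\<close> of \<open>A\<close> is a unit vector. Conjugating the elementary
matrix then changes it only within row \<open>s\<close>, by multiples of \<open>M\<close>.\<close>

lemma principal_central:
  fixes M :: int
  assumes m: "m \<ge> 3" and M: "M \<ge> 2" and E: "subgroup E (SLZ m)" and EP: "E \<subseteq> principal m M"
    and el: "\<And>p q x. p < m \<Longrightarrow> q < m \<Longrightarrow> p \<noteq> q \<Longrightarrow> emat m p q (M * x) \<in> E"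
    and conj: "\<And>g e. g \<in> elem_group m \<Longrightarrow> e \<in> E \<Longrightarrow> g * e * inv\<^bsub>SL m\<^esub> g \<in> E"
    and A: "A \<in> principal m M" "A \<in> elem_group m" and st: "s < m" "t < m" "s \<noteq> t"
  shows "A * emat m s t 1 * inv\<^bsub>SL m\<^esub> A * emat m s t (-1) \<in> E"
proof -
  interpret group "SLZ m" by (rule group_SL)
  have P: "subgroup (principal m M) (SL m)" using principal_finite_index[of M m] M finite_index_subgroupD by auto
  obtain e where e: "e \<in> E" "\<And>i. i < m \<Longrightarrow> (e * A) $$ (i, s) = unit_vec_fun s i"
    using column_reduce[OF m M E el conj A(1) st(1)] by blast
  have eSL: "e \<in> carrier (SL m)" using e(1) subgroup.subset[OF E] by blast
  have ASL: "A \<in> carrier (SL m)" using A(2) by (rule elem_group_SL)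
  define B where "B = e * A"
  have BP: "B \<in> principal m M" using subgroup.m_closed[OF P, of e A] e EP A by (auto simp: B_def)
  have BSL: "B \<in> carrier (SL m)" using BP by (simp add: principal_def)
  have Bc: "B \<in> carrier_mat m m" using BSL by (rule SL_carrierD)
  let ?W = "inv\<^bsub>SL m\<^esub> B"
  have WP: "?W \<in> principal m M" using subgroup.m_inv_closed[OF P BP] .
  have Wts: "?W $$ (t, s) = 0"
  proof -
    have "(\<Sum>k<m. ?W $$ (t, k) * B $$ (k, s)) = 0"
      using mat_mult_index[OF SL_inv(1)[OF BSL] Bc st(2,1)] SL_inv(2)[OF BSL] st by simp
    moreover have "(\<Sum>k<m. ?W $$ (t, k) * B $$ (k, s)) = (\<Sum>k<m. ?W $$ (t, k) * unit_vec_fun s k)"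
      using e(2) by (intro sum.cong) (auto simp: B_def)
    moreover have "\<dots> = ?W $$ (t, s)" using dot_unit(2)[OF st(1), of "\<lambda>k. ?W $$ (t, k)"] by (simp add: dot_def)
    ultimately show ?thesis by simp
  qed
  define v where "v j = ?W $$ (t, j) - unit_vec_fun t j" for j
  have vs: "v s = 0" using Wts st by (simp add: v_def unit_vec_fun_def)
  have vM: "M dvd v j" if "j < m" for j
  proof -
    have "[?W $$ (t, j) = (1\<^sub>m m) $$ (t, j)] (mod M)"
      using WP that st by (simp only: principal_def mat_cong_def mem_Collect_eq)
    then show ?thesis using that st by (auto simp: v_def unit_vec_fun_def cong_iff_dvd_diff)
  qed
  have R: "transv m (unit_vec_fun s) v \<in> E"
  proof (rule row_transv_mem[where v = v, OF E st(1) vs])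
    fix j assume "j < m" "j \<noteq> s"
    moreover obtain l where "v j = M * l" using vM[OF \<open>j < m\<close>] by (rule dvdE)
    ultimately show "emat m s j (v j) \<in> E" using el[of s j l] st by simp
  qed
  have "B * emat m s t 1 * ?W = transv m (\<lambda>i. 1 * B $$ (i, s)) (\<lambda>j. ?W $$ (t, j))"
    by (rule conj_elem[OF Bc SL_inv(1,3)[OF BSL] st(1,2)])
  also have "\<dots> = transv m (unit_vec_fun s) (\<lambda>j. v j + 1 * unit_vec_fun t j)"
    using e(2) by (intro eq_matI) (auto simp: transv_def v_def B_def)
  also have "\<dots> = transv m (unit_vec_fun s) v * emat m s t 1"
    unfolding elem_eq_transv' by (rule transv_mult_same_left[symmetric]) (use st vs in simp)
  finally have main: "B \<otimes>\<^bsub>SL m\<^esub> emat m s t 1 \<otimes>\<^bsub>SL m\<^esub> ?W = transv m (unit_vec_fun s) v \<otimes>\<^bsub>SL m\<^esub> emat m s t 1" by simp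
  let ?s = "emat m s t 1" and ?R = "transv m (unit_vec_fun s) v"
  have sSL: "?s \<in> carrier (SL m)" using st by (intro elem_SL)
  have sG: "?s \<in> elem_group m" using st by (intro elem_group_elem)
  have RSL: "?R \<in> carrier (SL m)" using R subgroup.subset[OF E] by blast
  have invs: "emat m s t (-1) = inv\<^bsub>SL m\<^esub> ?s" using st by (simp add: inv_elem)
  have A_eq: "A = inv\<^bsub>SL m\<^esub> e \<otimes>\<^bsub>SL m\<^esub> B" using inv_cancel_left(1)[OF eSL ASL] by (simp add: B_def)
  have "A \<otimes>\<^bsub>SL m\<^esub> ?s \<otimes>\<^bsub>SL m\<^esub> inv\<^bsub>SL m\<^esub> A = inv\<^bsub>SL m\<^esub> e \<otimes>\<^bsub>SL m\<^esub> (B \<otimes>\<^bsub>SL m\<^esub> ?s \<otimes>\<^bsub>SL m\<^esub> ?W) \<otimes>\<^bsub>SL m\<^esub> e"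
    unfolding A_eq using eSL BSL sSL by (simp add: inv_mult_group m_assoc del: SL_mult)
  also have "\<dots> = inv\<^bsub>SL m\<^esub> e \<otimes>\<^bsub>SL m\<^esub> (?R \<otimes>\<^bsub>SL m\<^esub> ?s) \<otimes>\<^bsub>SL m\<^esub> e" unfolding main ..
  finally have "A \<otimes>\<^bsub>SL m\<^esub> ?s \<otimes>\<^bsub>SL m\<^esub> inv\<^bsub>SL m\<^esub> A \<otimes>\<^bsub>SL m\<^esub> inv\<^bsub>SL m\<^esub> ?s
     = inv\<^bsub>SL m\<^esub> e \<otimes>\<^bsub>SL m\<^esub> ?R \<otimes>\<^bsub>SL m\<^esub> (?s \<otimes>\<^bsub>SL m\<^esub> e \<otimes>\<^bsub>SL m\<^esub> inv\<^bsub>SL m\<^esub> ?s)"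
    using eSL RSL sSL by (simp add: m_assoc del: SL_mult)
  moreover have "?s \<otimes>\<^bsub>SL m\<^esub> e \<otimes>\<^bsub>SL m\<^esub> inv\<^bsub>SL m\<^esub> ?s \<in> E" using conj[OF sG e(1)] by simp
  ultimately have "A \<otimes>\<^bsub>SL m\<^esub> ?s \<otimes>\<^bsub>SL m\<^esub> inv\<^bsub>SL m\<^esub> A \<otimes>\<^bsub>SL m\<^esub> inv\<^bsub>SL m\<^esub> ?s \<in> E"
    using subgroup.m_closed[OF E] subgroup.m_inv_closed[OF E e(1)] R by metis
  then show ?thesis unfolding invs by simp
qed

lemma (in group) finite_index_restrict:
  assumes \<Gamma>: "finite_index_subgroup \<Gamma> G" and H: "subgroup H G"
  shows "finite_index_subgroup (\<Gamma> \<inter> H) (G\<lparr>carrier := H\<rparr>)"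
proof -
  have \<Gamma>s: "subgroup \<Gamma> G" using \<Gamma> by (rule finite_index_subgroupD)
  have Hg: "group (G\<lparr>carrier := H\<rparr>)" using subgroup.subgroup_is_group[OF H is_group] .
  have Hc: "H \<subseteq> carrier G" using subgroup.subset[OF H] .
  show ?thesis
  proof (rule group.finite_index_subgroupI[OF Hg, where c = "\<lambda>x. \<Gamma> #> x"])
    show "subgroup (\<Gamma> \<inter> H) (G\<lparr>carrier := H\<rparr>)"
      using subgroups_Inter_pair[OF \<Gamma>s H] H by (simp add: subgroup_incl)
    show "finite ((\<lambda>x. \<Gamma> #> x) ` carrier (G\<lparr>carrier := H\<rparr>))"
      using finite_subset[OF image_mono[OF Hc] finite_rcos_image[OF \<Gamma>]] by simp
  next
    fix x y assume "x \<in> carrier (G\<lparr>carrier := H\<rparr>)" "y \<in> carrier (G\<lparr>carrier := H\<rparr>)" and eq: "\<Gamma> #> x = \<Gamma> #> y"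
    then have x: "x \<in> H" and y: "y \<in> H" by auto
    then show "x \<otimes>\<^bsub>G\<lparr>carrier := H\<rparr>\<^esub> inv\<^bsub>G\<lparr>carrier := H\<rparr>\<^esub> y \<in> \<Gamma> \<inter> H"
      using rcos_eq_imp_quotient[OF \<Gamma>s _ _ eq] Hc m_inv_consistent[OF H y]
        subgroup.m_closed[OF H x subgroup.m_inv_closed[OF H y]] by auto
  qed
qed

text \<open>The quotient to which the central extension argument is applied is by the largest subgroup \<open>E\<close> of \<open>K\<close> and of the
congruence subgroup that is normalised by all elementary matrices.\<close>

theorem elementary_finite_index:
  assumes m: "m \<ge> 3" and K: "subgroup K (SLZ m)"
    and el: "\<And>p q. p < m \<Longrightarrow> q < m \<Longrightarrow> p \<noteq> q \<Longrightarrow> \<exists>x. x \<noteq> 0 \<and> emat m p q x \<in> K"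
  shows "finite_index_subgroup K (SLZ m)"
proof -
  interpret group "SLZ m" by (rule group_SL)
  define y where "y p q = (SOME x. x \<noteq> 0 \<and> emat m p q x \<in> K)" for p q
  have y: "y p q \<noteq> 0" "emat m p q (y p q) \<in> K" if "p < m" "q < m" "p \<noteq> q" for p q
    using someI_ex[OF el[OF that]] by (auto simp: y_def)
  define I where "I = {(p, q). p < m \<and> q < m \<and> p \<noteq> q}"
  have finI: "finite I" by (rule finite_subset[of _ "{..<m} \<times> {..<m}"]) (auto simp: I_def)
  \<comment> \<open>The factor \<open>2\<close> ensures that the level \<open>N * N\<close> is at least \<open>2\<close>.\<close>
  define N where "N = 2 * (\<Prod>(p, q)\<in>I. y p q)"
  have N: "N \<noteq> 0" using y finI by (auto simp: N_def I_def)
  have elN: "emat m p q (N * x) \<in> K" if pq: "p < m" "q < m" "p \<noteq> q" for p q x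
  proof -
    have "(p, q) \<in> I" using pq by (simp add: I_def)
    then have "y p q dvd (\<Prod>(p, q)\<in>I. y p q)" using dvd_prodI[OF finI, of "(p, q)" "\<lambda>(p, q). y p q"] by simp
    then have "y p q dvd N" by (simp add: N_def)
    then obtain c where "N = y p q * c" by (rule dvdE)
    then show ?thesis using elem_multiple_mem[OF K pq(3,2) y(2)[OF pq], of "c * x"] by (simp add: algebra_simps)
  qed
  define M where "M = N * N"
  have "even N" by (simp add: N_def)
  then have "\<bar>N\<bar> \<ge> 2" using N by (auto elim!: evenE)
  then have "\<bar>N\<bar> * \<bar>N\<bar> \<ge> 2 * 2" by (intro mult_mono) auto
  then have M: "M \<ge> 2" by (simp add: M_def abs_mult_self_eq)
  let ?P = "principal m M" and ?G = "elem_group m"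
  have Pfi: "finite_index_subgroup ?P (SL m)" using principal_finite_index M by simp
  have P: "subgroup ?P (SL m)" using Pfi by (rule finite_index_subgroupD)
  \<comment> \<open>The normal core of \<open>K\<close> and the congruence subgroup in the elementary group.\<close>
  define E where "E = {e \<in> ?G. \<forall>g\<in>?G. g * e * inv\<^bsub>SL m\<^esub> g \<in> K \<inter> ?P}"
  have KP: "subgroup (K \<inter> ?P) (SL m)" using subgroups_Inter_pair[OF K P] .
  have EG: "E \<subseteq> ?G" by (auto simp: E_def)
  have oneG: "1\<^sub>m m \<in> ?G" using subgroup.one_closed[OF elem_group_subgroup] by simp
  have EKP: "E \<subseteq> K \<inter> ?P"
  proof
    fix e assume e: "e \<in> E"
    then have "1\<^sub>m m * e * inv\<^bsub>SL m\<^esub> (1\<^sub>m m) \<in> K \<inter> ?P" using oneG by (auto simp: E_def)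
    moreover have "inv\<^bsub>SL m\<^esub> (1\<^sub>m m) = (1\<^sub>m m :: int mat)" using inv_one by simp
    ultimately show "e \<in> K \<inter> ?P" using e elem_group_carrier[of e m] by (simp add: E_def)
  qed
  have Esub: "subgroup E (SL m)"
  proof (rule subgroupI)
    show "E \<subseteq> carrier (SL m)" using EG elem_group_SL by blast
    have "g * 1\<^sub>m m * inv\<^bsub>SL m\<^esub> g = 1\<^sub>m m" if "g \<in> ?G" for g
      using SL_inv[OF elem_group_SL[OF that]] elem_group_carrier[OF that] by simp
    then have "1\<^sub>m m \<in> E" using oneG subgroup.one_closed[OF KP] by (auto simp: E_def)
    then show "E \<noteq> {}" by blast
  next
    fix e assume e: "e \<in> E"
    have eSL: "e \<in> carrier (SL m)" using e EG elem_group_SL by blast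
    have "g * inv\<^bsub>SL m\<^esub> e * inv\<^bsub>SL m\<^esub> g \<in> K \<inter> ?P" if g: "g \<in> ?G" for g
    proof -
      have gSL: "g \<in> carrier (SL m)" using g by (rule elem_group_SL)
      have "g \<otimes>\<^bsub>SL m\<^esub> inv\<^bsub>SL m\<^esub> e \<otimes>\<^bsub>SL m\<^esub> inv\<^bsub>SL m\<^esub> g = inv\<^bsub>SL m\<^esub> (g \<otimes>\<^bsub>SL m\<^esub> e \<otimes>\<^bsub>SL m\<^esub> inv\<^bsub>SL m\<^esub> g)"
        using gSL eSL by (simp add: inv_mult_group m_assoc del: SL_mult)
      then show ?thesis using subgroup.m_inv_closed[OF KP, of "g * e * inv\<^bsub>SL m\<^esub> g"] e g by (auto simp: E_def)
    qed
    then show "inv\<^bsub>SL m\<^esub> e \<in> E" using e subgroup.m_inv_closed[OF elem_group_subgroup] by (auto simp: E_def)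
  next
    fix e f assume e: "e \<in> E" and f: "f \<in> E"
    have eSL: "e \<in> carrier (SL m)" and fSL: "f \<in> carrier (SL m)" using e f EG elem_group_SL by auto
    have "g * (e * f) * inv\<^bsub>SL m\<^esub> g \<in> K \<inter> ?P" if g: "g \<in> ?G" for g
    proof -
      have gSL: "g \<in> carrier (SL m)" using g by (rule elem_group_SL)
      have "g \<otimes>\<^bsub>SL m\<^esub> (e \<otimes>\<^bsub>SL m\<^esub> f) \<otimes>\<^bsub>SL m\<^esub> inv\<^bsub>SL m\<^esub> g
        = (g \<otimes>\<^bsub>SL m\<^esub> e \<otimes>\<^bsub>SL m\<^esub> inv\<^bsub>SL m\<^esub> g) \<otimes>\<^bsub>SL m\<^esub> (g \<otimes>\<^bsub>SL m\<^esub> f \<otimes>\<^bsub>SL m\<^esub> inv\<^bsub>SL m\<^esub> g)"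
        using gSL eSL fSL by (simp add: inv_cancel_left m_assoc del: SL_mult)
      then show ?thesis
        using subgroup.m_closed[OF KP, of "g * e * inv\<^bsub>SL m\<^esub> g" "g * f * inv\<^bsub>SL m\<^esub> g"] e f g by (auto simp: E_def)
    qed
    then show "e \<otimes>\<^bsub>SL m\<^esub> f \<in> E" using e f elem_group_mult by (auto simp: E_def)
  qed
  have conj: "g * e * inv\<^bsub>SL m\<^esub> g \<in> E" if g: "g \<in> ?G" and e: "e \<in> E" for g e
  proof -
    have gSL: "g \<in> carrier (SL m)" using g by (rule elem_group_SL)
    have eG: "e \<in> ?G" and eSL: "e \<in> carrier (SL m)" using e EG elem_group_SL by auto
    have "h * (g * e * inv\<^bsub>SL m\<^esub> g) * inv\<^bsub>SL m\<^esub> h \<in> K \<inter> ?P" if h: "h \<in> ?G" for h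
    proof -
      have hSL: "h \<in> carrier (SL m)" using h by (rule elem_group_SL)
      have "h \<otimes>\<^bsub>SL m\<^esub> (g \<otimes>\<^bsub>SL m\<^esub> e \<otimes>\<^bsub>SL m\<^esub> inv\<^bsub>SL m\<^esub> g) \<otimes>\<^bsub>SL m\<^esub> inv\<^bsub>SL m\<^esub> h
        = (h \<otimes>\<^bsub>SL m\<^esub> g) \<otimes>\<^bsub>SL m\<^esub> e \<otimes>\<^bsub>SL m\<^esub> inv\<^bsub>SL m\<^esub> (h \<otimes>\<^bsub>SL m\<^esub> g)"
        using gSL hSL eSL by (simp add: inv_mult_group m_assoc del: SL_mult)
      then show ?thesis using e elem_group_mult[OF h g] by (simp add: E_def)
    qed
    moreover have "g * e * inv\<^bsub>SL m\<^esub> g \<in> ?G"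
      using elem_group_mult elem_group_mult[OF g eG] subgroup.m_inv_closed[OF elem_group_subgroup g] by blast
    ultimately show ?thesis by (simp add: E_def)
  qed
  have elE: "emat m p q (M * x) \<in> E" if pq: "p < m" "q < m" "p \<noteq> q" for p q x
  proof -
    have "mat_cong m M (emat m p q (M * x)) (1\<^sub>m m)"
      using pq by (auto simp: mat_cong_def elem_index cong_0_iff cong_iff_dvd_diff)
    then have "emat m p q (M * x) \<in> ?P" using elem_SL[OF pq(3)] by (simp add: principal_def)
    then have "g * emat m p q (M * x) * inv\<^bsub>SL m\<^esub> g \<in> K \<inter> ?P" if "g \<in> ?G" for g
      using principal_conj[OF _ elem_group_SL[OF that]] conj_elem_mem[OF m K elN elem_group_SL[OF that] pq]
      by (simp add: M_def)
    then show ?thesis using elem_group_elem[OF pq] by (simp add: E_def)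
  qed
  let ?L = "(SL m)\<lparr>carrier := ?G\<rparr>"
  have L: "group ?L" using subgroup.subgroup_is_group[OF elem_group_subgroup is_group] .
  have invL: "inv\<^bsub>?L\<^esub> g = inv\<^bsub>SL m\<^esub> g" if "g \<in> ?G" for g using m_inv_consistent[OF elem_group_subgroup that] .
  define S where "S = {emat m p q 1 | p q. p < m \<and> q < m \<and> p \<noteq> q}"
  have SG: "S \<subseteq> ?G" by (auto simp: S_def intro: elem_group_elem)
  have finS: "finite S"
  proof -
    have "S = (\<lambda>(p, q). emat m p q 1) ` I" by (auto simp: S_def I_def)
    then show ?thesis using finI by simp
  qed
  have "finite_index_subgroup E ?L"
  proof (rule group.finite_index_of_central_quotient[OF L])
    have "subgroup E ?L" using subgroup_incl[OF Esub elem_group_subgroup EG] .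
    then show "E \<lhd> ?L"
      using conj invL by (auto intro!: group.normal_invI[OF L])
    show "finite_index_subgroup (?P \<inter> ?G) ?L" using finite_index_restrict[OF Pfi elem_group_subgroup] .
    show "S \<subseteq> carrier ?L" using SG by simp
    show "finite S" by (rule finS)
    show "generate ?L S = carrier ?L"
      using generate_consistent[OF SG elem_group_subgroup] by (simp add: S_def elem_group_def)
    show "nat M \<ge> 1" using M by simp
  next
    fix k s assume k: "k \<in> ?P \<inter> ?G" and s: "s \<in> S"
    then obtain p q where pq: "p < m" "q < m" "p \<noteq> q" "s = emat m p q 1" by (auto simp: S_def)
    have "s \<in> ?G" using s SG by blast
    then show "k \<otimes>\<^bsub>?L\<^esub> s \<otimes>\<^bsub>?L\<^esub> inv\<^bsub>?L\<^esub> k \<otimes>\<^bsub>?L\<^esub> inv\<^bsub>?L\<^esub> s \<in> E"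
      using principal_central[OF m M Esub _ elE conj _ _ pq(1-3), of k] EKP k invL inv_elem[OF pq(3,2), of 1] pq(4) by auto
  next
    fix s assume s: "s \<in> S"
    then obtain p q where pq: "p < m" "q < m" "p \<noteq> q" "s = emat m p q 1" by (auto simp: S_def)
    have "s [^]\<^bsub>?L\<^esub> nat M = s [^]\<^bsub>SL m\<^esub> nat M"
      using nat_pow_consistent[of s "nat M" ?G] by simp
    also have "\<dots> = emat m p q (M * 1)" using elem_pow[OF pq(3,2), of 1 "nat M"] M pq(4) by simp
    finally show "s [^]\<^bsub>?L\<^esub> nat M \<in> E" using elE[OF pq(1-3), of 1] by simp
  qed
  then have "finite_index_subgroup E (SL m)"
    using finite_index_trans[OF elem_group_finite_index] by blast
  then show ?thesis using finite_index_mono[OF _ _ K] EKP by blast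
qed

section \<open>Free groups and their automorphisms\<close>

abbreviation gen :: "'a \<Rightarrow> 'a letter list" where "gen x \<equiv> [(x, True)]"

lemma fg_mult: "u \<otimes>\<^bsub>free_group S\<^esub> w = reduce (u @ w)"
  by (simp add: free_group_def)

lemma fg_one: "\<one>\<^bsub>free_group S\<^esub> = []"
  by (simp add: free_group_def)

lemma gen_closed: "x \<in> S \<Longrightarrow> gen x \<in> carrier (free_group S)"
  by (simp add: free_group_def)

lemma fg_mono: "S' \<subseteq> S \<Longrightarrow> carrier (free_group S') \<subseteq> carrier (free_group S)"
  by (auto simp: free_group_def)

lemma fg_inv_letter:
  assumes "x \<in> S" shows "inv\<^bsub>free_group S\<^esub> (gen x) = [(x, False)]"
proof (rule group.inv_equality[OF group_free_group])
  show "[(x, False)] \<otimes>\<^bsub>free_group S\<^esub> gen x = \<one>\<^bsub>free_group S\<^esub>"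
    by (simp add: free_group_def reduce_def inv_letter_def)
qed (use assms in \<open>auto simp: free_group_def\<close>)

text \<open>Two homomorphisms, cocycles or signs are compared on the free group by applying this to the subgroup on which they
agree.\<close>

lemma fg_subgroup_gen:
  assumes K: "subgroup K (free_group S)" and g: "\<And>x. x \<in> S \<Longrightarrow> gen x \<in> K"
    and w: "w \<in> carrier (free_group S)"
  shows "w \<in> K"
  using w
proof (induction w)
  case Nil
  show ?case using subgroup.one_closed[OF K] by (simp add: fg_one)
next
  case (Cons a w)
  then have w: "w \<in> carrier (free_group S)" and aS: "fst a \<in> S"
    by (auto simp: free_group_def dest: reduced_ConsD)
  have eq: "[a] \<otimes>\<^bsub>free_group S\<^esub> w = a # w"
    using Cons.prems by (simp add: free_group_def reduce_reduced)
  have "[a] \<in> K"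
  proof (cases "snd a")
    case True
    then show ?thesis using g[OF aS] by (metis (full_types) prod.collapse)
  next
    case False
    then have "[a] = inv\<^bsub>free_group S\<^esub> (gen (fst a))"
      using fg_inv_letter[OF aS] by (metis (full_types) prod.collapse)
    then show ?thesis using subgroup.m_inv_closed[OF K g[OF aS]] by simp
  qed
  then show ?case using subgroup.m_closed[OF K _ Cons.IH[OF w]] eq by metis
qed

lemma fg_hom_eq:
  assumes H: "group H" and \<phi>: "\<phi> \<in> hom (free_group S) H" and \<psi>: "\<psi> \<in> hom (free_group S) H"
    and eq: "\<And>x. x \<in> S \<Longrightarrow> \<phi> (gen x) = \<psi> (gen x)" and w: "w \<in> carrier (free_group S)"
  shows "\<phi> w = \<psi> w"
proof -
  interpret F: group "free_group S" by (rule group_free_group)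
  interpret \<phi>: group_hom "free_group S" H \<phi> using H \<phi> F.is_group by (simp add: group_hom_def group_hom_axioms_def)
  interpret \<psi>: group_hom "free_group S" H \<psi> using H \<psi> F.is_group by (simp add: group_hom_def group_hom_axioms_def)
  have K: "subgroup {w \<in> carrier (free_group S). \<phi> w = \<psi> w} (free_group S)"
    by (rule F.subgroupI) auto
  have "w \<in> {w \<in> carrier (free_group S). \<phi> w = \<psi> w}"
    by (rule fg_subgroup_gen[OF K _ w]) (simp add: eq gen_closed)
  then show ?thesis by simp
qed

lemma fg_extend:
  assumes "group H" "f \<in> S \<rightarrow> carrier H"
  obtains \<phi> where "\<phi> \<in> hom (free_group S) H" "\<phi> \<in> extensional (carrier (free_group S))"
    "\<And>x. x \<in> S \<Longrightarrow> \<phi> (gen x) = f x"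
  using free_group_universal[OF assms] by blast

lemma Aut_carrier: "carrier (AutoGroup G) = auto G"
  by (simp add: AutoGroup_def)

lemma Aut_hom: "\<phi> \<in> carrier (AutoGroup G) \<Longrightarrow> \<phi> \<in> hom G G"
  by (simp add: Aut_carrier auto_def)

lemma Aut_closed: "\<phi> \<in> carrier (AutoGroup G) \<Longrightarrow> w \<in> carrier G \<Longrightarrow> \<phi> w \<in> carrier G"
  using Aut_hom by (rule hom_in_carrier)

lemma Aut_mult_apply:
  "\<phi> \<in> carrier (AutoGroup G) \<Longrightarrow> \<psi> \<in> carrier (AutoGroup G) \<Longrightarrow> w \<in> carrier G \<Longrightarrow>
    (\<phi> \<otimes>\<^bsub>AutoGroup G\<^esub> \<psi>) w = \<phi> (\<psi> w)"
  by (simp add: AutoGroup_def BijGroup_def auto_def compose_def)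

lemma Aut_one_apply: "w \<in> carrier G \<Longrightarrow> \<one>\<^bsub>AutoGroup G\<^esub> w = w"
  by (simp add: AutoGroup_def BijGroup_def)

lemma fg_mult_indep: "u \<otimes>\<^bsub>free_group S\<^esub> w = u \<otimes>\<^bsub>free_group S'\<^esub> w"
  by (simp add: fg_mult)

lemma fg_sub_subgroup: "S' \<subseteq> S \<Longrightarrow> subgroup (carrier (free_group S')) (free_group S)"
proof (rule group.subgroupI[OF group_free_group])
  assume S: "S' \<subseteq> S"
  interpret F: group "free_group S'" by (rule group_free_group)
  show "carrier (free_group S') \<subseteq> carrier (free_group S)" using S by (rule fg_mono)
  show "carrier (free_group S') \<noteq> {}" using F.one_closed by blast
  show "u \<otimes>\<^bsub>free_group S\<^esub> w \<in> carrier (free_group S')"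
    if "u \<in> carrier (free_group S')" "w \<in> carrier (free_group S')" for u w
    using F.m_closed[OF that] by (simp add: fg_mult)
  show "inv\<^bsub>free_group S\<^esub> u \<in> carrier (free_group S')" if u: "u \<in> carrier (free_group S')" for u
  proof -
    have "inv\<^bsub>free_group S\<^esub> u = inv\<^bsub>free_group S'\<^esub> u"
      using F.l_inv[OF u] F.inv_closed[OF u] fg_mono[OF S] u
      by (intro group.inv_equality[OF group_free_group]) (auto simp: fg_mult fg_one)
    then show ?thesis using F.inv_closed[OF u] by simp
  qed
qed

lemma fg_fixed_sub:
  assumes S: "S' \<subseteq> S" and \<phi>: "\<phi> \<in> hom (free_group S) (free_group S)"
    and fixg: "\<And>x. x \<in> S' \<Longrightarrow> \<phi> (gen x) = gen x" and w: "w \<in> carrier (free_group S')"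
  shows "\<phi> w = w"
proof -
  have "\<phi> \<in> hom (free_group S') (free_group S)" "id \<in> hom (free_group S') (free_group S)"
    using \<phi> subsetD[OF fg_mono[OF S]] fg_mult_indep[where S = S and S' = S']
    by (auto simp: hom_def Pi_iff)
  from fg_hom_eq[OF group_free_group this _ w] fixg show ?thesis by simp
qed

text \<open>The inverse of the endomorphism is the one given by the inverses of \<open>u\<close> and \<open>w\<close>; these do not involve \<open>a\<close>, so both
endomorphisms fix them.\<close>

lemma transvection_auto:
  assumes a: "a \<in> S" and u: "u \<in> carrier (free_group (S - {a}))" and w: "w \<in> carrier (free_group (S - {a}))"
  obtains \<phi> where "\<phi> \<in> carrier (AutoGroup (free_group S))"
    "\<phi> (gen a) = u \<otimes>\<^bsub>free_group S\<^esub> gen a \<otimes>\<^bsub>free_group S\<^esub> w"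
    "\<And>v. v \<in> carrier (free_group (S - {a})) \<Longrightarrow> \<phi> v = v"
proof -
  let ?F = "free_group S" and ?F' = "free_group (S - {a})"
  interpret F: group ?F by (rule group_free_group)
  have sub: "S - {a} \<subseteq> S" by blast
  note cl = subsetD[OF fg_mono[OF sub]]
  have sg: "subgroup (carrier ?F') ?F" using fg_sub_subgroup[OF sub] .
  have ex: "\<exists>\<phi>. \<phi> \<in> hom ?F ?F \<and> \<phi> \<in> extensional (carrier ?F) \<and> \<phi> (gen a) = u \<otimes>\<^bsub>?F\<^esub> gen a \<otimes>\<^bsub>?F\<^esub> w \<and>
      (\<forall>v\<in>carrier ?F'. \<phi> v = v)"
    if u: "u \<in> carrier ?F'" and w: "w \<in> carrier ?F'" for u w
  proof -
    have "(\<lambda>x. if x = a then u \<otimes>\<^bsub>?F\<^esub> gen a \<otimes>\<^bsub>?F\<^esub> w else gen x) \<in> S \<rightarrow> carrier ?F"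
      using cl[OF u] cl[OF w] gen_closed[of _ S] a by auto
    from fg_extend[OF F.is_group this]
    obtain \<phi> where \<phi>: "\<phi> \<in> hom ?F ?F" "\<phi> \<in> extensional (carrier ?F)"
      "\<And>x. x \<in> S \<Longrightarrow> \<phi> (gen x) = (if x = a then u \<otimes>\<^bsub>?F\<^esub> gen a \<otimes>\<^bsub>?F\<^esub> w else gen x)" by blast
    have "\<phi> v = v" if "v \<in> carrier ?F'" for v
      by (rule fg_fixed_sub[OF sub \<phi>(1) _ that]) (use \<phi>(3) in auto)
    then show ?thesis using \<phi> a by auto
  qed
  have u': "inv\<^bsub>?F\<^esub> u \<in> carrier ?F'" and w': "inv\<^bsub>?F\<^esub> w \<in> carrier ?F'"
    using subgroup.m_inv_closed[OF sg] u w by auto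
  obtain \<phi> where \<phi>: "\<phi> \<in> hom ?F ?F" "\<phi> \<in> extensional (carrier ?F)"
      "\<phi> (gen a) = u \<otimes>\<^bsub>?F\<^esub> gen a \<otimes>\<^bsub>?F\<^esub> w" "\<And>v. v \<in> carrier ?F' \<Longrightarrow> \<phi> v = v" using ex[OF u w] by blast
  obtain \<psi> where \<psi>: "\<psi> \<in> hom ?F ?F"
      "\<psi> (gen a) = inv\<^bsub>?F\<^esub> u \<otimes>\<^bsub>?F\<^esub> gen a \<otimes>\<^bsub>?F\<^esub> inv\<^bsub>?F\<^esub> w" "\<And>v. v \<in> carrier ?F' \<Longrightarrow> \<psi> v = v" using ex[OF u' w'] by blast
  have ga: "gen a \<in> carrier ?F" using gen_closed[OF a] .
  have id: "id \<in> hom ?F ?F" by (simp add: hom_def)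
  have g': "gen x \<in> carrier ?F'" if "x \<in> S" "x \<noteq> a" for x using that by (intro gen_closed) auto
  have c1: "\<phi> (\<psi> v) = v" if "v \<in> carrier ?F" for v
  proof -
    have h: "\<phi> \<circ> \<psi> \<in> hom ?F ?F" using \<phi>(1) \<psi>(1) by (rule Group.hom_compose[rotated])
    have "(\<phi> \<circ> \<psi>) v = id v"
    proof (rule fg_hom_eq[OF F.is_group h id _ that])
      fix x assume "x \<in> S"
      show "(\<phi> \<circ> \<psi>) (gen x) = id (gen x)"
      proof (cases "x = a")
        case True
        have "\<phi> (\<psi> (gen a)) = inv\<^bsub>?F\<^esub> u \<otimes>\<^bsub>?F\<^esub> (u \<otimes>\<^bsub>?F\<^esub> gen a \<otimes>\<^bsub>?F\<^esub> w) \<otimes>\<^bsub>?F\<^esub> inv\<^bsub>?F\<^esub> w"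
          using \<psi>(2) \<phi>(3,4) u' w' cl ga hom_mult[OF \<phi>(1)] by simp
        then show ?thesis using True cl[OF u] cl[OF w] ga by (simp add: F.m_assoc F.inv_cancel_left)
      qed (use g' \<phi>(4) \<psi>(3) \<open>x \<in> S\<close> in auto)
    qed
    then show ?thesis by simp
  qed
  have c2: "\<psi> (\<phi> v) = v" if "v \<in> carrier ?F" for v
  proof -
    have h: "\<psi> \<circ> \<phi> \<in> hom ?F ?F" using \<psi>(1) \<phi>(1) by (rule Group.hom_compose[rotated])
    have "(\<psi> \<circ> \<phi>) v = id v"
    proof (rule fg_hom_eq[OF F.is_group h id _ that])
      fix x assume "x \<in> S"
      show "(\<psi> \<circ> \<phi>) (gen x) = id (gen x)"
      proof (cases "x = a")
        case True
        have "\<psi> (\<phi> (gen a)) = u \<otimes>\<^bsub>?F\<^esub> (inv\<^bsub>?F\<^esub> u \<otimes>\<^bsub>?F\<^esub> gen a \<otimes>\<^bsub>?F\<^esub> inv\<^bsub>?F\<^esub> w) \<otimes>\<^bsub>?F\<^esub> w"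
          using \<phi>(3) \<psi>(2,3) u w cl ga hom_mult[OF \<psi>(1)] by simp
        then show ?thesis using True cl[OF u] cl[OF w] ga by (simp add: F.m_assoc F.inv_cancel_left)
      qed (use g' \<phi>(4) \<psi>(3) \<open>x \<in> S\<close> in auto)
    qed
    then show ?thesis by simp
  qed
  have "bij_betw \<phi> (carrier ?F) (carrier ?F)"
    by (rule bij_betw_byWitness[of _ \<psi>]) (use c1 c2 hom_in_carrier[OF \<phi>(1)] hom_in_carrier[OF \<psi>(1)] in auto)
  then have "\<phi> \<in> carrier (AutoGroup ?F)" using \<phi> by (simp add: Aut_carrier auto_def Bij_def)
  then show ?thesis using that \<phi> by blast
qed

section \<open>Products along paths in a cyclic cover\<close>

definition shift :: "nat \<Rightarrow> nat letter \<Rightarrow> int" where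
  "shift h a = (if fst a = h then (if snd a then 1 else -1) else 0)"

text \<open>The cyclic covers are unrolled: a word moves along the integers by its exponent sum in the generator \<open>h\<close>, and
periodicity of the labels replaces the residue classes.\<close>

definition disp :: "nat \<Rightarrow> nat letter list \<Rightarrow> int" where
  "disp h w = (\<Sum>a\<leftarrow>w. shift h a)"

lemma disp_simps [simp]: "disp h [] = 0" "disp h (a # w) = shift h a + disp h w"
  "disp h (u @ w) = disp h u + disp h w"
  by (simp_all add: disp_def)

lemma shift_letter [simp]: "shift h (x, b) = (if x = h then (if b then 1 else -1) else 0)"
  by (simp add: shift_def)

lemma shift_inv_letter [simp]: "shift h (inv_letter a) = - shift h a"
  by (simp add: shift_def inv_letter_def)

lemma disp_cancel_cons: "disp h (cancel_cons a w) = shift h a + disp h w"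
  by (cases w) auto

lemma disp_reduce [simp]: "disp h (reduce w) = disp h w"
  by (induction w) (auto simp: reduce_def disp_cancel_cons)

lemma disp_inv: "w \<in> carrier (free_group S) \<Longrightarrow> disp h (inv\<^bsub>free_group S\<^esub> w) = - disp h w"
proof -
  assume w: "w \<in> carrier (free_group S)"
  have "disp h (w \<otimes>\<^bsub>free_group S\<^esub> inv\<^bsub>free_group S\<^esub> w) = 0"
    using group.r_inv[OF group_free_group w] by (simp add: fg_one)
  then show ?thesis by (simp add: fg_mult)
qed

text \<open>Edges of the line labelled by \<open>P\<close>: the letter \<open>j\<close> read at the point \<open>s\<close> contributes \<open>q j s\<close>. With periodic labels the
words of displacement divisible by the period map homomorphically to \<open>P\<close>; this is the usual homomorphism on a subgroup
of finite index given by a labelling of the covering graph.\<close>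

locale path_product = group P for P (structure) +
  fixes q :: "nat \<Rightarrow> int \<Rightarrow> 'a" and h :: nat
  assumes q_closed: "q j s \<in> carrier P"
begin

definition step :: "nat letter \<Rightarrow> int \<Rightarrow> 'a" where
  "step a s = (if snd a then q (fst a) s else inv (q (fst a) (s + shift h a)))"

primrec path :: "nat letter list \<Rightarrow> int \<Rightarrow> 'a" where
  "path [] s = \<one>"
| "path (a # w) s = step a s \<otimes> path w (s + shift h a)"

lemma step_closed [simp]: "step a s \<in> carrier P"
  by (simp add: step_def q_closed)

lemma path_closed [simp]: "path w s \<in> carrier P"
  by (induction w arbitrary: s) auto

lemma path_append: "path (u @ w) s = path u s \<otimes> path w (s + disp h u)"
  by (induction u arbitrary: s) (auto simp: m_assoc add.assoc)

lemma step_inverse: "step a s \<otimes> step (inv_letter a) (s + shift h a) = \<one>"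
  by (auto simp: step_def inv_letter_def shift_def q_closed)

lemma path_cancel_cons: "path (cancel_cons a w) s = step a s \<otimes> path w (s + shift h a)"
proof (cases w)
  case (Cons b v)
  have "step a s \<otimes> (step (inv_letter a) (s + shift h a) \<otimes> path v s) = path v s"
    using step_inverse[of a s] by (simp add: m_assoc[symmetric])
  then show ?thesis using Cons by (auto simp: algebra_simps)
qed simp

lemma path_reduce [simp]: "path (reduce w) s = path w s"
  by (induction w arbitrary: s) (auto simp: reduce_def path_cancel_cons)

lemma path_periodic:
  assumes "\<And>j s. q j (s + d) = q j s" shows "path w (s + d) = path w s"
proof (induction w arbitrary: s)
  case (Cons a w)
  have "q j (s + d + e) = q j (s + e)" for j e using assms[of j "s + e"] by (simp add: ac_simps)
  moreover have "path w (s + d + e) = path w (s + e)" for e using Cons[of "s + e"] by (simp add: ac_simps)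
  ultimately show ?case using assms by (simp add: step_def)
qed simp

end

section \<open>Signed cyclic covers of the rose\<close>

text \<open>The maps \<open>x \<mapsto> b + e x\<close> of \<open>\<int>\<close> with \<open>e = \<plusminus>1\<close>. A path product in this group carries a sign and a
cocycle twisted by that sign at the same time.\<close>

definition signed_affine :: "(int \<times> int) monoid" where
  "signed_affine = \<lparr>carrier = UNIV \<times> {1, -1},
     monoid.mult = (\<lambda>(b, e) (b', e'). (b + e * b', e * e')), one = (0, 1)\<rparr>"

lemma signed_affine_simps [simp]:
  "carrier signed_affine = UNIV \<times> {1, -1}" "\<one>\<^bsub>signed_affine\<^esub> = (0, 1)"
  "(b, e) \<otimes>\<^bsub>signed_affine\<^esub> (b', e') = (b + e * b', e * e')"
  by (simp_all add: signed_affine_def)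

lemma group_signed_affine: "group signed_affine"
proof (rule groupI)
  fix x assume "x \<in> carrier signed_affine"
  then obtain b e where x: "x = (b, e)" "e = 1 \<or> e = -1" by auto
  then show "\<exists>y\<in>carrier signed_affine. y \<otimes>\<^bsub>signed_affine\<^esub> x = \<one>\<^bsub>signed_affine\<^esub>"
    by (intro bexI[of _ "(- e * b, e)"]) auto
qed (auto simp: algebra_simps)

definition gen_sign :: "nat \<Rightarrow> nat \<Rightarrow> nat \<Rightarrow> int \<Rightarrow> int" where
  "gen_sign t i j s = (if j = Suc t \<and> int i dvd s then -1 else 1)"

lemma signed_path_product: "path_product signed_affine (\<lambda>j s. (v j s, gen_sign t i j s))"
  by (auto simp: path_product_def path_product_axioms_def group_signed_affine gen_sign_def)

definition signed_path :: "nat \<Rightarrow> nat \<Rightarrow> (nat \<Rightarrow> int \<Rightarrow> int) \<Rightarrow> nat letter list \<Rightarrow> int \<Rightarrow> int \<times> int" where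
  "signed_path t i v = path_product.path signed_affine (\<lambda>j s. (v j s, gen_sign t i j s)) t"

definition path_sign :: "nat \<Rightarrow> nat \<Rightarrow> nat letter list \<Rightarrow> int \<Rightarrow> int" where
  "path_sign t i w s = snd (signed_path t i (\<lambda>_ _. 0) w s)"

definition gen_cocycle :: "nat \<Rightarrow> nat \<Rightarrow> (nat \<Rightarrow> int \<Rightarrow> int) \<Rightarrow> nat letter list \<Rightarrow> int \<Rightarrow> int" where
  "gen_cocycle t i v w s = fst (signed_path t i v w s)"

lemma snd_inv_signed: "x \<in> carrier signed_affine \<Longrightarrow> y \<in> carrier signed_affine \<Longrightarrow> snd x = snd y \<Longrightarrow>
   snd (inv\<^bsub>signed_affine\<^esub> x) = snd (inv\<^bsub>signed_affine\<^esub> y)"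
proof -
  interpret group signed_affine by (rule group_signed_affine)
  have i: "inv\<^bsub>signed_affine\<^esub> (b, e) = (- e * b, e)" if "e = 1 \<or> e = -1" for b e :: int
    by (rule inv_equality) (use that in auto)
  assume "x \<in> carrier signed_affine" "y \<in> carrier signed_affine" "snd x = snd y"
  then show ?thesis using i by (cases x, cases y) auto
qed

lemma signed_path_snd: "snd (signed_path t i v w s) = path_sign t i w s"
  unfolding path_sign_def
proof (induction w arbitrary: s)
  case Nil
  show ?case by (simp add: signed_path_def path_product.path.simps[OF signed_path_product])
next
  case (Cons a w)
  interpret p1: path_product signed_affine "\<lambda>j s. (v j s, gen_sign t i j s)" t by (rule signed_path_product)
  interpret p2: path_product signed_affine "\<lambda>j s. (0, gen_sign t i j s)" t by (rule signed_path_product[of "\<lambda>_ _. 0"])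
  have m: "snd (x \<otimes>\<^bsub>signed_affine\<^esub> y) = snd x * snd y" for x y by (cases x; cases y) simp
  have "snd (p1.step a s) = snd (p2.step a s)"
    unfolding p1.step_def p2.step_def using snd_inv_signed[OF p1.q_closed p2.q_closed] by simp
  moreover have "snd (p1.path w s') = snd (p2.path w s')" for s' using Cons[of s'] by (simp add: signed_path_def)
  ultimately show ?case by (simp add: signed_path_def m)
qed

lemma signed_path_eq: "signed_path t i v w s = (gen_cocycle t i v w s, path_sign t i w s)"
  using signed_path_snd[of t i v w s] by (simp add: gen_cocycle_def prod_eq_iff)

lemma signed_path_append: "signed_path t i v (u @ w) s = signed_path t i v u s \<otimes>\<^bsub>signed_affine\<^esub> signed_path t i v w (s + disp t u)"
  unfolding signed_path_def by (rule path_product.path_append[OF signed_path_product])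

lemma signed_path_reduce: "signed_path t i v (reduce w) s = signed_path t i v w s"
  unfolding signed_path_def by (rule path_product.path_reduce[OF signed_path_product])

lemma signed_path_closed: "signed_path t i v w s \<in> carrier signed_affine"
  unfolding signed_path_def by (rule path_product.path_closed[OF signed_path_product])

lemma path_sign_append: "path_sign t i (u @ w) s = path_sign t i u s * path_sign t i w (s + disp t u)"
  using signed_path_append[of t i "\<lambda>_ _. 0" u w s] by (simp add: signed_path_eq)

lemma gen_cocycle_append: "gen_cocycle t i v (u @ w) s = gen_cocycle t i v u s + path_sign t i u s * gen_cocycle t i v w (s + disp t u)"
  using signed_path_append[of t i v u w s] by (simp add: signed_path_eq)

lemma path_sign_reduce [simp]: "path_sign t i (reduce w) s = path_sign t i w s"
  using signed_path_reduce[of t i "\<lambda>_ _. 0" w s] by (simp add: signed_path_eq)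

lemma gen_cocycle_reduce [simp]: "gen_cocycle t i v (reduce w) s = gen_cocycle t i v w s"
  using signed_path_reduce[of t i v w s] by (simp add: signed_path_eq)

lemma path_sign_cases: "path_sign t i w s = 1 \<or> path_sign t i w s = -1"
  using signed_path_closed[of t i "\<lambda>_ _. 0" w s] by (simp add: signed_path_eq)

lemma path_sign_square [simp]: "path_sign t i w s * path_sign t i w s = 1" "path_sign t i w s * (path_sign t i w s * x) = x"
  using path_sign_cases[of t i w s] by auto

lemma path_sign_Nil [simp]: "path_sign t i [] s = 1" "gen_cocycle t i v [] s = 0"
  by (simp_all add: path_sign_def gen_cocycle_def signed_path_def path_product.path.simps[OF signed_path_product])

lemma signed_path_gen: "signed_path t i v (gen x) s = (v x s, gen_sign t i x s)"
  by (simp add: signed_path_def path_product.path.simps[OF signed_path_product] path_product.step_def[OF signed_path_product])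

lemma gen_cocycle_gen [simp]: "gen_cocycle t i v (gen x) s = v x s" and path_sign_gen [simp]: "path_sign t i (gen x) s = gen_sign t i x s"
  using signed_path_gen[of t i v x s] signed_path_gen[of t i "\<lambda>_ _. 0" x s] by (simp_all add: signed_path_eq)

lemma disp_gen [simp]: "disp h (gen x) = (if x = h then 1 else 0)"
  by (simp add: shift_def)

lemma gen_sign_periodic: "gen_sign t i j (s + int i) = gen_sign t i j s"
  by (simp add: gen_sign_def)

lemma signed_path_periodic:
  assumes "\<And>j s. v j (s + int i) = v j s"
  shows "signed_path t i v w (s + int i) = signed_path t i v w s"
  unfolding signed_path_def by (rule path_product.path_periodic[OF signed_path_product]) (simp add: assms gen_sign_periodic)

lemma path_sign_periodic: "path_sign t i w (s + int i) = path_sign t i w s"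
  unfolding path_sign_def by (simp add: signed_path_periodic)

lemma gen_cocycle_periodic: "(\<And>j s. v j (s + int i) = v j s) \<Longrightarrow> gen_cocycle t i v w (s + int i) = gen_cocycle t i v w s"
  unfolding gen_cocycle_def by (simp add: signed_path_periodic)

lemma periodic_cong:
  fixes f :: "int \<Rightarrow> 'b"
  assumes per: "\<And>s. f (s + int i) = f s" and c: "[s = s'] (mod int i)"
  shows "f s = f s'"
proof -
  have n: "f (s + int k * int i) = f s" for k s
  proof (induction k)
    case (Suc k)
    then show ?case using per[of "s + int k * int i"] by (simp add: algebra_simps)
  qed simp
  obtain k where k: "s = s' + k * int i" using c by (metis cong_iff_lin cong_sym mult.commute)
  show ?thesis
  proof (cases "k \<ge> 0")
    case True
    then show ?thesis using n[of s' "nat k"] k by simp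
  next
    case False
    then show ?thesis using n[of s "nat (- k)"] k by simp
  qed
qed

lemma path_sign_cong: "[s = s'] (mod int i) \<Longrightarrow> path_sign t i w s = path_sign t i w s'"
  using periodic_cong[of "path_sign t i w" i s s'] path_sign_periodic by blast

text \<open>The words act in the same way on the points and signs of the cover of degree \<open>i\<close>.\<close>

definition same_lift :: "nat \<Rightarrow> nat \<Rightarrow> nat letter list \<Rightarrow> nat letter list \<Rightarrow> bool" where
  "same_lift t i u w \<longleftrightarrow> [disp t u = disp t w] (mod int i) \<and> (\<forall>s. path_sign t i u s = path_sign t i w s)"

lemma same_lift_refl [simp]: "same_lift t i u u" and
  same_lift_sym: "same_lift t i u w \<Longrightarrow> same_lift t i w u" and
  same_lift_trans: "same_lift t i u w \<Longrightarrow> same_lift t i w x \<Longrightarrow> same_lift t i u x"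
  by (auto simp: same_lift_def cong_sym) (meson cong_trans)

lemma same_lift_mult:
  assumes "same_lift t i u u'" "same_lift t i w w'"
  shows "same_lift t i (u \<otimes>\<^bsub>free_group S\<^esub> w) (u' \<otimes>\<^bsub>free_group S\<^esub> w')"
  using assms path_sign_cong[of "s + disp t u" "s + disp t u'" i t w' for s]
  by (auto simp: same_lift_def fg_mult path_sign_append cong_add)

lemma path_sign_inv:
  assumes w: "w \<in> carrier (free_group S)"
  shows "path_sign t i (inv\<^bsub>free_group S\<^esub> w) s = path_sign t i w (s - disp t w)"
proof -
  have "path_sign t i (w \<otimes>\<^bsub>free_group S\<^esub> inv\<^bsub>free_group S\<^esub> w) (s - disp t w) = 1"
    using group.r_inv[OF group_free_group w] by (simp add: fg_one)
  then have "path_sign t i w (s - disp t w) * path_sign t i (inv\<^bsub>free_group S\<^esub> w) s = 1" by (simp add: fg_mult path_sign_append)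
  then show ?thesis using path_sign_cases[of t i w "s - disp t w"] by auto
qed

lemma same_lift_inv:
  assumes "same_lift t i u w" "u \<in> carrier (free_group S)" "w \<in> carrier (free_group S)"
  shows "same_lift t i (inv\<^bsub>free_group S\<^esub> u) (inv\<^bsub>free_group S\<^esub> w)"
  using assms path_sign_cong[of "s - disp t u" "s - disp t w" i t w for s]
  by (auto simp: same_lift_def path_sign_inv disp_inv cong_minus_minus_iff cong_diff)

lemma same_lift_hom:
  assumes \<phi>: "\<phi> \<in> hom (free_group S) (free_group S)" and \<psi>: "\<psi> \<in> hom (free_group S) (free_group S)"
    and g: "\<And>x. x \<in> S \<Longrightarrow> same_lift t i (\<phi> (gen x)) (\<psi> (gen x))" and w: "w \<in> carrier (free_group S)"
  shows "same_lift t i (\<phi> w) (\<psi> w)"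
proof -
  interpret F: group "free_group S" by (rule group_free_group)
  interpret \<phi>: group_hom "free_group S" "free_group S" \<phi> using \<phi> F.is_group by (simp add: group_hom_def group_hom_axioms_def)
  interpret \<psi>: group_hom "free_group S" "free_group S" \<psi> using \<psi> F.is_group by (simp add: group_hom_def group_hom_axioms_def)
  have K: "subgroup {w \<in> carrier (free_group S). same_lift t i (\<phi> w) (\<psi> w)} (free_group S)"
  proof (rule F.subgroupI)
    show "{w \<in> carrier (free_group S). same_lift t i (\<phi> w) (\<psi> w)} \<noteq> {}"
      using F.one_closed \<phi>.hom_one \<psi>.hom_one by force
  qed (auto simp: same_lift_mult same_lift_inv)
  have "w \<in> {w \<in> carrier (free_group S). same_lift t i (\<phi> w) (\<psi> w)}"
    by (rule fg_subgroup_gen[OF K _ w]) (simp add: g gen_closed)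
  then show ?thesis by simp
qed

section \<open>Cocycles\<close>

text \<open>Cocycles of the free group with values in the \<open>i\<close>-periodic functions on the line, on which words act by shifting and
by signs.\<close>

definition cocycle :: "nat \<Rightarrow> nat \<Rightarrow> nat \<Rightarrow> (nat letter list \<Rightarrow> int \<Rightarrow> int) \<Rightarrow> bool" where
  "cocycle n t i f \<longleftrightarrow>
    (\<forall>u\<in>carrier (free_group {..<n}). \<forall>w\<in>carrier (free_group {..<n}). \<forall>s.
       f (u \<otimes>\<^bsub>free_group {..<n}\<^esub> w) s = f u s + path_sign t i u s * f w (s + disp t u)) \<and>
    (\<forall>w\<in>carrier (free_group {..<n}). \<forall>s. f w (s + int i) = f w s)"

lemma cocycle_mult:
  "cocycle n t i f \<Longrightarrow> u \<in> carrier (free_group {..<n}) \<Longrightarrow> w \<in> carrier (free_group {..<n}) \<Longrightarrow>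
   f (u \<otimes>\<^bsub>free_group {..<n}\<^esub> w) s = f u s + path_sign t i u s * f w (s + disp t u)"
  by (simp add: cocycle_def)

lemma cocycle_cong:
  "cocycle n t i f \<Longrightarrow> w \<in> carrier (free_group {..<n}) \<Longrightarrow> [s = s'] (mod int i) \<Longrightarrow> f w s = f w s'"
  using periodic_cong[of "f w" i s s'] by (auto simp: cocycle_def)

lemma gen_cocycle_cocycle: "(\<And>j s. v j (s + int i) = v j s) \<Longrightarrow> cocycle n t i (gen_cocycle t i v)"
  by (auto simp: cocycle_def fg_mult gen_cocycle_append gen_cocycle_periodic)

lemma cocycle_one:
  assumes f: "cocycle n t i f" shows "f [] s = 0"
proof -
  interpret F: group "free_group {..<n}" by (rule group_free_group)
  show ?thesis using cocycle_mult[OF f F.one_closed F.one_closed, of s] by (simp add: fg_one fg_mult reduce_def)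
qed

lemma cocycle_inv:
  assumes f: "cocycle n t i f" and w: "w \<in> carrier (free_group {..<n})"
  shows "f (inv\<^bsub>free_group {..<n}\<^esub> w) (s + disp t w) = - path_sign t i w s * f w s"
proof -
  interpret F: group "free_group {..<n}" by (rule group_free_group)
  let ?i = "f (inv\<^bsub>free_group {..<n}\<^esub> w) (s + disp t w)"
  have "f w s + path_sign t i w s * ?i = 0"
    using cocycle_mult[OF f w F.inv_closed[OF w], of s] F.r_inv[OF w] cocycle_one[OF f] by (simp add: fg_one)
  then show ?thesis using path_sign_cases[of t i w s] by auto
qed

lemma cocycle_unique:
  assumes f: "cocycle n t i f" and g: "cocycle n t i g"
    and eq: "\<And>x s. x < n \<Longrightarrow> f (gen x) s = g (gen x) s" and w: "w \<in> carrier (free_group {..<n})"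
  shows "f w s = g w s"
proof -
  interpret F: group "free_group {..<n}" by (rule group_free_group)
  have K: "subgroup {w \<in> carrier (free_group {..<n}). \<forall>s. f w s = g w s} (free_group {..<n})"
  proof (rule F.subgroupI)
    show "{w \<in> carrier (free_group {..<n}). \<forall>s. f w s = g w s} \<noteq> {}"
      using F.one_closed cocycle_one[OF f] cocycle_one[OF g] by (auto simp: fg_one)
  next
    fix w assume w: "w \<in> {w \<in> carrier (free_group {..<n}). \<forall>s. f w s = g w s}"
    then have "f (inv\<^bsub>free_group {..<n}\<^esub> w) s = g (inv\<^bsub>free_group {..<n}\<^esub> w) s" for s
      using cocycle_inv[OF f, of w "s - disp t w"] cocycle_inv[OF g, of w "s - disp t w"] by simp
    then show "inv\<^bsub>free_group {..<n}\<^esub> w \<in> {w \<in> carrier (free_group {..<n}). \<forall>s. f w s = g w s}"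
      using w by simp
  qed (auto simp: cocycle_mult[OF f] cocycle_mult[OF g])
  have "w \<in> {w \<in> carrier (free_group {..<n}). \<forall>s. f w s = g w s}"
    by (rule fg_subgroup_gen[OF K _ w]) (simp add: eq gen_closed)
  then show ?thesis by simp
qed

lemma cocycle_pullback:
  assumes f: "cocycle n t i f" and \<phi>: "\<phi> \<in> hom (free_group {..<n}) (free_group {..<n})"
    and lift: "\<And>w. w \<in> carrier (free_group {..<n}) \<Longrightarrow> same_lift t i (\<phi> w) w"
  shows "cocycle n t i (\<lambda>w. f (\<phi> w))"
  unfolding cocycle_def
proof (intro conjI ballI allI)
  fix u w s assume u: "u \<in> carrier (free_group {..<n})" and w: "w \<in> carrier (free_group {..<n})"
  have "f (\<phi> (u \<otimes>\<^bsub>free_group {..<n}\<^esub> w)) s = f (\<phi> u) s + path_sign t i (\<phi> u) s * f (\<phi> w) (s + disp t (\<phi> u))"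
    using cocycle_mult[OF f hom_in_carrier[OF \<phi> u] hom_in_carrier[OF \<phi> w]] hom_mult[OF \<phi> u w] by simp
  also have "f (\<phi> w) (s + disp t (\<phi> u)) = f (\<phi> w) (s + disp t u)"
    using lift[OF u] by (intro cocycle_cong[OF f hom_in_carrier[OF \<phi> w]]) (simp add: same_lift_def cong_add_lcancel)
  finally show "f (\<phi> (u \<otimes>\<^bsub>free_group {..<n}\<^esub> w)) s = f (\<phi> u) s + path_sign t i u s * f (\<phi> w) (s + disp t u)"
    using lift[OF u] by (simp add: same_lift_def)
next
  fix w s assume "w \<in> carrier (free_group {..<n})"
  then show "f (\<phi> w) (s + int i) = f (\<phi> w) s"
    using f hom_in_carrier[OF \<phi>] by (simp add: cocycle_def)
qed

lemma cocycle_linear: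
  assumes f: "cocycle n t i f" and g: "\<And>p. p < m \<Longrightarrow> cocycle n t i (g p)"
  shows "cocycle n t i (\<lambda>w s. f w s - (\<Sum>p<m. c p * g p w s))"
  using f g by (auto simp: cocycle_def algebra_simps sum.distrib sum_distrib_left sum_subtractf)

lemma cocycle_coboundary:
  assumes "\<And>s. u (s + int i) = u s"
  shows "cocycle n t i (\<lambda>w s. path_sign t i w s * u (s + disp t w) - u s)"
proof -
  have "u (s + int i + disp t w) = u (s + disp t w)" for s w
    using assms[of "s + disp t w"] by (simp add: ac_simps)
  then have "\<forall>w\<in>carrier (free_group {..<n}). \<forall>s. path_sign t i w (s + int i) * u (s + int i + disp t w) - u (s + int i)
      = path_sign t i w s * u (s + disp t w) - u s"
    by (simp only: path_sign_periodic assms) simp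
  then show ?thesis by (simp add: cocycle_def fg_mult path_sign_append algebra_simps)
qed

lemma cocycle_double: "cocycle n t i f \<Longrightarrow> cocycle n t i (\<lambda>w s. 2 * f w s)"
  by (auto simp: cocycle_def algebra_simps)

abbreviation ypow :: "nat \<Rightarrow> nat \<Rightarrow> nat letter list" where "ypow t l \<equiv> replicate l (t, True)"

lemma reduced_ypow: "reduced (ypow t l)"
proof (induction l)
  case (Suc l)
  then show ?case by (cases l) (auto simp: inv_letter_def)
qed simp

lemma ypow_closed: "t \<in> S \<Longrightarrow> ypow t l \<in> carrier (free_group S)"
  using reduced_ypow by (auto simp: free_group_def)

lemma disp_ypow [simp]: "disp t (ypow t l) = int l"
  by (induction l) (auto simp: shift_def)

lemma path_sign_ypow [simp]: "path_sign t i (ypow t l) s = 1"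
proof (induction l arbitrary: s)
  case (Suc l)
  have "path_sign t i (ypow t (Suc l)) s = path_sign t i (gen t @ ypow t l) s" by simp
  then show ?case by (simp only: path_sign_append path_sign_gen Suc) (simp add: gen_sign_def)
qed simp

lemma cocycle_ypow:
  assumes f: "cocycle n t i f" and t: "t < n"
  shows "f (ypow t l) s = (\<Sum>k<l. f (gen t) (s + int k))"
proof (induction l arbitrary: s)
  case 0
  show ?case using cocycle_one[OF f] by simp
next
  case (Suc l)
  have cl: "gen t \<in> carrier (free_group {..<n})" "ypow t l \<in> carrier (free_group {..<n})"
    using t gen_closed[of t "{..<n}"] ypow_closed[of t "{..<n}"] by auto
  have "ypow t (Suc l) = gen t \<otimes>\<^bsub>free_group {..<n}\<^esub> ypow t l"
    using reduce_reduced[OF reduced_ypow[of "Suc l" t]] by (simp add: fg_mult)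
  then have "f (ypow t (Suc l)) s = f (gen t) s + f (ypow t l) (s + 1)"
    using cocycle_mult[OF f cl, of s] by (simp add: gen_sign_def)
  also have "\<dots> = f (gen t) s + (\<Sum>k<l. f (gen t) (s + int (Suc k)))" using Suc[of "s + 1"] by (simp add: ac_simps)
  finally show ?case by (simp add: sum.lessThan_Suc_shift del: sum.lessThan_Suc)
qed

section \<open>Coordinates on twisted cohomology\<close>

text \<open>The coordinates \<open>q < (t + 1) * i\<close> are arranged in \<open>t + 1\<close> blocks of length \<open>i\<close>. The block \<open>b < t\<close> holds the values of
a cocycle on the trivial generator \<open>b\<close>. The last block holds the values on the sign generator \<open>t + 1\<close> at the points
\<open>1, \<dots>, i - 1\<close>; at the point \<open>0\<close> this value can be removed by a coboundary, and its place \<open>t * i\<close> is given to the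
value of the cocycle on the \<open>i\<close>-th power of the shift generator.\<close>

definition block_gen :: "nat \<Rightarrow> nat \<Rightarrow> nat" where
  "block_gen t b = (if b = t then Suc t else b)"

definition basis_loop :: "nat \<Rightarrow> nat \<Rightarrow> nat \<Rightarrow> nat letter list" where
  "basis_loop t i q = (if q = t * i then ypow t i else gen (block_gen t (q div i)))"

definition basepoint :: "nat \<Rightarrow> nat \<Rightarrow> int" where "basepoint i q = int (q mod i)"

text \<open>The dual basis: cocycles with a single nonzero coordinate. The shift generator is supported on one residue class, so
that its sum over a period is \<open>1\<close>.\<close>

definition coord_values :: "nat \<Rightarrow> nat \<Rightarrow> nat \<Rightarrow> nat \<Rightarrow> int \<Rightarrow> int" where
  "coord_values t i p j s =
    (if j = (if p = t * i then t else block_gen t (p div i)) \<and> [s = int p] (mod int i) then 1 else 0)"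

abbreviation coord where "coord t i p \<equiv> gen_cocycle t i (coord_values t i p)"

text \<open>The second alternative leaves out the sign generator. For \<open>i = 1\<close> its block contains only the place \<open>t * i\<close>, so the
coordinates are unaffected, and the cocycles become homomorphisms to \<open>\<int>\<close>.\<close>

locale signed_cover =
  fixes n t i :: nat
  assumes i_pos: "i \<ge> 1" and rank: "n = t + 2 \<or> n = t + 1 \<and> i = 1"
begin

lemma t_less: "t < n" using rank by auto

lemma coord_cocycle: "cocycle n t i (coord t i p)"
proof (rule gen_cocycle_cocycle)
  fix j s
  have "[s + int i = int p] (mod int i) \<longleftrightarrow> [s = int p] (mod int i)" by (simp add: cong_def)
  then show "coord_values t i p j (s + int i) = coord_values t i p j s" by (simp add: coord_values_def)
qed

lemma block_less: "q < (t + 1) * i \<Longrightarrow> q div i \<le> t"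
  using i_pos by (metis Suc_eq_plus1 less_Suc_eq_le less_mult_imp_div_less)

lemma special_block: "q < (t + 1) * i \<Longrightarrow> q \<noteq> t * i \<Longrightarrow> q div i = t \<Longrightarrow> n = t + 2 \<and> q mod i \<noteq> 0"
proof -
  assume q: "q < (t + 1) * i" "q \<noteq> t * i" "q div i = t"
  have "q = t * i + q mod i" using div_mult_mod_eq[of q i] q(3) by simp
  then show ?thesis using rank q(2) by auto
qed

lemma basis_loop_closed: "q < (t + 1) * i \<Longrightarrow> basis_loop t i q \<in> carrier (free_group {..<n})"
  using block_less[of q] special_block[of q] t_less ypow_closed[of t "{..<n}" i] gen_closed[of _ "{..<n}"]
  by (auto simp: basis_loop_def block_gen_def)

lemma basis_loop_loop:
  assumes q: "q < (t + 1) * i"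
  shows "[disp t (basis_loop t i q) = 0] (mod int i)" "path_sign t i (basis_loop t i q) (basepoint i q) = 1"
proof -
  show "[disp t (basis_loop t i q) = 0] (mod int i)"
    by (auto simp: basis_loop_def block_gen_def cong_def)
  have "\<not> int i dvd int (q mod i)" if "q \<noteq> t * i" "q div i = t"
    using special_block[OF q that] i_pos
    by (metis int_dvd_int_iff mod_mod_trivial dvd_imp_mod_0)
  then show "path_sign t i (basis_loop t i q) (basepoint i q) = 1"
    using block_less[OF q] by (auto simp: basis_loop_def block_gen_def gen_sign_def basepoint_def)
qed

lemma sum_indicator_period:
  "(\<Sum>k<i. (if [int k = 0] (mod int i) then 1 else 0 :: int)) = 1"
proof -
  have "(\<Sum>k<i. (if [int k = 0] (mod int i) then 1 else 0 :: int)) = (\<Sum>k<i. if k = 0 then 1 else 0)"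
    by (intro sum.cong) (auto simp: cong_def)
  then show ?thesis using i_pos by simp
qed

lemma coord_shift_gen: "coord t i p (gen t) s = (if p = t * i \<and> [s = 0] (mod int i) then 1 else 0)"
  by (auto simp: coord_values_def block_gen_def cong_def)

lemma coord_block_gen:
  assumes "p < (t + 1) * i" "b \<le> t" "r < i"
  shows "coord t i p (gen (block_gen t b)) (int r) = (if p = b * i + r \<and> p \<noteq> t * i then 1 else 0)"
proof -
  have "[int r = int p] (mod int i) \<longleftrightarrow> r = p mod i"
    using assms(3) unfolding cong_int_iff by (simp add: cong_def)
  moreover have "(p div i = b \<and> p mod i = r) \<longleftrightarrow> p = b * i + r"
  proof
    assume "p div i = b \<and> p mod i = r"
    then show "p = b * i + r" using div_mult_mod_eq[of p i] by simp
  qed (use assms(3) in simp)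
  moreover have "block_gen t (p div i) = block_gen t b \<longleftrightarrow> p div i = b" "block_gen t b \<noteq> t"
    using block_less[OF assms(1)] assms(2) by (auto simp: block_gen_def)
  ultimately show ?thesis by (auto simp: coord_values_def)
qed

lemma coord_dual:
  assumes p: "p < (t + 1) * i" and q: "q < (t + 1) * i"
  shows "coord t i p (basis_loop t i q) (basepoint i q) = (if p = q then 1 else 0)"
proof (cases "q = t * i")
  case True
  have "coord t i p (ypow t i) 0 = (\<Sum>k<i. coord t i p (gen t) (0 + int k))"
    by (rule cocycle_ypow[OF coord_cocycle t_less])
  also have "\<dots> = (if p = t * i then 1 else 0)"
    using sum_indicator_period by (simp add: coord_shift_gen del: gen_cocycle_gen)
  finally show ?thesis using True i_pos by (simp add: basis_loop_def basepoint_def)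
next
  case False
  have "coord t i p (gen (block_gen t (q div i))) (int (q mod i)) = (if p = q div i * i + q mod i \<and> p \<noteq> t * i then 1 else 0)"
    using block_less[OF q] i_pos by (intro coord_block_gen[OF p]) auto
  then show ?thesis using False by (auto simp: basis_loop_def basepoint_def)
qed

text \<open>Twice the cocycle is the coboundary of a function \<open>u\<close>, which is found by summing the values on the shift generator.
A coboundary vanishes on the words that fix the point \<open>s\<close> with positive sign. The factor \<open>2\<close> appears because the sign
generator changes \<open>u 0\<close> into \<open>- u 0\<close>.\<close>

lemma loops_determine:
  assumes f: "cocycle n t i f" and zero: "\<And>q. q < (t + 1) * i \<Longrightarrow> f (basis_loop t i q) (basepoint i q) = 0"
    and w: "w \<in> carrier (free_group {..<n})" and loop: "[disp t w = 0] (mod int i)" "path_sign t i w s = 1"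
  shows "f w s = 0"
proof -
  define y where "y k = f (gen t) (int k)" for k :: nat
  \<comment> \<open>The constant term is forced by the sign generator at \<open>0\<close>, where the coboundary of \<open>u\<close> is \<open>- 2 * u 0\<close>.\<close>
  define u where "u s = (\<Sum>k<nat (s mod int i). 2 * y k) - f (gen (Suc t)) 0" for s
  have gt: "gen t \<in> carrier (free_group {..<n})" using t_less by (intro gen_closed) simp
  have ysum: "(\<Sum>k<i. y k) = 0"
  proof -
    have "f (ypow t i) 0 = (\<Sum>k<i. y k)" using cocycle_ypow[OF f t_less, of i 0] by (simp add: y_def)
    moreover have "f (ypow t i) 0 = 0" using zero[of "t * i"] i_pos by (simp add: basis_loop_def basepoint_def)
    ultimately show ?thesis by simp
  qed
  have uper: "u (s + int i) = u s" for s by (simp add: u_def)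
  have gens: "2 * f (gen x) s = path_sign t i (gen x) s * u (s + disp t (gen x)) - u s" if x: "x < n" for x s
  proof -
    have gx: "gen x \<in> carrier (free_group {..<n})" using x by (intro gen_closed) simp
    define r where "r = nat (s mod int i)"
    have r: "r < i" "[s = int r] (mod int i)" "s mod int i = int r"
      using i_pos by (auto simp: r_def cong_def nat_less_iff)
    have fr: "f (gen x) s = f (gen x) (int r)" using cocycle_cong[OF f gx r(2)] .
    consider "x < t" | "x = t" | "x = Suc t" using x rank by linarith
    then show ?thesis
    proof cases
      case 1
      have lt: "x * i + r < (t + 1) * i"
      proof -
        have "x * i + r < x * i + i" using r by simp
        also have "\<dots> = (x + 1) * i" by simp
        also have "\<dots> \<le> (t + 1) * i" using 1 by (intro mult_le_mono1) simp
        finally show ?thesis .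
      qed
      have d: "(x * i + r) div i = x" "(x * i + r) mod i = r" using r(1) by auto
      have "t * i div i = t" using i_pos by simp
      then have "x * i + r \<noteq> t * i" using d(1) 1 by auto
      then have "f (gen x) (int r) = 0"
        using zero[OF lt] d 1 by (simp add: basis_loop_def basepoint_def block_gen_def)
      then show ?thesis using fr 1 by (simp add: gen_sign_def)
    next
      case 2
      have us: "u s = (\<Sum>k<r. 2 * y k) - f (gen (Suc t)) 0" using r by (simp add: u_def)
      have "u (s + 1) = (\<Sum>k<Suc r. 2 * y k) - f (gen (Suc t)) 0"
      proof (cases "Suc r = i")
        case True
        have "(s + 1) mod int i = (int r + 1) mod int i" 
          using cong_add[OF r(2) cong_refl[of 1]] unfolding cong_def .
        moreover have "int r + 1 = int i" using True by simp
        ultimately have "(s + 1) mod int i = 0" by simp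
        moreover have "(\<Sum>k<Suc r. 2 * y k) = 0" using True ysum by (simp add: sum_distrib_left[symmetric] del: sum.lessThan_Suc)
        ultimately show ?thesis by (simp add: u_def del: sum.lessThan_Suc)
      next
        case False
        have "(s + 1) mod int i = (int r + 1) mod int i" 
          using cong_add[OF r(2) cong_refl[of 1]] unfolding cong_def .
        also have "\<dots> = int (Suc r)" using False r(1) by (simp add: mod_pos_pos_trivial)
        finally have e: "(s + 1) mod int i = int (Suc r)" .
        show ?thesis unfolding u_def e nat_int ..
      qed
      then show ?thesis using us fr 2 by (simp add: gen_sign_def y_def)
    next
      case 3
      show ?thesis
      proof (cases "r = 0")
        case True
        then have "int i dvd s" using r(3) by (simp add: dvd_eq_mod_eq_0)
        moreover have "u s = - f (gen (Suc t)) 0" using True r(3) by (simp add: u_def)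
        ultimately show ?thesis using fr True 3 by (simp add: gen_sign_def)
      next
        case False
        have lt: "t * i + r < (t + 1) * i" "t * i + r \<noteq> t * i" using r(1) False by auto
        have d: "(t * i + r) div i = t" "(t * i + r) mod i = r" using r(1) by auto
        have "f (gen x) (int r) = 0" using zero[OF lt(1)] lt(2) d 3 by (simp add: basis_loop_def basepoint_def block_gen_def)
        moreover have "\<not> int i dvd s" using r(3) False by (simp add: dvd_eq_mod_eq_0)
        ultimately show ?thesis using fr 3 by (simp add: gen_sign_def)
      qed
    qed
  qed
  have "2 * f w s = path_sign t i w s * u (s + disp t w) - u s"
    by (rule cocycle_unique[OF cocycle_double[OF f] cocycle_coboundary[where u = u, OF uper] gens w])
  moreover have "u (s + disp t w) = u s"
    using periodic_cong[of u i "s + disp t w" s] uper loop(1) by (simp add: cong_def)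
      (metis add.right_neutral mod_add_right_eq)
  ultimately show ?thesis using loop(2) by simp
qed

text \<open>On loops a cocycle is the combination of the coordinate cocycles with its own coordinates as coefficients. This
identity makes the matrices below multiplicative.\<close>

lemma loop_expansion:
  assumes f: "cocycle n t i f" and w: "w \<in> carrier (free_group {..<n})"
    and loop: "[disp t w = 0] (mod int i)" "path_sign t i w s = 1"
  shows "f w s = (\<Sum>p<(t + 1) * i. f (basis_loop t i p) (basepoint i p) * coord t i p w s)"
proof -
  let ?g = "\<lambda>w s. f w s - (\<Sum>p<(t + 1) * i. f (basis_loop t i p) (basepoint i p) * coord t i p w s)"
  have g: "cocycle n t i ?g" using cocycle_linear[OF f coord_cocycle] .
  have "?g w s = 0"
  proof (rule loops_determine[OF g _ w loop])
    fix q assume q: "q < (t + 1) * i"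
    have "(\<Sum>p<(t + 1) * i. f (basis_loop t i p) (basepoint i p) * coord t i p (basis_loop t i q) (basepoint i q))
      = (\<Sum>p<(t + 1) * i. f (basis_loop t i p) (basepoint i p) * (if p = q then 1 else 0))"
      using coord_dual[OF _ q] by (intro sum.cong) auto
    then show "?g (basis_loop t i q) (basepoint i q) = 0" using q by simp
  qed
  then show ?thesis by simp
qed

end

section \<open>The representations\<close>

text \<open>The automorphisms that preserve the signed actions of degree \<open>1, \<dots>, k\<close>.\<close>

definition lift_stab :: "nat \<Rightarrow> nat \<Rightarrow> nat \<Rightarrow> (nat letter list \<Rightarrow> nat letter list) set" where
  "lift_stab n t k = {\<phi> \<in> carrier (AutoGroup (free_group {..<n})).
     \<forall>i\<in>{1..k}. \<forall>w\<in>carrier (free_group {..<n}). same_lift t i (\<phi> w) w}"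

definition rho :: "nat \<Rightarrow> nat \<Rightarrow> (nat letter list \<Rightarrow> nat letter list) \<Rightarrow> int mat" where
  "rho t i \<phi> = mat ((t + 1) * i) ((t + 1) * i) (\<lambda>(p, q). coord t i p (\<phi> (basis_loop t i q)) (basepoint i q))"

lemma rho_carrier [simp]: "rho t i \<phi> \<in> carrier_mat ((t + 1) * i) ((t + 1) * i)"
  by (simp add: rho_def)

lemma rho_carrier' [simp]: "rho t i \<phi> \<in> carrier_mat (i + t * i) (i + t * i)"
  using rho_carrier[of t i \<phi>] by simp

lemma group_Aut: "group (AutoGroup (free_group S))"
  by (rule group.AutoGroup[OF group_free_group])

lemma lift_stab_Aut: "\<phi> \<in> lift_stab n t k \<Longrightarrow> \<phi> \<in> carrier (AutoGroup (free_group {..<n}))"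
  by (simp add: lift_stab_def)

lemma lift_stab_hom: "\<phi> \<in> lift_stab n t k \<Longrightarrow> \<phi> \<in> hom (free_group {..<n}) (free_group {..<n})"
  using lift_stab_Aut Aut_hom by blast

lemma lift_stab_same: "\<phi> \<in> lift_stab n t k \<Longrightarrow> i \<in> {1..k} \<Longrightarrow> w \<in> carrier (free_group {..<n}) \<Longrightarrow> same_lift t i (\<phi> w) w"
  by (simp add: lift_stab_def)

lemma Aut_inv_apply:
  assumes \<phi>: "\<phi> \<in> carrier (AutoGroup (free_group S))" and w: "w \<in> carrier (free_group S)"
  shows "\<phi> ((inv\<^bsub>AutoGroup (free_group S)\<^esub> \<phi>) w) = w"
proof -
  interpret A: group "AutoGroup (free_group S)" by (rule group_Aut)
  show ?thesis using Aut_mult_apply[OF \<phi> A.inv_closed[OF \<phi>] w] A.r_inv[OF \<phi>] Aut_one_apply[OF w] by simp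
qed

text \<open>There are finitely many signed actions on \<open>\<int>/i\<close>, and an action is determined by the generators.\<close>

lemma lift_stab_finite_index: "finite_index_subgroup (lift_stab n t k) (AutoGroup (free_group {..<n}))"
proof -
  let ?F = "free_group {..<n}" and ?A = "AutoGroup (free_group {..<n})"
  interpret A: group ?A by (rule group_Aut)
  have sub: "subgroup (lift_stab n t k) ?A"
  proof (rule A.subgroupI)
    have "\<one>\<^bsub>?A\<^esub> \<in> lift_stab n t k" using A.one_closed by (auto simp: lift_stab_def Aut_one_apply)
    then show "lift_stab n t k \<noteq> {}" by blast
  next
    fix \<phi> assume \<phi>: "\<phi> \<in> lift_stab n t k"
    have "same_lift t i ((inv\<^bsub>?A\<^esub> \<phi>) w) w" if "i \<in> {1..k}" "w \<in> carrier ?F" for i w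
      using lift_stab_same[OF \<phi> that(1) Aut_closed[OF A.inv_closed[OF lift_stab_Aut[OF \<phi>]] that(2)]]
        Aut_inv_apply[OF lift_stab_Aut[OF \<phi>] that(2)] same_lift_sym by simp
    then show "inv\<^bsub>?A\<^esub> \<phi> \<in> lift_stab n t k" using A.inv_closed[OF lift_stab_Aut[OF \<phi>]] by (simp add: lift_stab_def)
  next
    fix \<phi> \<psi> assume \<phi>: "\<phi> \<in> lift_stab n t k" and \<psi>: "\<psi> \<in> lift_stab n t k"
    have "same_lift t i ((\<phi> \<otimes>\<^bsub>?A\<^esub> \<psi>) w) w" if "i \<in> {1..k}" "w \<in> carrier ?F" for i w
      using lift_stab_same[OF \<phi> that(1) Aut_closed[OF lift_stab_Aut[OF \<psi>] that(2)]] lift_stab_same[OF \<psi> that]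
        Aut_mult_apply[OF lift_stab_Aut[OF \<phi>] lift_stab_Aut[OF \<psi>] that(2)] same_lift_trans by metis
    then show "\<phi> \<otimes>\<^bsub>?A\<^esub> \<psi> \<in> lift_stab n t k"
      using A.m_closed[OF lift_stab_Aut[OF \<phi>] lift_stab_Aut[OF \<psi>]] by (simp add: lift_stab_def)
  qed (auto simp: lift_stab_def)
  define c where "c \<phi> = (\<lambda>(i, x)\<in>{1..k} \<times> {..<n}.
    (disp t (\<phi> (gen x)) mod int i, \<lambda>s\<in>{0..<int i}. path_sign t i (\<phi> (gen x)) s))" for \<phi>
  show ?thesis
  proof (rule A.finite_index_subgroupI[where c = c, OF sub])
    have val: "(d mod int i, \<lambda>s\<in>{0..<int i}. path_sign t i w s) \<in> {0..<int i} \<times> ({0..<int i} \<rightarrow>\<^sub>E {1, -1})"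
      if "i \<ge> 1" for d i w
      using that by (intro SigmaI) (simp_all add: restrict_PiE_iff path_sign_cases)
    have "c \<phi> \<in> (\<Pi>\<^sub>E p\<in>{1..k} \<times> {..<n}. {0..<int (fst p)} \<times> ({0..<int (fst p)} \<rightarrow>\<^sub>E {1, -1}))" for \<phi>
      unfolding c_def restrict_PiE_iff using val by force
    then have "c ` carrier ?A \<subseteq> (\<Pi>\<^sub>E p\<in>{1..k} \<times> {..<n}. {0..<int (fst p)} \<times> ({0..<int (fst p)} \<rightarrow>\<^sub>E {1, -1}))"
      by blast
    then show "finite (c ` carrier ?A)"
      by (rule finite_subset) (intro finite_PiE finite_SigmaI; simp)
  next
    fix \<phi> \<psi> assume \<phi>: "\<phi> \<in> carrier ?A" and \<psi>: "\<psi> \<in> carrier ?A" and eq: "c \<phi> = c \<psi>"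
    have same: "same_lift t i (\<phi> w) (\<psi> w)" if i: "i \<in> {1..k}" and w: "w \<in> carrier ?F" for i w
    proof (rule same_lift_hom[OF Aut_hom[OF \<phi>] Aut_hom[OF \<psi>] _ w])
      fix x assume x: "x \<in> {..<n}"
      have e: "disp t (\<phi> (gen x)) mod int i = disp t (\<psi> (gen x)) mod int i"
        "(\<lambda>s\<in>{0..<int i}. path_sign t i (\<phi> (gen x)) s) = (\<lambda>s\<in>{0..<int i}. path_sign t i (\<psi> (gen x)) s)"
        using fun_cong[OF eq, of "(i, x)"] i x by (simp_all add: c_def)
      have "path_sign t i (\<phi> (gen x)) s = path_sign t i (\<psi> (gen x)) s" for s
      proof -
        have "s mod int i \<in> {0..<int i}" using i by simp
        then have "path_sign t i (\<phi> (gen x)) (s mod int i) = path_sign t i (\<psi> (gen x)) (s mod int i)"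
          using fun_cong[OF e(2), of "s mod int i"] by simp
        then show ?thesis using path_sign_cong[of "s mod int i" s i t] by (simp add: cong_def)
      qed
      then show "same_lift t i (\<phi> (gen x)) (\<psi> (gen x))" using e(1) by (simp add: same_lift_def cong_def)
    qed
    let ?\<psi>' = "inv\<^bsub>?A\<^esub> \<psi>"
    have "same_lift t i ((\<phi> \<otimes>\<^bsub>?A\<^esub> ?\<psi>') w) w" if "i \<in> {1..k}" "w \<in> carrier ?F" for i w
      using same[OF that(1) Aut_closed[OF A.inv_closed[OF \<psi>] that(2)]] Aut_inv_apply[OF \<psi> that(2)]
        Aut_mult_apply[OF \<phi> A.inv_closed[OF \<psi>] that(2)] by simp
    then show "\<phi> \<otimes>\<^bsub>?A\<^esub> ?\<psi>' \<in> lift_stab n t k"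
      using A.m_closed[OF \<phi> A.inv_closed[OF \<psi>]] by (simp add: lift_stab_def)
  qed
qed

lemma rho_index: "p < (t + 1) * i \<Longrightarrow> q < (t + 1) * i \<Longrightarrow> rho t i \<phi> $$ (p, q) = coord t i p (\<phi> (basis_loop t i q)) (basepoint i q)"
  by (simp add: rho_def)

locale signed_covers =
  fixes n t k :: nat
  assumes rank: "n = t + 2 \<or> n = t + 1 \<and> k = 1"
begin

abbreviation "F \<equiv> free_group {..<n}"
abbreviation "A \<equiv> AutoGroup (free_group {..<n})"

lemma cover: "i \<in> {1..k} \<Longrightarrow> signed_cover n t i"
  using rank by (auto simp: signed_cover_def)

lemma t_less: "t < n" using rank by auto

text \<open>An automorphism in \<open>lift_stab\<close> pulls cocycles back to cocycles and maps loops to loops, so the entry of the product is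
the expansion of a pulled-back coordinate cocycle along a loop.\<close>

lemma rho_mult:
  assumes i: "i \<in> {1..k}" and \<phi>: "\<phi> \<in> lift_stab n t k" and \<psi>: "\<psi> \<in> lift_stab n t k"
  shows "rho t i (\<phi> \<otimes>\<^bsub>A\<^esub> \<psi>) = rho t i \<phi> * rho t i \<psi>"
proof (rule square_mat_eqI[of _ "(t + 1) * i"])
  interpret signed_cover n t i using cover[OF i] .
  fix p q assume p: "p < (t + 1) * i" and q: "q < (t + 1) * i"
  have lq: "basis_loop t i q \<in> carrier F" using basis_loop_closed[OF q] .
  have \<psi>q: "\<psi> (basis_loop t i q) \<in> carrier F" using hom_in_carrier[OF lift_stab_hom[OF \<psi>] lq] .
  have same: "same_lift t i (\<psi> (basis_loop t i q)) (basis_loop t i q)" using lift_stab_same[OF \<psi> i lq] .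
  have coc: "cocycle n t i (\<lambda>w. coord t i p (\<phi> w))"
    using lift_stab_same[OF \<phi> i] by (intro cocycle_pullback[OF coord_cocycle lift_stab_hom[OF \<phi>]])
  have "rho t i (\<phi> \<otimes>\<^bsub>A\<^esub> \<psi>) $$ (p, q) = coord t i p (\<phi> (\<psi> (basis_loop t i q))) (basepoint i q)"
    using Aut_mult_apply[OF lift_stab_Aut[OF \<phi>] lift_stab_Aut[OF \<psi>] lq] p q by (simp add: rho_index)
  also have "\<dots> = (\<Sum>r<(t + 1) * i. coord t i p (\<phi> (basis_loop t i r)) (basepoint i r) * coord t i r (\<psi> (basis_loop t i q)) (basepoint i q))"
    using same basis_loop_loop[OF q] cong_trans by (intro loop_expansion[OF coc \<psi>q]) (auto simp: same_lift_def)
  also have "\<dots> = (rho t i \<phi> * rho t i \<psi>) $$ (p, q)"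
    using p q by (simp add: mat_mult_index[OF rho_carrier rho_carrier] rho_index)
  finally show "rho t i (\<phi> \<otimes>\<^bsub>A\<^esub> \<psi>) $$ (p, q) = (rho t i \<phi> * rho t i \<psi>) $$ (p, q)" .
qed auto

lemma rho_one:
  assumes i: "i \<in> {1..k}" shows "rho t i \<one>\<^bsub>A\<^esub> = 1\<^sub>m ((t + 1) * i)"
proof (rule square_mat_eqI[of _ "(t + 1) * i"])
  interpret signed_cover n t i using cover[OF i] .
  fix p q assume p: "p < (t + 1) * i" and q: "q < (t + 1) * i"
  then show "rho t i \<one>\<^bsub>A\<^esub> $$ (p, q) = 1\<^sub>m ((t + 1) * i) $$ (p, q)"
    using coord_dual[OF p q] basis_loop_closed[OF q] by (simp add: rho_index Aut_one_apply)
qed auto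

definition \<Gamma> :: "(nat letter list \<Rightarrow> nat letter list) set" where
  "\<Gamma> = {\<phi> \<in> lift_stab n t k. \<forall>i\<in>{1..k}. det (rho t i \<phi>) = 1}"

lemma rho_inv:
  assumes i: "i \<in> {1..k}" and \<phi>: "\<phi> \<in> lift_stab n t k"
  shows "rho t i \<phi> * rho t i (inv\<^bsub>A\<^esub> \<phi>) = 1\<^sub>m ((t + 1) * i)" "inv\<^bsub>A\<^esub> \<phi> \<in> lift_stab n t k"
proof -
  interpret A: group A by (rule group_Aut)
  show inv: "inv\<^bsub>A\<^esub> \<phi> \<in> lift_stab n t k"
    using subgroup.m_inv_closed[OF finite_index_subgroupD[OF lift_stab_finite_index] \<phi>] .
  show "rho t i \<phi> * rho t i (inv\<^bsub>A\<^esub> \<phi>) = 1\<^sub>m ((t + 1) * i)"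
    using rho_mult[OF i \<phi> inv] A.r_inv[OF lift_stab_Aut[OF \<phi>]] rho_one[OF i] by simp
qed

lemma \<Gamma>_finite_index: "finite_index_subgroup \<Gamma> A"
proof -
  interpret A: group A by (rule group_Aut)
  let ?L = "lift_stab n t k"
  have Ls: "subgroup ?L A" using finite_index_subgroupD[OF lift_stab_finite_index] .
  let ?AL = "A\<lparr>carrier := ?L\<rparr>"
  interpret L: group ?AL using subgroup.subgroup_is_group[OF Ls A.is_group] .
  have det_mult: "det (rho t i (\<phi> \<otimes>\<^bsub>A\<^esub> \<psi>)) = det (rho t i \<phi>) * det (rho t i \<psi>)"
    if "i \<in> {1..k}" "\<phi> \<in> ?L" "\<psi> \<in> ?L" for i \<phi> \<psi>
    using rho_mult[OF that] det_mult[OF rho_carrier rho_carrier] by metis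
  have det_inv: "det (rho t i \<phi>) * det (rho t i (inv\<^bsub>A\<^esub> \<phi>)) = 1" if "i \<in> {1..k}" "\<phi> \<in> ?L" for i \<phi>
    using rho_inv[OF that] Determinant.det_mult[OF rho_carrier rho_carrier] by (metis det_one)
  have linv: "inv\<^bsub>?AL\<^esub> \<phi> = inv\<^bsub>A\<^esub> \<phi>" if "\<phi> \<in> ?L" for \<phi> using A.m_inv_consistent[OF Ls that] .
  have linv_in: "inv\<^bsub>A\<^esub> \<phi> \<in> ?L" if "\<phi> \<in> ?L" for \<phi> using subgroup.m_inv_closed[OF Ls that] .
  have "finite_index_subgroup \<Gamma> ?AL"
  proof (rule L.finite_index_subgroupI[where c = "\<lambda>\<phi>. \<lambda>i\<in>{1..k}. det (rho t i \<phi>)"])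
    show "subgroup \<Gamma> ?AL"
    proof (rule L.subgroupI)
      have "\<one>\<^bsub>A\<^esub> \<in> \<Gamma>" using subgroup.one_closed[OF Ls] rho_one by (simp add: \<Gamma>_def)
      then show "\<Gamma> \<noteq> {}" by blast
      fix \<phi> assume \<phi>: "\<phi> \<in> \<Gamma>"
      then have L: "\<phi> \<in> ?L" by (simp add: \<Gamma>_def)
      show "inv\<^bsub>?AL\<^esub> \<phi> \<in> \<Gamma>" using \<phi> det_inv[OF _ L] linv[OF L] linv_in[OF L] by (auto simp: \<Gamma>_def)
      fix \<psi> assume \<psi>: "\<psi> \<in> \<Gamma>"
      then show "\<phi> \<otimes>\<^bsub>?AL\<^esub> \<psi> \<in> \<Gamma>" using \<phi> L subgroup.m_closed[OF Ls] det_mult by (auto simp: \<Gamma>_def)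
    qed (auto simp: \<Gamma>_def)
    have "(\<lambda>\<phi>. \<lambda>i\<in>{1..k}. det (rho t i \<phi>)) ` ?L \<subseteq> {1..k} \<rightarrow>\<^sub>E {1, -1}"
    proof (rule image_subsetI, rule PiE_I)
      fix \<phi> i assume "\<phi> \<in> ?L" "i \<in> {1..k}"
      then have "det (rho t i \<phi>) dvd 1" using det_inv[of i \<phi>] by (metis dvd_triv_left)
      then show "(\<lambda>i\<in>{1..k}. det (rho t i \<phi>)) i \<in> {1, -1}" using \<open>i \<in> {1..k}\<close> by auto
    qed auto
    then show "finite ((\<lambda>\<phi>. \<lambda>i\<in>{1..k}. det (rho t i \<phi>)) ` carrier ?AL)"
      by (simp add: finite_subset[OF _ finite_PiE])
  next
    fix \<phi> \<psi> assume "\<phi> \<in> carrier ?AL" "\<psi> \<in> carrier ?AL"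
      and eq: "(\<lambda>i\<in>{1..k}. det (rho t i \<phi>)) = (\<lambda>i\<in>{1..k}. det (rho t i \<psi>))"
    then have \<phi>: "\<phi> \<in> ?L" and \<psi>: "\<psi> \<in> ?L" by auto
    have "det (rho t i (\<phi> \<otimes>\<^bsub>A\<^esub> inv\<^bsub>A\<^esub> \<psi>)) = 1" if i: "i \<in> {1..k}" for i
    proof -
      have "det (rho t i \<phi>) = det (rho t i \<psi>)" using fun_cong[OF eq, of i] i by simp
      then show ?thesis using det_mult[OF i \<phi> linv_in[OF \<psi>]] det_inv[OF i \<psi>] by simp
    qed
    then show "\<phi> \<otimes>\<^bsub>?AL\<^esub> inv\<^bsub>?AL\<^esub> \<psi> \<in> \<Gamma>"
      using linv[OF \<psi>] subgroup.m_closed[OF Ls \<phi> linv_in[OF \<psi>]] by (simp add: \<Gamma>_def)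
  qed
  then show ?thesis using A.finite_index_trans[OF lift_stab_finite_index] by blast
qed

definition repr :: "(nat letter list \<Rightarrow> nat letter list) \<Rightarrow> nat \<Rightarrow> int mat" where
  "repr \<phi> = (\<lambda>i\<in>{1..k}. rho t i \<phi>)"

abbreviation "target \<equiv> product_group {1..k} (\<lambda>i. SL ((t + 1) * i) :: int mat monoid)"

lemma repr_hom: "repr \<in> hom (A\<lparr>carrier := \<Gamma>\<rparr>) target"
proof (rule homI)
  fix \<phi> assume "\<phi> \<in> carrier (A\<lparr>carrier := \<Gamma>\<rparr>)"
  then show "repr \<phi> \<in> carrier target" by (auto simp: repr_def \<Gamma>_def SL_def simp del: add_mult_distrib)
next
  fix \<phi> \<psi> assume "\<phi> \<in> carrier (A\<lparr>carrier := \<Gamma>\<rparr>)" "\<psi> \<in> carrier (A\<lparr>carrier := \<Gamma>\<rparr>)"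
  then show "repr (\<phi> \<otimes>\<^bsub>A\<lparr>carrier := \<Gamma>\<rparr>\<^esub> \<psi>) = repr \<phi> \<otimes>\<^bsub>target\<^esub> repr \<psi>"
    by (auto simp: repr_def \<Gamma>_def rho_mult intro!: restrict_ext)
qed

section \<open>Automorphisms that act as elementary matrices\<close>

text \<open>Cocycles are additive on these words, and conjugation by a word
in the other generators acts on the values by the signed permutation of that word.\<close>

definition deck_trivial :: "nat \<Rightarrow> nat letter list set" where
  "deck_trivial a = {w \<in> carrier (free_group ({..<n} - {a})). \<forall>i\<in>{1..k}. same_lift t i w []}"

lemma deck_trivial_F: "w \<in> deck_trivial a \<Longrightarrow> w \<in> carrier F"
  using fg_mono[of "{..<n} - {a}" "{..<n}"] by (auto simp: deck_trivial_def)

lemma deck_trivialD: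
  assumes "w \<in> deck_trivial a" "i \<in> {1..k}"
  shows "[disp t w = 0] (mod int i)" "path_sign t i w s = 1"
  using assms by (auto simp: deck_trivial_def same_lift_def)

lemma sub_mult: "u \<in> carrier (free_group ({..<n} - {a})) \<Longrightarrow> w \<in> carrier (free_group ({..<n} - {a})) \<Longrightarrow>
   u \<otimes>\<^bsub>F\<^esub> w \<in> carrier (free_group ({..<n} - {a}))"
  using subgroup.m_closed[OF fg_sub_subgroup[of "{..<n} - {a}" "{..<n}"]] by auto

lemma sub_inv: "u \<in> carrier (free_group ({..<n} - {a})) \<Longrightarrow>
   inv\<^bsub>F\<^esub> u \<in> carrier (free_group ({..<n} - {a}))"
  using subgroup.m_inv_closed[OF fg_sub_subgroup[of "{..<n} - {a}" "{..<n}"]] by auto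

lemma deck_trivial_mult:
  assumes "u \<in> deck_trivial a" "w \<in> deck_trivial a"
  shows "u \<otimes>\<^bsub>F\<^esub> w \<in> deck_trivial a"
    "i \<in> {1..k} \<Longrightarrow> cocycle n t i f \<Longrightarrow> f (u \<otimes>\<^bsub>F\<^esub> w) s = f u s + f w s"
proof -
  have "same_lift t i (u \<otimes>\<^bsub>F\<^esub> w) []" if "i \<in> {1..k}" for i
    using same_lift_mult[of t i u "[]" w "[]" "{..<n}"] assms that
    by (auto simp: deck_trivial_def fg_mult reduce_def)
  then show "u \<otimes>\<^bsub>F\<^esub> w \<in> deck_trivial a" using assms sub_mult by (auto simp: deck_trivial_def)
  assume i: "i \<in> {1..k}" and f: "cocycle n t i f"
  have "f w (s + disp t u) = f w s"
    using deck_trivialD[OF assms(1) i] by (intro cocycle_cong[OF f deck_trivial_F[OF assms(2)]]) (simp add: cong_add_lcancel_0)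
  then show "f (u \<otimes>\<^bsub>F\<^esub> w) s = f u s + f w s"
    using cocycle_mult[OF f deck_trivial_F[OF assms(1)] deck_trivial_F[OF assms(2)]] deck_trivialD[OF assms(1) i] by simp
qed

lemma deck_trivial_inv:
  assumes "u \<in> deck_trivial a"
  shows "inv\<^bsub>F\<^esub> u \<in> deck_trivial a"
    "i \<in> {1..k} \<Longrightarrow> cocycle n t i f \<Longrightarrow> f (inv\<^bsub>F\<^esub> u) s = - f u s"
proof -
  interpret F: group F by (rule group_free_group)
  have one: "inv\<^bsub>F\<^esub> [] = []" using F.inv_one by (simp add: fg_one)
  have "same_lift t i (inv\<^bsub>F\<^esub> u) []" if "i \<in> {1..k}" for i
    using same_lift_inv[of t i u "[]" "{..<n}"] assms that F.one_closed one deck_trivial_F[OF assms]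
    by (auto simp: deck_trivial_def fg_one)
  then show inv: "inv\<^bsub>F\<^esub> u \<in> deck_trivial a" using assms sub_inv by (auto simp: deck_trivial_def)
  assume i: "i \<in> {1..k}" and f: "cocycle n t i f"
  have "f u s + f (inv\<^bsub>F\<^esub> u) s = 0"
    using deck_trivial_mult(2)[OF assms inv i f, of s] F.r_inv[OF deck_trivial_F[OF assms]] cocycle_one[OF f] by (simp add: fg_one)
  then show "f (inv\<^bsub>F\<^esub> u) s = - f u s" by simp
qed

lemma deck_trivial_conj:
  assumes w: "w \<in> deck_trivial a" and u: "u \<in> carrier (free_group ({..<n} - {a}))"
  shows "u \<otimes>\<^bsub>F\<^esub> w \<otimes>\<^bsub>F\<^esub> inv\<^bsub>F\<^esub> u \<in> deck_trivial a"
    "i \<in> {1..k} \<Longrightarrow> cocycle n t i f \<Longrightarrow>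
      f (u \<otimes>\<^bsub>F\<^esub> w \<otimes>\<^bsub>F\<^esub> inv\<^bsub>F\<^esub> u) s = path_sign t i u s * f w (s + disp t u)"
proof -
  interpret F: group F by (rule group_free_group)
  have uF: "u \<in> carrier F" using u fg_mono[of "{..<n} - {a}" "{..<n}"] by auto
  have wF: "w \<in> carrier F" using deck_trivial_F[OF w] .
  have "same_lift t i (u \<otimes>\<^bsub>F\<^esub> w \<otimes>\<^bsub>F\<^esub> inv\<^bsub>F\<^esub> u) []" if "i \<in> {1..k}" for i
  proof -
    have "same_lift t i (u \<otimes>\<^bsub>F\<^esub> w \<otimes>\<^bsub>F\<^esub> inv\<^bsub>F\<^esub> u) (u \<otimes>\<^bsub>F\<^esub> \<one>\<^bsub>F\<^esub> \<otimes>\<^bsub>F\<^esub> inv\<^bsub>F\<^esub> u)"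
      using w that by (intro same_lift_mult) (auto simp: deck_trivial_def fg_one)
    moreover have "u \<otimes>\<^bsub>F\<^esub> \<one>\<^bsub>F\<^esub> \<otimes>\<^bsub>F\<^esub> inv\<^bsub>F\<^esub> u = \<one>\<^bsub>F\<^esub>" using uF by simp
    ultimately show ?thesis by (simp add: fg_one)
  qed
  then show "u \<otimes>\<^bsub>F\<^esub> w \<otimes>\<^bsub>F\<^esub> inv\<^bsub>F\<^esub> u \<in> deck_trivial a"
    using w sub_mult[OF sub_mult[OF u] sub_inv[OF u]] by (auto simp: deck_trivial_def)
  assume i: "i \<in> {1..k}" and f: "cocycle n t i f"
  have c: "f (inv\<^bsub>F\<^esub> u) (s + (disp t u + disp t w)) = f (inv\<^bsub>F\<^esub> u) (s + disp t u)"
  proof (rule cocycle_cong[OF f F.inv_closed[OF uF]])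
    show "[s + (disp t u + disp t w) = s + disp t u] (mod int i)"
      using cong_add[OF cong_refl[of "s + disp t u"] deck_trivialD(1)[OF w i]] by (simp add: algebra_simps)
  qed
  have "f (u \<otimes>\<^bsub>F\<^esub> w \<otimes>\<^bsub>F\<^esub> inv\<^bsub>F\<^esub> u) s
     = f u s + path_sign t i u s * f w (s + disp t u) + path_sign t i u s * f (inv\<^bsub>F\<^esub> u) (s + disp t u)"
    using cocycle_mult[OF f F.m_closed[OF uF wF] F.inv_closed[OF uF], of s] cocycle_mult[OF f uF wF, of s]
      deck_trivialD(2)[OF w i] c by (simp add: fg_mult path_sign_append)
  also have "\<dots> = path_sign t i u s * f w (s + disp t u)"
    using cocycle_inv[OF f uF, of s] by simp
  finally show "f (u \<otimes>\<^bsub>F\<^esub> w \<otimes>\<^bsub>F\<^esub> inv\<^bsub>F\<^esub> u) s = path_sign t i u s * f w (s + disp t u)" .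
qed

lemma ypow_sub: "a < t \<Longrightarrow> ypow t l \<in> carrier (free_group ({..<n} - {a}))"
  using t_less by (intro ypow_closed) auto

lemma deck_trivial_shift:
  assumes w: "w \<in> deck_trivial a" and a: "a < t"
  obtains w' where "w' \<in> deck_trivial a"
    "\<And>i f s. i \<in> {1..k} \<Longrightarrow> cocycle n t i f \<Longrightarrow> f w' s = f w (s + int l)"
  using deck_trivial_conj[OF w ypow_sub[OF a, of l]] that by simp

text \<open>Conjugation by the sign generator negates the values at the multiples of \<open>i\<close> and fixes the others; the quotient of
\<open>w\<close> by its conjugate therefore has the value \<open>2 f w\<close> there and \<open>0\<close> elsewhere.\<close>

lemma deck_trivial_annihilate:
  assumes w: "w \<in> deck_trivial a" and a: "a < t" and n: "n = t + 2"
  obtains w' where "w' \<in> deck_trivial a"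
    "\<And>i f s. i \<in> {1..k} \<Longrightarrow> cocycle n t i f \<Longrightarrow> f w' s = (if int i dvd s then 2 * f w s else 0)"
proof -
  let ?z = "gen (Suc t)"
  have z: "?z \<in> carrier (free_group ({..<n} - {a}))" using a n by (intro gen_closed) auto
  let ?c = "?z \<otimes>\<^bsub>F\<^esub> w \<otimes>\<^bsub>F\<^esub> inv\<^bsub>F\<^esub> ?z"
  note c = deck_trivial_conj[OF w z]
  show ?thesis
  proof (rule that[of "w \<otimes>\<^bsub>F\<^esub> inv\<^bsub>F\<^esub> ?c"])
    show "w \<otimes>\<^bsub>F\<^esub> inv\<^bsub>F\<^esub> ?c \<in> deck_trivial a"
      using deck_trivial_mult(1)[OF w deck_trivial_inv(1)[OF c(1)]] .
    fix i f s assume i: "i \<in> {1..k}" and f: "cocycle n t i f"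
    show "f (w \<otimes>\<^bsub>F\<^esub> inv\<^bsub>F\<^esub> ?c) s = (if int i dvd s then 2 * f w s else 0)"
      using deck_trivial_mult(2)[OF w deck_trivial_inv(1)[OF c(1)] i f] deck_trivial_inv(2)[OF c(1) i f] c(2)[OF i f]
      by (simp add: gen_sign_def)
  qed
qed

text \<open>Annihilating, shifting by \<open>l\<close> and annihilating again leaves \<open>4 f w 0\<close> for the degrees \<open>i\<close> that divide \<open>l\<close>, and
\<open>0\<close> for the other degrees. The proper divisors of \<open>l\<close> are then removed by induction.\<close>

lemma deck_trivial_isolate:
  assumes w: "w \<in> deck_trivial a" and a: "a < t" and n: "n = t + 2"
  shows "l \<in> {1..k} \<Longrightarrow> \<exists>w'\<in>deck_trivial a. \<forall>i\<in>{1..k}. \<forall>f. cocycle n t i f \<longrightarrow>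
    (\<forall>s. f w' s = (if i = l \<and> int i dvd s then 4 * f w 0 else 0))"
proof (induction l rule: less_induct)
  case (less l)
  obtain w1 where w1: "w1 \<in> deck_trivial a"
    "\<And>i f s. i \<in> {1..k} \<Longrightarrow> cocycle n t i f \<Longrightarrow> f w1 s = (if int i dvd s then 2 * f w s else 0)"
    using deck_trivial_annihilate[OF w a n] by metis
  obtain w2 where w2: "w2 \<in> deck_trivial a"
    "\<And>i f s. i \<in> {1..k} \<Longrightarrow> cocycle n t i f \<Longrightarrow> f w2 s = f w1 (s + int l)"
    using deck_trivial_shift[OF w1(1) a] by metis
  obtain w3 where w3: "w3 \<in> deck_trivial a"
    "\<And>i f s. i \<in> {1..k} \<Longrightarrow> cocycle n t i f \<Longrightarrow> f w3 s = (if int i dvd s then 2 * f w2 s else 0)"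
    using deck_trivial_annihilate[OF w2(1) a n] by metis
  have w3v: "f w3 s = (if i dvd l \<and> int i dvd s then 4 * f w 0 else 0)"
    if i: "i \<in> {1..k}" and f: "cocycle n t i f" for i f s
  proof (cases "int i dvd s")
    case True
    have "int i dvd s + int l \<longleftrightarrow> i dvd l" using True by (simp add: dvd_add_right_iff)
    moreover have "f w (s + int l) = f w 0" if "i dvd l"
    proof (rule cocycle_cong[OF f deck_trivial_F[OF w]])
      have "int i dvd s + int l" using True that by (simp add: dvd_add_right_iff)
      then show "[s + int l = 0] (mod int i)" by (simp add: cong_0_iff)
    qed
    ultimately show ?thesis using True w3(2)[OF i f] w2(2)[OF i f] w1(2)[OF i f] by simp
  qed (use w3(2)[OF i f] in simp)
  have "\<exists>v\<in>deck_trivial a. \<forall>i\<in>{1..k}. \<forall>f. cocycle n t i f \<longrightarrow>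
    (\<forall>s. f v s = (if i \<in> D \<and> int i dvd s then 4 * f w 0 else 0))" if "finite D" "D \<subseteq> {1..<l}" for D
    using that
  proof (induction D rule: finite_induct)
    case empty
    have "w \<otimes>\<^bsub>F\<^esub> inv\<^bsub>F\<^esub> w = []" using group.r_inv[OF group_free_group deck_trivial_F[OF w]] by (simp add: fg_one)
    then have "[] \<in> deck_trivial a" using deck_trivial_mult(1)[OF w deck_trivial_inv(1)[OF w]] by simp
    then show ?case using cocycle_one by (intro bexI[of _ "[]"]) auto
  next
    case (insert x D)
    obtain v where v: "v \<in> deck_trivial a" "\<And>i f s. i \<in> {1..k} \<Longrightarrow> cocycle n t i f \<Longrightarrow>
      f v s = (if i \<in> D \<and> int i dvd s then 4 * f w 0 else 0)" using insert by (meson insert_subset)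
    have "x < l" "x \<in> {1..k}" using insert.prems less.prems by auto
    then obtain v' where v': "v' \<in> deck_trivial a" "\<And>i f s. i \<in> {1..k} \<Longrightarrow> cocycle n t i f \<Longrightarrow>
      f v' s = (if i = x \<and> int i dvd s then 4 * f w 0 else 0)" using less.IH[of x] by meson
    show ?case
    proof (intro bexI[of _ "v \<otimes>\<^bsub>F\<^esub> v'"] ballI allI impI)
      show "v \<otimes>\<^bsub>F\<^esub> v' \<in> deck_trivial a" using deck_trivial_mult(1)[OF v(1) v'(1)] .
      fix i f s assume i: "i \<in> {1..k}" and f: "cocycle n t i f"
      show "f (v \<otimes>\<^bsub>F\<^esub> v') s = (if i \<in> insert x D \<and> int i dvd s then 4 * f w 0 else 0)"
        using deck_trivial_mult(2)[OF v(1) v'(1) i f] v(2)[OF i f] v'(2)[OF i f] insert.hyps(2) by auto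
    qed
  qed
  from this[of "{m. m dvd l \<and> 1 \<le> m \<and> m < l}"]
  obtain v where v: "v \<in> deck_trivial a" "\<And>i f s. i \<in> {1..k} \<Longrightarrow> cocycle n t i f \<Longrightarrow>
      f v s = (if i dvd l \<and> 1 \<le> i \<and> i < l \<and> int i dvd s then 4 * f w 0 else 0)" by fastforce
  show ?case
  proof (intro bexI[of _ "w3 \<otimes>\<^bsub>F\<^esub> inv\<^bsub>F\<^esub> v"] ballI allI impI)
    show "w3 \<otimes>\<^bsub>F\<^esub> inv\<^bsub>F\<^esub> v \<in> deck_trivial a"
      using deck_trivial_mult(1)[OF w3(1) deck_trivial_inv(1)[OF v(1)]] .
    fix i f s assume i: "i \<in> {1..k}" and f: "cocycle n t i f"
    have "i dvd l \<Longrightarrow> i \<le> l" using less.prems by (auto intro: dvd_imp_le)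
    then show "f (w3 \<otimes>\<^bsub>F\<^esub> inv\<^bsub>F\<^esub> v) s = (if i = l \<and> int i dvd s then 4 * f w 0 else 0)"
      using deck_trivial_mult(2)[OF w3(1) deck_trivial_inv(1)[OF v(1)] i f] deck_trivial_inv(2)[OF v(1) i f]
        w3v[OF i f] v(2)[OF i f] i by auto
  qed
qed

lemma lift_stabI:
  assumes \<phi>: "\<phi> \<in> carrier A"
    and g: "\<And>i x. i \<in> {1..k} \<Longrightarrow> x < n \<Longrightarrow> same_lift t i (\<phi> (gen x)) (gen x)"
  shows "\<phi> \<in> lift_stab n t k"
proof -
  have "id \<in> hom F F" by (simp add: hom_def)
  then have "same_lift t i (\<phi> w) w" if "i \<in> {1..k}" "w \<in> carrier F" for i w
    using same_lift_hom[OF Aut_hom[OF \<phi>] _ _ that(2), of id t i] g that(1) by simp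
  then show ?thesis using \<phi> by (simp add: lift_stab_def)
qed

lemma transvection_in_lift_stab:
  assumes x: "x < n" and u: "u \<in> deck_trivial x" and w: "w \<in> deck_trivial x"
  obtains \<phi> where "\<phi> \<in> lift_stab n t k" "\<phi> (gen x) = u \<otimes>\<^bsub>F\<^esub> gen x \<otimes>\<^bsub>F\<^esub> w"
    "\<And>v. v \<in> carrier (free_group ({..<n} - {x})) \<Longrightarrow> \<phi> v = v"
proof -
  interpret F: group F by (rule group_free_group)
  have xS: "x \<in> {..<n}" using x by simp
  obtain \<phi> where \<phi>: "\<phi> \<in> carrier A" "\<phi> (gen x) = u \<otimes>\<^bsub>F\<^esub> gen x \<otimes>\<^bsub>F\<^esub> w"
    "\<And>v. v \<in> carrier (free_group ({..<n} - {x})) \<Longrightarrow> \<phi> v = v"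
    using transvection_auto[OF xS, of u w] u w unfolding deck_trivial_def by (metis (no_types, lifting) mem_Collect_eq)
  have "\<phi> \<in> lift_stab n t k"
  proof (rule lift_stabI[OF \<phi>(1)])
    fix i y assume i: "i \<in> {1..k}" and y: "y < n"
    show "same_lift t i (\<phi> (gen y)) (gen y)"
    proof (cases "y = x")
      case True
      have "same_lift t i (u \<otimes>\<^bsub>F\<^esub> gen x \<otimes>\<^bsub>F\<^esub> w) (\<one>\<^bsub>F\<^esub> \<otimes>\<^bsub>F\<^esub> gen x \<otimes>\<^bsub>F\<^esub> \<one>\<^bsub>F\<^esub>)"
        using u w i by (intro same_lift_mult) (auto simp: deck_trivial_def fg_one)
      then show ?thesis using True \<phi>(2) gen_closed[OF xS] by simp
    next
      case False
      then have "gen y \<in> carrier (free_group ({..<n} - {x}))" using y by (intro gen_closed) auto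
      then show ?thesis using \<phi>(3) by simp
    qed
  qed
  then show ?thesis using that \<phi> by blast
qed

lemma one_deck: "[] \<in> deck_trivial a"
proof -
  interpret F': group "free_group ({..<n} - {a})" by (rule group_free_group)
  show ?thesis using F'.one_closed by (simp add: deck_trivial_def fg_one)
qed

lemma fg_l_one: "w \<in> carrier F \<Longrightarrow> [] \<otimes>\<^bsub>F\<^esub> w = w" "w \<in> carrier F \<Longrightarrow> w \<otimes>\<^bsub>F\<^esub> [] = w"
proof -
  interpret F: group F by (rule group_free_group)
  show "w \<in> carrier F \<Longrightarrow> [] \<otimes>\<^bsub>F\<^esub> w = w" "w \<in> carrier F \<Longrightarrow> w \<otimes>\<^bsub>F\<^esub> [] = w"
    using F.l_one F.r_one by (simp_all add: fg_one)
qed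

text \<open>Multiplying the trivial generator \<open>a\<close> by \<open>w\<close> adds the values of the coordinate cocycles on \<open>w\<close> to the columns of the
block \<open>a\<close>.\<close>

lemma rho_right_transvection:
  assumes a: "a < t" and w: "w \<in> deck_trivial a"
  obtains \<phi> where "\<phi> \<in> lift_stab n t k"
    "\<And>i p q. i \<in> {1..k} \<Longrightarrow> p < (t + 1) * i \<Longrightarrow> q < (t + 1) * i \<Longrightarrow>
      rho t i \<phi> $$ (p, q) = (if p = q then 1 else 0) + (if q div i = a then coord t i p w (basepoint i q) else 0)"
proof -
  have an: "a < n" using a t_less by simp
  have ga: "gen a \<in> carrier F" using an by (intro gen_closed) simp
  obtain \<phi> where \<phi>: "\<phi> \<in> lift_stab n t k" "\<phi> (gen a) = [] \<otimes>\<^bsub>F\<^esub> gen a \<otimes>\<^bsub>F\<^esub> w"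
    "\<And>v. v \<in> carrier (free_group ({..<n} - {a})) \<Longrightarrow> \<phi> v = v"
    using transvection_in_lift_stab[OF an one_deck w] by metis
  have "rho t i \<phi> $$ (p, q) = (if p = q then 1 else 0) + (if q div i = a then coord t i p w (basepoint i q) else 0)"
    if i: "i \<in> {1..k}" and p: "p < (t + 1) * i" and q: "q < (t + 1) * i" for i p q
  proof -
    interpret signed_cover n t i using cover[OF i] .
    show ?thesis
    proof (cases "q div i = a")
      case True
      then have "q \<noteq> t * i" using a i by auto
      then have l: "basis_loop t i q = gen a" using True a by (simp add: basis_loop_def block_gen_def)
      have "coord t i p (\<phi> (gen a)) s = coord t i p (gen a) s + coord t i p w s" for s
        using cocycle_mult[OF coord_cocycle ga deck_trivial_F[OF w], of p s] \<phi>(2) fg_l_one(1)[OF ga] a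
        by (simp add: gen_sign_def)
      then show ?thesis using coord_dual[OF p q] l True by (simp add: rho_index[OF p q])
    next
      case False
      have "basis_loop t i q \<in> carrier (free_group ({..<n} - {a}))"
      proof (cases "q = t * i")
        case True
        then show ?thesis using ypow_sub[OF a] by (simp add: basis_loop_def)
      next
        case ne: False
        have "block_gen t (q div i) < n" "block_gen t (q div i) \<noteq> a"
          using block_less[OF q] special_block[OF q ne] False a t_less by (auto simp: block_gen_def)
        then show ?thesis using ne gen_closed[of "block_gen t (q div i)" "{..<n} - {a}"] by (simp add: basis_loop_def)
      qed
      then show ?thesis using coord_dual[OF p q] \<phi>(3) False by (simp add: rho_index[OF p q])
    qed
  qed
  then show ?thesis using that \<phi>(1) by blast
qed

definition realizes :: "(nat letter list \<Rightarrow> nat letter list) \<Rightarrow> nat \<Rightarrow> nat \<Rightarrow> nat \<Rightarrow> int \<Rightarrow> bool" where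
  "realizes \<phi> l p q x \<longleftrightarrow> \<phi> \<in> lift_stab n t k \<and>
    (\<forall>i\<in>{1..k}. rho t i \<phi> = (if i = l then emat ((t + 1) * i) p q x else 1\<^sub>m ((t + 1) * i)))"

lemma gen_deck: "b < t \<Longrightarrow> b \<noteq> a \<Longrightarrow> gen b \<in> deck_trivial a"
  using t_less gen_closed[of b "{..<n} - {a}"] by (auto simp: deck_trivial_def same_lift_def gen_sign_def)

lemma z_square_deck:
  assumes a: "a < t" and n: "n = t + 2"
  shows "gen (Suc t) \<otimes>\<^bsub>F\<^esub> gen (Suc t) \<in> deck_trivial a"
    "i \<in> {1..k} \<Longrightarrow> cocycle n t i f \<Longrightarrow> \<not> int i dvd s \<Longrightarrow>
      f (gen (Suc t) \<otimes>\<^bsub>F\<^esub> gen (Suc t)) s = 2 * f (gen (Suc t)) s"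
proof -
  have z: "gen (Suc t) \<in> carrier (free_group ({..<n} - {a}))" using a n by (intro gen_closed) auto
  then show "gen (Suc t) \<otimes>\<^bsub>F\<^esub> gen (Suc t) \<in> deck_trivial a"
    using sub_mult[OF z z] by (auto simp: deck_trivial_def same_lift_def fg_mult path_sign_append simp del: append_Cons append.simps)
      (simp_all add: shift_def gen_sign_def)
  assume "i \<in> {1..k}" and f: "cocycle n t i f" and s: "\<not> int i dvd s"
  have zF: "gen (Suc t) \<in> carrier F" using n by (intro gen_closed) auto
  show "f (gen (Suc t) \<otimes>\<^bsub>F\<^esub> gen (Suc t)) s = 2 * f (gen (Suc t)) s"
    using cocycle_mult[OF f zF zF, of s] s by (simp add: gen_sign_def)
qed

lemma ypow_deck:
  assumes "a < t" "\<And>i. i \<in> {1..k} \<Longrightarrow> i dvd l" shows "ypow t l \<in> deck_trivial a"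
  using ypow_sub[OF assms(1)] assms(2) by (auto simp: deck_trivial_def same_lift_def cong_0_iff)

text \<open>For a coordinate in a trivial block or in the block of the sign generator, a shifted conjugate of the generator or of
its square is taken; the square acts trivially, and it doubles the value away from the point \<open>0\<close>. For the coordinate
\<open>t * l\<close> a power of the shift generator with exponent divisible by all degrees is taken.\<close>

lemma coordinate_word:
  assumes a: "a < t" and n: "n = t + 2" and l: "l \<in> {1..k}" and p: "p < (t + 1) * l" "p div l \<noteq> a"
  obtains w c where "w \<in> deck_trivial a" "c \<noteq> 0"
    "\<And>p'. p' < (t + 1) * l \<Longrightarrow> coord t l p' w 0 = (if p' = p then c else 0)"
proof -
  interpret signed_cover n t l using cover[OF l] .
  consider "p = t * l" | "p \<noteq> t * l" "p div l < t" | "p \<noteq> t * l" "p div l = t"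
    using block_less[OF p(1)] by linarith
  then show ?thesis
  proof cases
    case 1
    let ?L = "fact k :: nat"
    have "i dvd ?L" if "i \<in> {1..k}" for i using that by (auto intro: dvd_fact)
    then have w: "ypow t ?L \<in> deck_trivial a" using ypow_deck[OF a] by blast
    let ?c = "\<Sum>j<?L. if [int j = 0] (mod int l) then 1 else 0 :: int"
    have "?c \<ge> (\<Sum>j\<in>{0}. if [int j = 0] (mod int l) then 1 else 0)"
      by (rule sum_mono2) (auto simp: fact_gt_zero)
    then have "?c \<noteq> 0" by simp
    moreover have "coord t l p' (ypow t ?L) 0 = (if p' = p then ?c else 0)" for p'
      using cocycle_ypow[OF coord_cocycle t_less, of p' ?L 0] 1 by (simp add: coord_shift_gen del: gen_cocycle_gen)
    ultimately show ?thesis using that w by blast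
  next
    case 2
    obtain w where w: "w \<in> deck_trivial a"
      "\<And>i f s. i \<in> {1..k} \<Longrightarrow> cocycle n t i f \<Longrightarrow> f w s = f (gen (p div l)) (s + int (p mod l))"
      using deck_trivial_shift[OF gen_deck[OF 2(2) p(2)] a, of "p mod l"] by metis
    have "coord t l p' w 0 = (if p' = p then 1 else 0)" if p': "p' < (t + 1) * l" for p'
    proof -
      have "coord t l p' (gen (block_gen t (p div l))) (int (p mod l)) = (if p' = p div l * l + p mod l \<and> p' \<noteq> t * l then 1 else 0)"
        using coord_block_gen[OF p', of "p div l" "p mod l"] block_less[OF p(1)] l by simp
      moreover have "block_gen t (p div l) = p div l" using 2 by (simp add: block_gen_def)
      ultimately show ?thesis using w(2)[OF l coord_cocycle, of p' 0] 2(1) by (simp del: gen_cocycle_gen)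
    qed
    then show ?thesis using that[OF w(1), of 1] by simp
  next
    case 3
    have nd: "\<not> int l dvd int (p mod l)"
      using special_block[OF p(1) 3] l by (metis int_dvd_int_iff mod_mod_trivial dvd_imp_mod_0)
    obtain w where w: "w \<in> deck_trivial a"
      "\<And>i f s. i \<in> {1..k} \<Longrightarrow> cocycle n t i f \<Longrightarrow> f w s = f (gen (Suc t) \<otimes>\<^bsub>F\<^esub> gen (Suc t)) (s + int (p mod l))"
      using deck_trivial_shift[OF z_square_deck(1)[OF a n] a, of "p mod l"] by metis
    have "coord t l p' w 0 = (if p' = p then 2 else 0)" if p': "p' < (t + 1) * l" for p'
    proof -
      have "coord t l p' (gen (block_gen t (p div l))) (int (p mod l)) = (if p' = p div l * l + p mod l \<and> p' \<noteq> t * l then 1 else 0)"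
        using coord_block_gen[OF p', of "p div l" "p mod l"] block_less[OF p(1)] l by simp
      moreover have "block_gen t (p div l) = Suc t" using 3 by (simp add: block_gen_def)
      ultimately have "coord t l p' (gen (Suc t)) (int (p mod l)) = (if p' = p then 1 else 0)"
        using 3(1) by (simp del: gen_cocycle_gen)
      then show ?thesis using w(2)[OF l coord_cocycle, of p' 0] z_square_deck(2)[OF a n l coord_cocycle nd]
        by (simp del: gen_cocycle_gen)
    qed
    then show ?thesis using that[OF w(1), of 2] by simp
  qed
qed

lemma realize_to_trivial_block:
  assumes a: "a < t" and n: "n = t + 2" and l: "l \<in> {1..k}" and p: "p < (t + 1) * l" "p div l \<noteq> a" and s: "s < l"
  shows "\<exists>\<phi> x. x \<noteq> 0 \<and> realizes \<phi> l p (a * l + s) x"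
proof -
  obtain w c where w: "w \<in> deck_trivial a" "c \<noteq> 0"
    "\<And>p'. p' < (t + 1) * l \<Longrightarrow> coord t l p' w 0 = (if p' = p then c else 0)"
    using coordinate_word[OF a n l p] by metis
  obtain w1 where w1: "w1 \<in> deck_trivial a"
    "\<And>i f s. i \<in> {1..k} \<Longrightarrow> cocycle n t i f \<Longrightarrow> f w1 s = (if i = l \<and> int i dvd s then 4 * f w 0 else 0)"
    using deck_trivial_isolate[OF w(1) a n l] by blast
  \<comment> \<open>A shift by \<open>- s\<close> modulo \<open>l\<close>, which moves the support of the values from \<open>0\<close> to \<open>s\<close>.\<close>
  obtain w2 where w2: "w2 \<in> deck_trivial a"
    "\<And>i f r. i \<in> {1..k} \<Longrightarrow> cocycle n t i f \<Longrightarrow> f w2 r = f w1 (r + int (l - s))"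
    using deck_trivial_shift[OF w1(1) a, of "l - s"] by metis
  obtain \<phi> where \<phi>: "\<phi> \<in> lift_stab n t k"
    "\<And>i p q. i \<in> {1..k} \<Longrightarrow> p < (t + 1) * i \<Longrightarrow> q < (t + 1) * i \<Longrightarrow>
      rho t i \<phi> $$ (p, q) = (if p = q then 1 else 0) + (if q div i = a then coord t i p w2 (basepoint i q) else 0)"
    using rho_right_transvection[OF a w2(1)] by metis
  have "rho t i \<phi> = (if i = l then emat ((t + 1) * i) p (a * l + s) (4 * c) else 1\<^sub>m ((t + 1) * i))" if i: "i \<in> {1..k}" for i
  proof (rule square_mat_eqI[of _ "(t + 1) * i"])
    interpret signed_cover n t i using cover[OF i] .
    fix p' q assume p': "p' < (t + 1) * i" and q: "q < (t + 1) * i"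
    show "rho t i \<phi> $$ (p', q) = (if i = l then emat ((t + 1) * i) p (a * l + s) (4 * c) else 1\<^sub>m ((t + 1) * i)) $$ (p', q)"
    proof (cases "i = l")
      case True
      have "int l dvd int (q mod l) + int (l - s) \<longleftrightarrow> l dvd q mod l + (l - s)"
        by (simp only: of_nat_add[symmetric] int_dvd_int_iff)
      also have "\<dots> \<longleftrightarrow> q mod l = s"
      proof
        assume "l dvd q mod l + (l - s)"
        then obtain d where d: "q mod l + (l - s) = l * d" by (rule dvdE)
        have "q mod l < l" using l by simp
        then have "0 < l * d" "l * d < l * 2" using s d by linarith+
        then have "d = 1" by simp
        then show "q mod l = s" using d s by simp
      qed (use s in simp)
      finally have dv: "int l dvd int (q mod l) + int (l - s) \<longleftrightarrow> q mod l = s" .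
      have q_eq: "q = a * l + s \<longleftrightarrow> q div l = a \<and> q mod l = s" using s div_mult_mod_eq[of q l] by auto
      have "coord t l p' w2 (basepoint l q) = (if q mod l = s then 4 * (if p' = p then c else 0) else 0)"
        using w2(2)[OF l, of "coord t l p'" "basepoint l q"] w1(2)[OF l, of "coord t l p'"]
          coord_cocycle True dv w(3)[of p'] p' by (simp add: basepoint_def)
      then show ?thesis using \<phi>(2)[OF i p' q] p' q q_eq unfolding True by (auto simp add: elem_index)
    next
      case False
      have "coord t i p' w2 (basepoint i q) = 0"
        using w2(2)[OF i coord_cocycle] w1(2)[OF i coord_cocycle] False by simp
      then show ?thesis using \<phi>(2)[OF i p' q] False p' q by simp
    qed
  qed auto
  then have "realizes \<phi> l p (a * l + s) (4 * c)" using \<phi>(1) by (simp add: realizes_def)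
  then show ?thesis using w(2) by (intro exI[of _ \<phi>] exI[of _ "4 * c"]) simp
qed

lemma coord_trivial_gen:
  assumes b: "b < t" and i: "i \<in> {1..k}" and p: "p < (t + 1) * i" and r: "r < i"
  shows "coord t i p (gen b) (int r) = (if p = b * i + r then 1 else 0)"
proof -
  interpret signed_cover n t i using cover[OF i] .
  have "(b * i + r) div i = b" using r by simp
  moreover have "t * i div i = t" using i by simp
  ultimately have "b * i + r \<noteq> t * i" using b by auto
  then show ?thesis using coord_block_gen[OF p, of b r] b r by (simp add: block_gen_def del: gen_cocycle_gen)
qed

text \<open>Columns of the last block cannot be isolated by the words used above, since these involve the sign and the shift
generator themselves. Instead a trivial generator is multiplied to the left of the sign generator, respectively of the
shift generator. The matrices so obtained act in all degrees at once; a commutator with an isolated elementary matrix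
restricts them to a single degree.\<close>

lemma rho_sign_transvection:
  assumes b: "b < t" and n: "n = t + 2"
  obtains \<psi> where "\<psi> \<in> lift_stab n t k"
    "\<And>i p q. i \<in> {1..k} \<Longrightarrow> p < (t + 1) * i \<Longrightarrow> q < (t + 1) * i \<Longrightarrow>
      rho t i \<psi> $$ (p, q) = (if p = q then 1 else 0) + (if q div i = t \<and> q \<noteq> t * i \<and> p = b * i + q mod i then 1 else 0)"
proof -
  have gb: "gen b \<in> carrier F" "gen (Suc t) \<in> carrier F" using b n by (auto intro!: gen_closed)
  obtain \<psi> where \<psi>: "\<psi> \<in> lift_stab n t k" "\<psi> (gen (Suc t)) = gen b \<otimes>\<^bsub>F\<^esub> gen (Suc t) \<otimes>\<^bsub>F\<^esub> []"
    "\<And>v. v \<in> carrier (free_group ({..<n} - {Suc t})) \<Longrightarrow> \<psi> v = v"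
    using transvection_in_lift_stab[of "Suc t" "gen b" "[]"] gen_deck[OF b, of "Suc t"] one_deck b n by (metis Suc_lessD less_irrefl add_2_eq_Suc' lessI)
  interpret F: group F by (rule group_free_group)
  have \<psi>g: "\<psi> (gen (Suc t)) = gen b \<otimes>\<^bsub>F\<^esub> gen (Suc t)"
    using \<psi>(2) fg_l_one(2) gb by simp
  have \<psi>fix: "\<psi> (gen x) = gen x" if "x < n" "x \<noteq> Suc t" for x using that by (intro \<psi>(3) gen_closed) auto
  have "rho t i \<psi> $$ (p, q) = (if p = q then 1 else 0) + (if q div i = t \<and> q \<noteq> t * i \<and> p = b * i + q mod i then 1 else 0)"
    if i: "i \<in> {1..k}" and p: "p < (t + 1) * i" and q: "q < (t + 1) * i" for i p q
  proof -
    interpret signed_cover n t i using cover[OF i] .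
    have r: "q mod i < i" using i by simp
    show ?thesis
    proof (cases "q div i = t \<and> q \<noteq> t * i")
      case True
      then have l: "basis_loop t i q = gen (Suc t)" by (simp add: basis_loop_def block_gen_def)
      have "coord t i p (\<psi> (gen (Suc t))) s = coord t i p (gen b) s + coord t i p (gen (Suc t)) s" for s
        using cocycle_mult[OF coord_cocycle gb(1,2), of p s] b unfolding \<psi>g by (simp add: gen_sign_def)
      then show ?thesis using coord_dual[OF p q] l True coord_trivial_gen[OF b i p r]
        by (simp add: rho_index[OF p q] basepoint_def del: gen_cocycle_gen)
    next
      case False
      have "\<psi> (basis_loop t i q) = basis_loop t i q"
      proof (cases "q = t * i")
        case True
        then show ?thesis using n by (auto simp: basis_loop_def intro!: \<psi>(3) ypow_closed)
      next
        case ne: False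
        then show ?thesis using False \<psi>fix[of "q div i"] block_less[OF q] n by (auto simp: basis_loop_def block_gen_def)
      qed
      then show ?thesis using coord_dual[OF p q] False by (auto simp add: rho_index[OF p q])
    qed
  qed
  then show ?thesis using that[OF \<psi>(1)] by blast
qed

lemma rho_shift_transvection:
  assumes b: "b < t"
  obtains \<psi> where "\<psi> \<in> lift_stab n t k"
    "\<And>i p q. i \<in> {1..k} \<Longrightarrow> p < (t + 1) * i \<Longrightarrow> q < (t + 1) * i \<Longrightarrow>
      rho t i \<psi> $$ (p, q) = (if p = q then 1 else 0) + (if q = t * i \<and> p div i = b then 1 else 0)"
proof -
  have gb: "gen b \<in> carrier F" "gen t \<in> carrier F" using b t_less by (auto intro!: gen_closed)
  obtain \<psi> where \<psi>: "\<psi> \<in> lift_stab n t k" "\<psi> (gen t) = gen b \<otimes>\<^bsub>F\<^esub> gen t \<otimes>\<^bsub>F\<^esub> []"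
    "\<And>v. v \<in> carrier (free_group ({..<n} - {t})) \<Longrightarrow> \<psi> v = v"
    using transvection_in_lift_stab[of t "gen b" "[]"] gen_deck[OF b, of t] one_deck b t_less by (metis less_irrefl)
  interpret F: group F by (rule group_free_group)
  have \<psi>g: "\<psi> (gen t) = gen b \<otimes>\<^bsub>F\<^esub> gen t" using \<psi>(2) fg_l_one(2) gb by simp
  have \<psi>fix: "\<psi> (gen x) = gen x" if "x < n" "x \<noteq> t" for x using that by (intro \<psi>(3) gen_closed) auto
  have "rho t i \<psi> $$ (p, q) = (if p = q then 1 else 0) + (if q = t * i \<and> p div i = b then 1 else 0)"
    if i: "i \<in> {1..k}" and p: "p < (t + 1) * i" and q: "q < (t + 1) * i" for i p q
  proof -
    interpret signed_cover n t i using cover[OF i] .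
    show ?thesis
    proof (cases "q = t * i")
      case True
      then have l: "basis_loop t i q = ypow t i" "basepoint i q = 0" using i by (auto simp: basis_loop_def basepoint_def)
      have coc: "cocycle n t i (\<lambda>w. coord t i p (\<psi> w))"
        using lift_stab_same[OF \<psi>(1) i] by (intro cocycle_pullback[OF coord_cocycle lift_stab_hom[OF \<psi>(1)]])
      have "coord t i p (\<psi> (gen t)) s = coord t i p (gen b) s + coord t i p (gen t) s" for s
        using cocycle_mult[OF coord_cocycle gb, of p s] b unfolding \<psi>g by (simp add: gen_sign_def)
      then have "coord t i p (\<psi> (ypow t i)) 0 = (\<Sum>r<i. coord t i p (gen b) (int r)) + (\<Sum>r<i. coord t i p (gen t) (0 + int r))"
        using cocycle_ypow[OF coc t_less, of i 0] by (simp add: sum.distrib del: gen_cocycle_gen)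
      also have "(\<Sum>r<i. coord t i p (gen t) (0 + int r)) = coord t i p (basis_loop t i q) (basepoint i q)"
        using cocycle_ypow[OF coord_cocycle t_less, of p i 0] l by simp
      also have "(\<Sum>r<i. coord t i p (gen b) (int r)) = (\<Sum>r<i. if r = p mod i then (if p div i = b then 1 else 0) else 0)"
      proof (rule sum.cong)
        fix r assume r: "r \<in> {..<i}"
        have "p = b * i + r \<longleftrightarrow> p div i = b \<and> r = p mod i" using r div_mult_mod_eq[of p i] by auto
        then show "coord t i p (gen b) (int r) = (if r = p mod i then (if p div i = b then 1 else 0) else 0)"
          using coord_trivial_gen[OF b i p, of r] r by simp
      qed simp
      also have "\<dots> = (if p div i = b then 1 else 0)" using i by simp
      finally have "coord t i p (\<psi> (ypow t i)) 0 = (if p div i = b then 1 else 0) + (if p = q then 1 else 0)"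
        unfolding coord_dual[OF p q] .
      then show ?thesis unfolding rho_index[OF p q] l using True by simp
    next
      case False
      have "block_gen t (q div i) < n" "block_gen t (q div i) \<noteq> t"
        using block_less[OF q] special_block[OF q False] t_less by (auto simp: block_gen_def)
      then have "\<psi> (basis_loop t i q) = basis_loop t i q" using False \<psi>fix by (simp add: basis_loop_def)
      then show ?thesis using coord_dual[OF p q] False by (simp add: rho_index[OF p q])
    qed
  qed
  then show ?thesis using that[OF \<psi>(1)] by blast
qed

text \<open>The conditions on \<open>\<psi>\<close> say that, as far as row \<open>c\<close>, row \<open>r\<close> and column \<open>p\<close> are concerned, its matrix looks like the elementary
matrix at \<open>(c, r)\<close>. In degrees other than \<open>l\<close> the commutator is that of \<open>\<psi>\<close> and the identity.\<close>

lemma realize_commutator: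
  assumes l: "l \<in> {1..k}" and \<phi>: "realizes \<phi> l p c x" and \<psi>: "\<psi> \<in> lift_stab n t k"
    and lt: "p < (t + 1) * l" "c < (t + 1) * l" "r < (t + 1) * l" and dist: "p \<noteq> c" "p \<noteq> r" "c \<noteq> r"
    and rowc: "\<And>j. j < (t + 1) * l \<Longrightarrow> rho t l \<psi> $$ (c, j) = (if j = c \<or> j = r then 1 else 0)"
    and rowr: "\<And>j. j < (t + 1) * l \<Longrightarrow> rho t l \<psi> $$ (r, j) = (if j = r then 1 else 0)"
    and colp: "\<And>i. i < (t + 1) * l \<Longrightarrow> rho t l \<psi> $$ (i, p) = (if i = p then 1 else 0)"
  shows "\<exists>\<kappa>. realizes \<kappa> l p r x"
proof -
  interpret A: group A by (rule group_Aut)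
  have L: "subgroup (lift_stab n t k) A" using finite_index_subgroupD[OF lift_stab_finite_index] .
  have \<phi>L: "\<phi> \<in> lift_stab n t k" using \<phi> by (simp add: realizes_def)
  have cA: "\<phi> \<in> carrier A" "\<psi> \<in> carrier A" using \<phi>L \<psi> lift_stab_Aut by auto
  let ?V = "inv\<^bsub>A\<^esub> (\<psi> \<otimes>\<^bsub>A\<^esub> \<phi>)"
  \<comment> \<open>The commutator, in the form \<open>\<kappa> (\<psi> \<phi>) = \<phi> \<psi>\<close>, which avoids inverse matrices.\<close>
  define \<kappa> where "\<kappa> = (\<phi> \<otimes>\<^bsub>A\<^esub> \<psi>) \<otimes>\<^bsub>A\<^esub> ?V"
  have m: "\<phi> \<otimes>\<^bsub>A\<^esub> \<psi> \<in> lift_stab n t k" "\<psi> \<otimes>\<^bsub>A\<^esub> \<phi> \<in> lift_stab n t k"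
    using subgroup.m_closed[OF L] \<phi>L \<psi> by auto
  have \<kappa>L: "\<kappa> \<in> lift_stab n t k" unfolding \<kappa>_def
    using subgroup.m_closed[OF L m(1) subgroup.m_inv_closed[OF L m(2)]] .
  have eq: "\<kappa> \<otimes>\<^bsub>A\<^esub> (\<psi> \<otimes>\<^bsub>A\<^esub> \<phi>) = \<phi> \<otimes>\<^bsub>A\<^esub> \<psi>" using cA by (simp add: \<kappa>_def A.m_assoc)
  have "rho t i \<kappa> = (if i = l then emat ((t + 1) * i) p r x else 1\<^sub>m ((t + 1) * i))" if i: "i \<in> {1..k}" for i
  proof -
    let ?m = "(t + 1) * i"
    have rel: "rho t i \<kappa> * (rho t i \<psi> * rho t i \<phi>) = rho t i \<phi> * rho t i \<psi>"
      using rho_mult[OF i \<kappa>L m(2)] rho_mult[OF i \<psi> \<phi>L] rho_mult[OF i \<phi>L \<psi>] eq by simp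
    define Em where "Em = (if i = l then emat ?m p r x else 1\<^sub>m ?m)"
    have Emc: "Em \<in> carrier_mat ?m ?m" by (simp add: Em_def del: add_mult_distrib)
    have rel': "Em * (rho t i \<psi> * rho t i \<phi>) = rho t i \<phi> * rho t i \<psi>"
    proof (cases "i = l")
      case False
      then have "rho t i \<phi> = 1\<^sub>m ?m" using \<phi> i by (simp add: realizes_def)
      then show ?thesis using False left_mult_one_mat[OF rho_carrier] right_mult_one_mat[OF rho_carrier] Em_def by metis
    next
      case True
      have E: "rho t i \<phi> = emat ?m p c x" using \<phi> i True by (simp add: realizes_def)
      let ?P = "rho t i \<psi>"
      have P: "?P \<in> carrier_mat ?m ?m" by simp
      have lt': "p < ?m" "c < ?m" "r < ?m" using lt True by auto
      have PE: "(?P * emat ?m p c x) $$ (u, v) = ?P $$ (u, v) + (if v = c \<and> u = p then x else 0)"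
        if "u < ?m" "v < ?m" for u v
      proof -
        have "(?P * emat ?m p c x) $$ (u, v) = (\<Sum>j<?m. ?P $$ (u, j) * (if j = v then 1 else 0) + (if j = p then (if v = c then ?P $$ (u, p) * x else 0) else 0))"
          unfolding mat_mult_index[OF P elem_carrier that] using that
          by (intro sum.cong) (auto simp: elem_index distrib_left)
        also have "\<dots> = ?P $$ (u, v) + (if v = c then ?P $$ (u, p) * x else 0)"
          unfolding sum.distrib using that lt' by simp
        finally show ?thesis using colp[of u] that unfolding True by auto
      qed
      have PEc: "?P * emat ?m p c x \<in> carrier_mat ?m ?m" using P by (intro square_mult_closed) auto
      have Em: "Em = emat ?m p r x" unfolding Em_def using True by simp
      show ?thesis unfolding E Em
      proof (rule square_mat_eqI[of _ ?m])
        fix u v assume uv: "u < ?m" "v < ?m"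
        show "(emat ?m p r x * (?P * emat ?m p c x)) $$ (u, v) = (emat ?m p c x * ?P) $$ (u, v)"
          unfolding elem_mult_index[OF PEc uv lt'(3)] elem_mult_index[OF P uv lt'(2)]
          using uv PE[OF uv] PE[OF lt'(3) uv(2)] rowc[of v] rowr[of v] True dist by auto
      qed (use P PEc square_mult_closed[OF elem_carrier PEc] square_mult_closed[OF elem_carrier P] in auto)
    qed
    let ?V = "rho t i (inv\<^bsub>A\<^esub> (\<psi> \<otimes>\<^bsub>A\<^esub> \<phi>))"
    have "rho t i \<psi> * rho t i \<phi> * ?V = 1\<^sub>m ?m" using rho_inv[OF i m(2)] rho_mult[OF i \<psi> \<phi>L] by simp
    then have cancel: "Y = Y * (rho t i \<psi> * rho t i \<phi>) * ?V" if "Y \<in> carrier_mat ?m ?m" for Y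
      using that assoc_mult_mat[OF that square_mult_closed[OF rho_carrier rho_carrier] rho_carrier]
        right_mult_one_mat[OF that] by metis
    have "rho t i \<kappa> = rho t i \<kappa> * (rho t i \<psi> * rho t i \<phi>) * ?V" by (rule cancel[OF rho_carrier])
    also have "\<dots> = Em * (rho t i \<psi> * rho t i \<phi>) * ?V" unfolding rel rel' ..
    also have "\<dots> = Em" by (rule cancel[OF Emc, symmetric])
    finally show ?thesis unfolding Em_def .
  qed
  then show ?thesis using \<kappa>L by (auto simp: realizes_def)
qed

text \<open>A second trivial block \<open>b\<close> serves as the intermediate step, which is why \<open>t \<ge> 2\<close> is assumed.\<close>

lemma realize_from_trivial_block:
  assumes n: "n = t + 2" and t2: "t \<ge> 2" and l: "l \<in> {1..k}" and a: "a < t" and s: "s < l"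
    and r: "r < (t + 1) * l" "r div l = t"
  shows "\<exists>\<kappa> x. x \<noteq> 0 \<and> realizes \<kappa> l (a * l + s) r x"
proof -
  define b where "b = (if a = 0 then 1 else 0 :: nat)"
  have b: "b < t" "b \<noteq> a" using t2 by (auto simp: b_def)
  let ?p = "a * l + s"
  have lt: "a' * l + s' < (t + 1) * l" if "a' < t" "s' < l" for a' s'
  proof -
    have "a' * l + s' < (a' + 1) * l" using that by simp
    also have "\<dots> \<le> (t + 1) * l" using that by (intro mult_le_mono1) simp
    finally show ?thesis .
  qed
  have d: "(a' * l + s') div l = a'" "(a' * l + s') mod l = s'" if "s' < l" for a' s' using that by auto
  have tl: "t * l div l = t" "t * l mod l = 0" using l by auto
  obtain \<psi>z where \<psi>z: "\<psi>z \<in> lift_stab n t k"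
    "\<And>p q. p < (t + 1) * l \<Longrightarrow> q < (t + 1) * l \<Longrightarrow>
      rho t l \<psi>z $$ (p, q) = (if p = q then 1 else 0) + (if q div l = t \<and> q \<noteq> t * l \<and> p = b * l + q mod l then 1 else 0)"
    using rho_sign_transvection[OF b(1) n] l by metis
  obtain \<psi>y where \<psi>y: "\<psi>y \<in> lift_stab n t k"
    "\<And>p q. p < (t + 1) * l \<Longrightarrow> q < (t + 1) * l \<Longrightarrow>
      rho t l \<psi>y $$ (p, q) = (if p = q then 1 else 0) + (if q = t * l \<and> p div l = b then 1 else 0)"
    using rho_shift_transvection[OF b(1)] l by metis
  note \<psi> = \<psi>z(1) \<psi>y(1) \<psi>z(2) \<psi>y(2)
  define e where "e = r mod l"
  have e: "e < l" "r = t * l + e" using l r div_mult_mod_eq[of r l] by (auto simp: e_def)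
  let ?c = "b * l + e"
  obtain \<phi> x where \<phi>: "x \<noteq> 0" "realizes \<phi> l ?p ?c x"
    using realize_to_trivial_block[OF b(1) n l lt[OF a s] _ e(1)] d(1)[OF s] b(2) by metis
  have ne: "?p \<noteq> ?c" "?p \<noteq> r" "?c \<noteq> r" using d[OF s, of a] d[OF e(1), of b] r(2) a b by auto
  define \<psi> where "\<psi> = (if r = t * l then \<psi>y else \<psi>z)"
  have \<psi>L: "\<psi> \<in> lift_stab n t k" using \<psi> by (simp add: \<psi>_def)
  have "\<exists>\<kappa>. realizes \<kappa> l ?p r x"
  proof (rule realize_commutator[OF l \<phi>(2) \<psi>L lt[OF a s] lt[OF b(1) e(1)] r(1) ne])
    fix j assume j: "j < (t + 1) * l"
    show "rho t l \<psi> $$ (?c, j) = (if j = ?c \<or> j = r then 1 else 0)"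
    proof (cases "r = t * l")
      case True
      then show ?thesis using \<psi>(4)[OF lt[OF b(1) e(1)] j] d[OF e(1), of b] ne by (auto simp: \<psi>_def)
    next
      case False
      have "(j div l = t \<and> j \<noteq> t * l \<and> ?c = b * l + j mod l) \<longleftrightarrow> j = r"
      proof
        assume h: "j div l = t \<and> j \<noteq> t * l \<and> ?c = b * l + j mod l"
        then have "j = t * l + e" using div_mult_mod_eq[of j l] by simp
        then show "j = r" using e(2) by simp
      next
        assume "j = r"
        then show "j div l = t \<and> j \<noteq> t * l \<and> ?c = b * l + j mod l" using False r(2) e_def by simp
      qed
      then show ?thesis using \<psi>(3)[OF lt[OF b(1) e(1)] j] ne False by (auto simp: \<psi>_def)
    qed
    show "rho t l \<psi> $$ (r, j) = (if j = r then 1 else 0)"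
    proof -
      have "r \<noteq> b * l + j mod l" using r(2) d(1)[of "j mod l" b] b l by auto
      then show ?thesis using \<psi>(3)[OF r(1) j] \<psi>(4)[OF r(1) j] r(2) b by (auto simp: \<psi>_def)
    qed
    show "rho t l \<psi> $$ (j, ?p) = (if j = ?p then 1 else 0)"
      using \<psi>(3)[OF j lt[OF a s]] \<psi>(4)[OF j lt[OF a s]] d[OF s, of a] a tl by (auto simp: \<psi>_def)
  qed
  then show ?thesis using \<phi>(1) by blast
qed

end

section \<open>A free subgroup of SL(2,Z)\<close>

text \<open>Sanov's generators. The subgroup they generate contains the congruence subgroup of level \<open>4\<close>, and it is free by a
ping-pong argument on \<open>\<int>\<^sup>2\<close>.\<close>

definition sanov_gen :: "nat \<Rightarrow> int mat" where
  "sanov_gen j = (if j = 0 then emat 2 0 1 2 else emat 2 1 0 2)"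

definition sanov_word :: "nat letter list \<Rightarrow> int mat" where
  "sanov_word = eval_word (SL 2) sanov_gen"

abbreviation "F2 \<equiv> free_group {..<2::nat}"

lemma sanov_gen_closed: "sanov_gen \<in> {..<2} \<rightarrow> carrier (SL 2)"
  by (auto simp: sanov_gen_def intro: elem_SL)

lemma sanov_hom: "sanov_word \<in> hom F2 (SL 2)"
proof -
  interpret S: group "SLZ 2" by (rule group_SL)
  show ?thesis
  proof (rule homI)
    show "sanov_word w \<in> carrier (SL 2)" if "w \<in> carrier F2" for w
      using S.eval_word_closed[OF sanov_gen_closed] that by (simp add: sanov_word_def free_group_def)
    show "sanov_word (u \<otimes>\<^bsub>F2\<^esub> w) = sanov_word u \<otimes>\<^bsub>SL 2\<^esub> sanov_word w"
      if "u \<in> carrier F2" "w \<in> carrier F2" for u w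
      using S.eval_word_reduce[OF sanov_gen_closed, of "u @ w"] S.eval_word_append[OF sanov_gen_closed, of u w] that
      unfolding sanov_word_def by (auto simp: free_group_def image_Un)
  qed
qed

lemma sanov_letter: "eval_letter (SL 2) sanov_gen (j, b) = (if j = 0 then emat 2 0 1 (if b then 2 else -2)
   else emat 2 1 0 (if b then 2 else -2))"
  by (auto simp: eval_letter_def sanov_gen_def inv_elem)

definition sanov :: "int mat set" where "sanov = sanov_word ` carrier F2"

lemma sanov_group_hom: "group_hom F2 (SL 2) sanov_word"
  using sanov_hom group_free_group group_SL by (auto simp: group_hom_def group_hom_axioms_def)

lemma sanov_subgroup: "subgroup sanov (SL 2)"
  unfolding sanov_def by (rule group_hom.img_is_subgroup[OF sanov_group_hom])

lemma sanov_elem_group: "sanov \<subseteq> elem_group 2"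
proof -
  have "sanov_word w \<in> elem_group 2" for w
  proof (induction w)
    case Nil
    show ?case using subgroup.one_closed[OF elem_group_subgroup] by (simp add: sanov_word_def eval_word_def)
  next
    case (Cons a w)
    obtain j b where a: "a = (j, b)" by (cases a)
    have "eval_letter (SL 2) sanov_gen a \<in> elem_group 2"
      unfolding a sanov_letter by (auto intro: elem_group_elem)
    then show ?case using Cons elem_group_mult by (simp add: sanov_word_def eval_word_def)
  qed
  then show ?thesis by (auto simp: sanov_def)
qed

lemma sanov_gens: "emat 2 0 1 (2 * x) \<in> sanov" "emat 2 1 0 (2 * x) \<in> sanov"
proof -
  have g: "sanov_word (gen j) = sanov_gen j" if "j < 2" for j
  proof -
    interpret S: group "SLZ 2" by (rule group_SL)
    have "sanov_gen j \<in> carrier (SL 2)" using sanov_gen_closed that by auto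
    then show ?thesis using S.r_one unfolding sanov_word_def by (simp add: eval_letter_def)
  qed
  have "gen j \<in> carrier F2" if "j < 2" for j using that by (intro gen_closed) simp
  then have "sanov_gen j \<in> sanov" if "j < 2" for j using g[OF that] that unfolding sanov_def by (metis imageI)
  from this[of 0] this[of 1] have "emat 2 0 1 2 \<in> sanov" "emat 2 1 0 2 \<in> sanov" by (simp_all add: sanov_gen_def)
  then show "emat 2 0 1 (2 * x) \<in> sanov" "emat 2 1 0 (2 * x) \<in> sanov"
    using elem_multiple_mem[OF sanov_subgroup, of 0 1 2 x] elem_multiple_mem[OF sanov_subgroup, of 1 0 2 x]
    by (simp_all add: mult.commute)
qed

lemma det_dim2: "A \<in> carrier_mat 2 2 \<Longrightarrow> det A = A $$ (0, 0) * A $$ (1, 1) - A $$ (0, 1) * A $$ (1, 0)"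
  for A :: "int mat"
proof -
  assume A: "A \<in> carrier_mat 2 2"
  have "det A = (\<Sum>j<2. A $$ (0, j) * cofactor A 0 j)"
    by (rule laplace_expansion_row[OF A]) simp
  also have "\<dots> = A $$ (0, 0) * cofactor A 0 0 + A $$ (0, 1) * cofactor A 0 1"
    by (simp add: numeral_2_eq_2)
  finally have "det A = A $$ (0, 0) * cofactor A 0 0 + A $$ (0, 1) * cofactor A 0 1" .
  moreover have "cofactor A 0 0 = A $$ (1, 1)" "cofactor A 0 1 = - A $$ (1, 0)"
    using A by (auto simp: cofactor_def mat_delete_def det_single)
  ultimately show ?thesis by simp
qed

text \<open>The Euclidean algorithm with even quotients on the first column. It cannot stall at entries of equal absolute value,
since one entry is odd and the other even, and the congruence modulo \<open>4\<close> excludes \<open>-1\<close> as its result.\<close>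

lemma sanov_euclid:
  assumes "A \<in> carrier (SLZ 2)" "[A $$ (0, 0) = 1] (mod 4)" "even (A $$ (0, 1))" "even (A $$ (1, 0))"
  shows "A \<in> sanov"
  using assms
proof (induction "nat \<bar>A $$ (0, 0)\<bar> + nat \<bar>A $$ (1, 0)\<bar>" arbitrary: A rule: less_induct)
  case less
  interpret S: group "SLZ 2" by (rule group_SL)
  have Ac: "A \<in> carrier_mat 2 2" using less.prems(1) by (rule SL_carrierD)
  define a b c d where abcd: "a = A $$ (0, 0)" "b = A $$ (0, 1)" "c = A $$ (1, 0)" "d = A $$ (1, 1)"
  have det: "a * d - b * c = 1" using less.prems(1) det_dim2[OF Ac] by (simp add: SL_def abcd)
  have a4: "[a = 1] (mod 4)" and ev: "even b" "even c" using less.prems abcd by auto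
  have odd: "odd a" using a4 by (auto simp: cong_def) presburger
  have step: "A \<in> sanov" if B: "B = E * A" "B \<in> sanov" "E \<in> sanov" for B E
  proof -
    have E: "E \<in> carrier (SL 2)" using B(3) subgroup.subset[OF sanov_subgroup] by blast
    have "A = inv\<^bsub>SL 2\<^esub> E \<otimes>\<^bsub>SL 2\<^esub> B" using S.inv_cancel_left(1)[OF E less.prems(1)] B(1) by simp
    then show ?thesis using subgroup.m_closed[OF sanov_subgroup subgroup.m_inv_closed[OF sanov_subgroup B(3)] B(2)] by metis
  qed
  have reduce: "A \<in> sanov" if E: "E \<in> sanov" "(E * A) $$ (0, 0) = a + 2 * x * c" "(E * A) $$ (1, 0) = c + 2 * y * a"
    "(E * A) $$ (0, 1) = b + 2 * x * d" "x = 0 \<or> y = 0"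
    "\<bar>a + 2 * x * c\<bar> + \<bar>c + 2 * y * a\<bar> < \<bar>a\<bar> + \<bar>c\<bar>" for E x y
  proof (rule step[OF refl _ E(1)])
    have ESL: "E \<in> carrier (SL 2)" using E(1) subgroup.subset[OF sanov_subgroup] by blast
    show "E * A \<in> sanov"
    proof (rule less.hyps)
      show "nat \<bar>(E * A) $$ (0, 0)\<bar> + nat \<bar>(E * A) $$ (1, 0)\<bar> < nat \<bar>A $$ (0, 0)\<bar> + nat \<bar>A $$ (1, 0)\<bar>"
        unfolding E(2,3) abcd(1,3)[symmetric] using E(6) by linarith
      show "E * A \<in> carrier (SL 2)" using S.m_closed[OF ESL less.prems(1)] by simp
      obtain c' where c': "c = 2 * c'" using ev by (auto elim: evenE)
      have "(a + 2 * x * c) mod 4 = (a + 4 * (x * c')) mod 4" by (simp add: c')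
      also have "\<dots> = a mod 4" by simp
      finally have "(a + 2 * x * c) mod 4 = a mod 4" .
      then show "[(E * A) $$ (0, 0) = 1] (mod 4)" using a4 by (simp add: E(2) cong_def)
      show "even ((E * A) $$ (0, 1))" unfolding E(4) using ev by simp
      show "even ((E * A) $$ (1, 0))" unfolding E(3) using ev by simp
    qed
  qed
  have e0: "(emat 2 0 1 z * A) $$ (i, j) = A $$ (i, j) + (if i = 0 then z * A $$ (1, j) else 0)" if "i < 2" "j < 2" for z i j
    using elem_mult_index[OF Ac that] by simp
  have e1: "(emat 2 1 0 z * A) $$ (i, j) = A $$ (i, j) + (if i = 1 then z * A $$ (0, j) else 0)" if "i < 2" "j < 2" for z i j
    using elem_mult_index[OF Ac that] by simp
  have "\<bar>a\<bar> \<noteq> \<bar>c\<bar>" using odd ev(2) by presburger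
  then consider "c = 0" | "\<bar>a\<bar> < \<bar>c\<bar>" | "c \<noteq> 0" "\<bar>c\<bar> < \<bar>a\<bar>" by linarith
  then show ?case
  proof cases
    case 1
    then have "a * d = 1" using det by simp
    then have "\<bar>a\<bar> = 1" by (metis abs_mult abs_one zmult_eq_1_iff abs_zmult_eq_1)
    then have "a = 1" using a4 by (auto simp: abs_if cong_def split: if_splits)
    then have "d = 1" using \<open>a * d = 1\<close> by simp
    obtain b' where b': "b = 2 * b'" using ev by (auto elim: evenE)
    have "A = emat 2 0 1 (2 * b')"
    proof (rule square_mat_eqI[of _ 2])
      fix i j :: nat assume "i < 2" "j < 2"
      then have "(i = 0 \<or> i = 1) \<and> (j = 0 \<or> j = 1)" by auto
      then show "A $$ (i, j) = emat 2 0 1 (2 * b') $$ (i, j)"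
        using 1 \<open>a = 1\<close> \<open>d = 1\<close> b' by (auto simp: elem_index abcd)
    qed (use Ac in auto)
    then show ?thesis using sanov_gens(1) by simp
  next
    case 2
    define y where "y = - sgn a * sgn c"
    have "\<bar>c + 2 * y * a\<bar> < \<bar>c\<bar>" using 2 odd by (auto simp: y_def sgn_if abs_if split: if_splits)
    then show ?thesis
      by (intro reduce[of "emat 2 1 0 (2 * y)" 0 y]) (auto simp: e1 abcd sanov_gens simp del: One_nat_def)
  next
    case 3
    define x where "x = - sgn a * sgn c"
    have "\<bar>a + 2 * x * c\<bar> < \<bar>a\<bar>" using 3 by (auto simp: x_def sgn_if abs_if split: if_splits)
    then show ?thesis
      by (intro reduce[of "emat 2 0 1 (2 * x)" x 0]) (auto simp: e0 abcd sanov_gens simp del: One_nat_def)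
  qed
qed

lemma sanov_finite_index: "finite_index_subgroup sanov (SL 2)"
proof -
  have "principal 2 4 \<subseteq> sanov"
  proof
    fix A assume A: "A \<in> principal 2 4"
    have c: "[A $$ (i, j) = (1\<^sub>m 2) $$ (i, j)] (mod 4)" if "i < 2" "j < 2" for i j
      using A that unfolding principal_def mat_cong_def by simp
    have "4 dvd A $$ (0, 1)" "4 dvd A $$ (1, 0)" using c[of 0 1] c[of 1 0] by (simp_all add: cong_0_iff)
    then have "even (A $$ (0, 1))" "even (A $$ (1, 0))" by (auto elim: dvd_trans[rotated])
    then show "A \<in> sanov" using c[of 0 0] A by (intro sanov_euclid) (auto simp: principal_def)
  qed
  then show ?thesis
    using group.finite_index_mono[OF group_SL principal_finite_index[of 4 2] _ sanov_subgroup] by simp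
qed

fun pong :: "nat letter \<Rightarrow> int \<times> int \<Rightarrow> int \<times> int" where
  "pong (j, b) (x, y) = (if j = 0 then (x + (if b then 2 else -2) * y, y) else (x, y + (if b then 2 else -2) * x))"

text \<open>The regions of the letters for the ping-pong: a letter maps every region but that of its inverse into its own.\<close>

fun region :: "nat letter \<Rightarrow> (int \<times> int) \<Rightarrow> bool" where
  "region (j, b) (x, y) \<longleftrightarrow> (if j = 0 then \<bar>y\<bar> < \<bar>x\<bar> else \<bar>x\<bar> < \<bar>y\<bar>) \<and> x \<noteq> 0 \<and> y \<noteq> 0 \<and> ((x > 0 \<longleftrightarrow> y > 0) \<longleftrightarrow> b)"

lemma pong_region:
  assumes "fst a < 2" "fst b < 2" "b \<noteq> inv_letter a" "region b v"
  shows "region a (pong a v)"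
proof -
  obtain j p where a: "a = (j, p)" by (cases a)
  obtain l q where b: "b = (l, q)" by (cases b)
  obtain x y where v: "v = (x, y)" by (cases v)
  have "j = 0 \<or> j = 1" "l = 0 \<or> l = 1" using assms a b by auto
  then show ?thesis using assms(3,4) unfolding a b v
    by (cases p; cases q) (auto simp: inv_letter_def abs_if split: if_splits)
qed

lemma region_disjoint: "fst a < 2 \<Longrightarrow> fst b < 2 \<Longrightarrow> region a v \<Longrightarrow> region b v \<Longrightarrow> a = b"
  by (cases a; cases b; cases v) (auto split: if_splits)

lemma ping_pong_word:
  assumes "fst b < 2" "region b v"
  shows "reduced w \<Longrightarrow> fst ` set w \<subseteq> {..<2} \<Longrightarrow> w \<noteq> [] \<Longrightarrow> b \<noteq> inv_letter (last w) \<Longrightarrow>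
    region (hd w) (foldr pong w v)"
proof (induction w)
  case (Cons a w)
  show ?case
  proof (cases w)
    case Nil
    then show ?thesis using Cons.prems pong_region[OF _ assms(1) _ assms(2), of a] by simp
  next
    case (Cons c w')
    have "region (hd w) (foldr pong w v)" using Cons Cons.IH Cons.prems by auto
    then show ?thesis using Cons Cons.prems pong_region[of a c "foldr pong w v"] by auto
  qed
qed simp

definition act2 :: "int mat \<Rightarrow> int \<times> int \<Rightarrow> int \<times> int" where
  "act2 A v = (A $$ (0, 0) * fst v + A $$ (0, 1) * snd v, A $$ (1, 0) * fst v + A $$ (1, 1) * snd v)"

lemma act2_mult: "A \<in> carrier_mat 2 2 \<Longrightarrow> B \<in> carrier_mat 2 2 \<Longrightarrow> act2 (A * B) v = act2 A (act2 B v)"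
  by (simp add: act2_def mat_mult_index[of _ 2] numeral_2_eq_2 algebra_simps)

lemma act2_sanov_word: "fst ` set w \<subseteq> {..<2} \<Longrightarrow> act2 (sanov_word w) v = foldr pong w v"
proof (induction w)
  case Nil
  show ?case by (simp add: act2_def sanov_word_def eval_word_def)
next
  case (Cons a w)
  interpret S: group "SLZ 2" by (rule group_SL)
  obtain j b where a: "a = (j, b)" by (cases a)
  have "sanov_word w \<in> carrier (SL 2)"
    using S.eval_word_closed[OF sanov_gen_closed] Cons.prems by (simp add: sanov_word_def)
  then have w: "sanov_word w \<in> carrier_mat 2 2" by (rule SL_carrierD)
  have "sanov_word (a # w) = eval_letter (SL 2) sanov_gen a * sanov_word w"
    by (simp add: sanov_word_def eval_word_def)
  moreover have "act2 (eval_letter (SL 2) sanov_gen a) u = pong a u" for u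
    unfolding a sanov_letter by (cases u) (simp add: act2_def elem_index)
  moreover have "eval_letter (SL 2) sanov_gen a \<in> carrier_mat 2 2" unfolding a sanov_letter by simp
  ultimately show ?case using act2_mult[OF _ w] Cons by simp
qed

text \<open>There are four regions, so a starting vector can be chosen outside the region of the first letter of the word and
outside the region of the inverse of the last. The word moves it into the region of its first letter, hence moves it.\<close>

lemma sanov_word_inj: "inj_on sanov_word (carrier F2)"
proof -
  interpret h: group_hom F2 "SL 2" sanov_word by (rule sanov_group_hom)
  have "w = []" if w: "w \<in> carrier F2" "sanov_word w = 1\<^sub>m 2" for w
  proof (rule ccontr)
    assume ne: "w \<noteq> []"
    have red: "reduced w" and S: "fst ` set w \<subseteq> {..<2}" using w(1) by (auto simp: free_group_def)
    define T where "T = {(0::nat, True), (0, False), (1, True), (1::nat, False)}"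
    have "card {inv_letter (last w), hd w} < card T"
      using card_insert_le_m1[of 2 "{hd w}" "inv_letter (last w)"] by (simp add: T_def)
    then obtain b where b: "b \<in> T" "b \<noteq> inv_letter (last w)" "b \<noteq> hd w"
      by (metis card_mono finite.emptyI finite_insert insertI1 insertI2 not_le subsetI)
    define v where "v = (if fst b = 0 then (2, if snd b then 1 else -1) else (1, if snd b then 2 else -2) :: int \<times> int)"
    have rb: "region b v" "fst b < 2" using b(1) by (auto simp: T_def v_def)
    have "region (hd w) (foldr pong w v)" using ping_pong_word[OF rb(2,1) red S ne b(2)] .
    moreover have "foldr pong w v = v" using act2_sanov_word[OF S, of v] w(2) by (simp add: act2_def)
    moreover have "fst (hd w) < 2" using ne S by (cases w) auto
    ultimately show False using region_disjoint[OF _ rb(2) _ rb(1), of "hd w"] b(3) by simp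
  qed
  then have "\<forall>w\<in>carrier F2. sanov_word w = \<one>\<^bsub>SL 2\<^esub> \<longrightarrow> w = \<one>\<^bsub>F2\<^esub>" by (simp add: fg_one)
  then show ?thesis using h.inj_on_one_iff by blast
qed

section \<open>SL(2,Z) is large\<close>

text \<open>In the free group \<open>sanov\<close> on \<open>a\<close> and \<open>b\<close>, take the words with exponent sum in \<open>a\<close> divisible by \<open>d\<close>, and label the
edges \<open>b\<close> of the corresponding cyclic cover by \<open>x 0, \<dots>, x (d - 1)\<close>, the edges \<open>a\<close> by the identity. The word
\<open>a\<^sup>j b a\<^sup>-\<^sup>j\<close> then has the value \<open>x j\<close>.\<close>

lemma SL2_large:
  fixes P (structure) and x :: "nat \<Rightarrow> 'p"
  assumes P: "group P" and x: "\<And>j. x j \<in> carrier P" and d: "d \<ge> 1"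
  shows "\<exists>K \<theta>. finite_index_subgroup K (SLZ 2) \<and> \<theta> \<in> hom (SLZ 2\<lparr>carrier := K\<rparr>) P \<and>
    (\<forall>j<d. \<exists>g\<in>K \<inter> elem_group 2. \<theta> g = x j)"
proof -
  interpret P: group P by (rule P)
  interpret S: group "SLZ 2" by (rule group_SL)
  interpret F: group F2 by (rule group_free_group)
  interpret h: group_hom F2 "SL 2" sanov_word by (rule sanov_group_hom)
  define val where "val j s = (if j = 1 then x (nat (s mod int d)) else \<one>)" for j :: nat and s :: int
  interpret pp: path_product P val 0
    by unfold_locales (simp add: val_def x)
  have per: "pp.path w s = pp.path w s'" if "[s = s'] (mod int d)" for w s s'
    using periodic_cong[of "pp.path w" d, OF _ that] pp.path_periodic[of "int d" w] by (simp add: val_def)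
  have pmult: "pp.path (u \<otimes>\<^bsub>F2\<^esub> w) s = pp.path u s \<otimes> pp.path w (s + disp 0 u)" for u w s
    by (simp add: fg_mult pp.path_append)
  define \<psi> where "\<psi> = inv_into (carrier F2) sanov_word"
  have \<psi>: "\<psi> A \<in> carrier F2" "sanov_word (\<psi> A) = A" if "A \<in> sanov" for A
    using that by (auto simp: \<psi>_def sanov_def inv_into_into f_inv_into_f)
  have \<psi>w: "\<psi> (sanov_word w) = w" if "w \<in> carrier F2" for w
    using that sanov_word_inj by (simp add: \<psi>_def)
  have sanov: "A \<in> carrier (SL 2)" if "A \<in> sanov" for A using that subgroup.subset[OF sanov_subgroup] by blast
  have \<psi>mult: "\<psi> (A * B) = \<psi> A \<otimes>\<^bsub>F2\<^esub> \<psi> B" if "A \<in> sanov" "B \<in> sanov" for A B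
    using \<psi>w[OF F.m_closed[OF \<psi>(1)[OF that(1)] \<psi>(1)[OF that(2)]]] h.hom_mult[OF \<psi>(1)[OF that(1)] \<psi>(1)[OF that(2)]]
      \<psi>(2)[OF that(1)] \<psi>(2)[OF that(2)] by simp
  have \<psi>inv: "\<psi> (inv\<^bsub>SL 2\<^esub> A) = inv\<^bsub>F2\<^esub> \<psi> A" if "A \<in> sanov" for A
    using \<psi>w[OF F.inv_closed[OF \<psi>(1)[OF that]]] h.hom_inv[OF \<psi>(1)[OF that]] \<psi>(2)[OF that] by simp
  have \<psi>one: "\<psi> (1\<^sub>m 2) = []" using \<psi>w[OF F.one_closed] h.hom_one by (simp add: fg_one)
  have s_inv: "inv\<^bsub>SL 2\<^esub> A \<in> sanov" if "A \<in> sanov" for A using subgroup.m_inv_closed[OF sanov_subgroup that] .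
  have s_mult: "A * B \<in> sanov" if "A \<in> sanov" "B \<in> sanov" for A B using subgroup.m_closed[OF sanov_subgroup that] by simp
  have s_one: "1\<^sub>m 2 \<in> sanov" using subgroup.one_closed[OF sanov_subgroup] by simp
  define K where "K = {A \<in> sanov. [disp 0 (\<psi> A) = 0] (mod int d)}"
  define \<theta> where "\<theta> A = pp.path (\<psi> A) 0" for A
  have dm: "disp 0 (\<psi> (A * B)) = disp 0 (\<psi> A) + disp 0 (\<psi> B)" if "A \<in> sanov" "B \<in> sanov" for A B
    using \<psi>mult[OF that] by (simp add: fg_mult)
  have di: "disp 0 (\<psi> (inv\<^bsub>SL 2\<^esub> A)) = - disp 0 (\<psi> A)" if "A \<in> sanov" for A
    using \<psi>inv[OF that] disp_inv[OF \<psi>(1)[OF that]] by simp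
  have "finite_index_subgroup K (SLZ 2\<lparr>carrier := sanov\<rparr>)"
  proof -
    let ?L = "SLZ 2\<lparr>carrier := sanov\<rparr>"
    have L: "group ?L" using subgroup.subgroup_is_group[OF sanov_subgroup S.is_group] .
    have linv: "inv\<^bsub>?L\<^esub> A = inv\<^bsub>SL 2\<^esub> A" if "A \<in> sanov" for A using S.m_inv_consistent[OF sanov_subgroup that] .
    show ?thesis
    proof (rule group.finite_index_subgroupI[OF L, where c = "\<lambda>A. disp 0 (\<psi> A) mod int d"])
      show "subgroup K ?L"
      proof (rule group.subgroupI[OF L])
        show "K \<noteq> {}" using s_one \<psi>one by (auto simp: K_def)
      next
        fix A assume A: "A \<in> K"
        then have "[- disp 0 (\<psi> A) = - 0] (mod int d)" unfolding cong_minus_minus_iff by (simp add: K_def)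
        then show "inv\<^bsub>?L\<^esub> A \<in> K" using A linv s_inv di by (simp add: K_def)
      next
        fix A B assume "A \<in> K" "B \<in> K"
        then show "A \<otimes>\<^bsub>?L\<^esub> B \<in> K" using s_mult dm cong_add[of "disp 0 (\<psi> A)" 0 "int d" "disp 0 (\<psi> B)" 0] by (auto simp: K_def)
      qed (auto simp: K_def)
      have "(\<lambda>A. disp 0 (\<psi> A) mod int d) ` carrier ?L \<subseteq> {0..<int d}" using d by auto
      then show "finite ((\<lambda>A. disp 0 (\<psi> A) mod int d) ` carrier ?L)" using finite_subset by blast
    next
      fix A B assume "A \<in> carrier ?L" "B \<in> carrier ?L" and eq: "disp 0 (\<psi> A) mod int d = disp 0 (\<psi> B) mod int d"
      then have A: "A \<in> sanov" and B: "B \<in> sanov" by auto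
      have "[disp 0 (\<psi> A) - disp 0 (\<psi> B) = 0] (mod int d)" using eq by (simp add: cong_def cong_diff_iff_cong_0[symmetric] cong_diff_iff_cong_0)
          (metis cong_def cong_diff_iff_cong_0 mod_0)
      then show "A \<otimes>\<^bsub>?L\<^esub> inv\<^bsub>?L\<^esub> B \<in> K"
        using linv[OF B] s_mult[OF A s_inv[OF B]] dm[OF A s_inv[OF B]] di[OF B] by (simp add: K_def)
    qed
  qed
  then have "finite_index_subgroup K (SLZ 2)" using S.finite_index_trans[OF sanov_finite_index] by blast
  moreover have "\<theta> \<in> hom (SLZ 2\<lparr>carrier := K\<rparr>) P"
  proof (rule homI)
    fix A B assume "A \<in> carrier (SLZ 2\<lparr>carrier := K\<rparr>)" "B \<in> carrier (SLZ 2\<lparr>carrier := K\<rparr>)"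
    then have A: "A \<in> sanov" "[disp 0 (\<psi> A) = 0] (mod int d)" and B: "B \<in> sanov" by (auto simp: K_def)
    show "\<theta> (A \<otimes>\<^bsub>SLZ 2\<lparr>carrier := K\<rparr>\<^esub> B) = \<theta> A \<otimes> \<theta> B"
      using \<psi>mult[OF A(1) B] per[OF A(2), of "\<psi> B"] by (simp add: \<theta>_def pmult)
  qed (simp add: \<theta>_def)
  moreover have "\<exists>g\<in>K \<inter> elem_group 2. \<theta> g = x j" if j: "j < d" for j
  proof -
    let ?y = "ypow 0 j" and ?z = "gen (1::nat)"
    have y: "?y \<in> carrier F2" by (intro ypow_closed) simp
    have z: "?z \<in> carrier F2" by (intro gen_closed) simp
    let ?w = "?y \<otimes>\<^bsub>F2\<^esub> ?z \<otimes>\<^bsub>F2\<^esub> inv\<^bsub>F2\<^esub> ?y"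
    have w: "?w \<in> carrier F2" using y z by simp
    have py: "pp.path (ypow 0 l) s = \<one>" for l s
      by (induction l arbitrary: s) (simp_all add: pp.step_def val_def)
    have pz: "pp.path ?z s = x (nat (s mod int d))" for s by (simp add: pp.step_def val_def x)
    have "pp.path (?y \<otimes>\<^bsub>F2\<^esub> inv\<^bsub>F2\<^esub> ?y) 0 = \<one>" using F.r_inv[OF y] by (simp add: fg_one)
    then have pyi: "pp.path (inv\<^bsub>F2\<^esub> ?y) (int j) = \<one>" by (simp add: pmult py)
    have st: "pp.step (Suc 0, True) s = x (nat (s mod int d))" for s by (simp add: pp.step_def val_def)
    have "pp.path ?w 0 = x j" using j by (simp add: pmult py pz pyi fg_mult[symmetric] x) (simp add: fg_mult pyi st x)
    moreover have "disp 0 ?w = 0" using disp_inv[OF y, of 0] by (simp add: fg_mult)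
    ultimately have "sanov_word ?w \<in> K" "\<theta> (sanov_word ?w) = x j"
      using w \<psi>w[OF w] by (auto simp: K_def \<theta>_def sanov_def)
    moreover have "sanov_word ?w \<in> elem_group 2" using sanov_elem_group w by (auto simp: sanov_def)
    ultimately show ?thesis by blast
  qed
  ultimately show ?thesis by blast
qed

section \<open>Finite index in direct products\<close>

definition single :: "'i set \<Rightarrow> ('i \<Rightarrow> ('a, 'b) monoid_scheme) \<Rightarrow> 'i \<Rightarrow> 'a \<Rightarrow> 'i \<Rightarrow> 'a" where
  "single I G i g = (\<lambda>j\<in>I. if j = i then g else \<one>\<^bsub>G j\<^esub>)"

lemma single_mult:
  assumes "\<And>i. i \<in> I \<Longrightarrow> group (G i)"
  shows "single I G i (g \<otimes>\<^bsub>G i\<^esub> h) = single I G i g \<otimes>\<^bsub>product_group I G\<^esub> single I G i h"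
  using assms by (auto simp: single_def group.is_monoid monoid.l_one monoid.one_closed)

lemma factor_subgroup:
  assumes G: "\<And>i. i \<in> I \<Longrightarrow> group (G i)" and H: "subgroup H (product_group I G)" and i: "i \<in> I"
  shows "subgroup {g \<in> carrier (G i). single I G i g \<in> H} (G i)"
proof -
  interpret Gi: group "G i" using G[OF i] .
  interpret P: group "product_group I G" using G by (rule product_group)
  have c: "single I G i g \<in> carrier (product_group I G)" if "g \<in> carrier (G i)" for g
    using that by (auto simp: single_def intro!: monoid.one_closed group.is_monoid G)
  have one: "single I G i \<one>\<^bsub>G i\<^esub> = \<one>\<^bsub>product_group I G\<^esub>"
    by (auto simp: single_def)
  have inv: "single I G i (inv\<^bsub>G i\<^esub> g) = inv\<^bsub>product_group I G\<^esub> single I G i g" if g: "g \<in> carrier (G i)" for g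
  proof (rule P.inv_equality[symmetric])
    show "single I G i (inv\<^bsub>G i\<^esub> g) \<otimes>\<^bsub>product_group I G\<^esub> single I G i g = \<one>\<^bsub>product_group I G\<^esub>"
    proof -
      have "single I G i (inv\<^bsub>G i\<^esub> g) \<otimes>\<^bsub>product_group I G\<^esub> single I G i g = single I G i (inv\<^bsub>G i\<^esub> g \<otimes>\<^bsub>G i\<^esub> g)"
        by (rule single_mult[symmetric]) (rule G)
      also have "\<dots> = single I G i \<one>\<^bsub>G i\<^esub>" using g by simp
      finally show ?thesis unfolding one .
    qed
  qed (use c g in auto)
  have mult: "single I G i (g \<otimes>\<^bsub>G i\<^esub> h) = single I G i g \<otimes>\<^bsub>product_group I G\<^esub> single I G i h" for g h
    by (rule single_mult) (rule G)
  show ?thesis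
  proof (rule Gi.subgroupI)
    have "\<one>\<^bsub>G i\<^esub> \<in> {g \<in> carrier (G i). single I G i g \<in> H}"
      using subgroup.one_closed[OF H] one by simp
    then show "{g \<in> carrier (G i). single I G i g \<in> H} \<noteq> {}" by blast
  qed (use inv mult subgroup.m_inv_closed[OF H] subgroup.m_closed[OF H] in \<open>auto simp del: mult_product_group\<close>)
qed

text \<open>The part of \<open>H\<close> in each factor has finite index there, and \<open>H\<close> contains the product of these parts.\<close>

lemma product_finite_index:
  assumes I: "finite I" and G: "\<And>i. i \<in> I \<Longrightarrow> group (G i)" and H: "subgroup H (product_group I G)"
    and fi: "\<And>i. i \<in> I \<Longrightarrow> finite_index_subgroup {g \<in> carrier (G i). single I G i g \<in> H} (G i)"
  shows "finite_index_subgroup H (product_group I G)"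
proof -
  let ?P = "product_group I G"
  interpret P: group ?P using G by (rule product_group)
  define K where "K i = {g \<in> carrier (G i). single I G i g \<in> H}" for i
  have K: "finite_index_subgroup (K i) (G i)" "subgroup (K i) (G i)" if "i \<in> I" for i
    using fi[OF that] finite_index_subgroupD by (auto simp: K_def)
  have mem: "x \<in> H" if x: "x \<in> carrier ?P" "\<And>i. i \<in> I \<Longrightarrow> x i \<in> K i" for x
  proof -
    have "(\<lambda>j\<in>I. if j \<in> J then x j else \<one>\<^bsub>G j\<^esub>) \<in> H" if "finite J" "J \<subseteq> I" for J
      using that
    proof (induction J rule: finite_induct)
      case empty
      show ?case using subgroup.one_closed[OF H] unfolding one_product_group by (simp only: empty_iff if_False)
    next
      case (insert i J)
      then have i: "i \<in> I" and "J \<subseteq> I" by auto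
      have J: "(\<lambda>j\<in>I. if j \<in> J then x j else \<one>\<^bsub>G j\<^esub>) \<in> H" by (rule insert.IH[OF \<open>J \<subseteq> I\<close>])
      have "single I G i (x i) \<in> H" using x(2)[OF i] by (simp add: K_def)
      then have "(\<lambda>j\<in>I. if j \<in> J then x j else \<one>\<^bsub>G j\<^esub>) \<otimes>\<^bsub>?P\<^esub> single I G i (x i) \<in> H"
        using subgroup.m_closed[OF H J] by blast
      moreover have "(\<lambda>j\<in>I. if j \<in> J then x j else \<one>\<^bsub>G j\<^esub>) \<otimes>\<^bsub>?P\<^esub> single I G i (x i)
          = (\<lambda>j\<in>I. if j \<in> insert i J then x j else \<one>\<^bsub>G j\<^esub>)"
      proof (rule extensionalityI[of _ I])
        fix j assume j: "j \<in> I"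
        then interpret Gj: group "G j" using G by blast
        have "x j \<in> carrier (G j)" using x(1) j by auto
        then have "\<one>\<^bsub>G j\<^esub> \<otimes>\<^bsub>G j\<^esub> x j = x j" "x j \<otimes>\<^bsub>G j\<^esub> \<one>\<^bsub>G j\<^esub> = x j" by simp_all
        then show "((\<lambda>j\<in>I. if j \<in> J then x j else \<one>\<^bsub>G j\<^esub>) \<otimes>\<^bsub>?P\<^esub> single I G i (x i)) j
          = (\<lambda>j\<in>I. if j \<in> insert i J then x j else \<one>\<^bsub>G j\<^esub>) j"
          using j insert.hyps by (auto simp: single_def)
      qed auto
      ultimately show ?case by (simp only:)
    qed
    from this[OF I subset_refl] have "(\<lambda>j\<in>I. x j) \<in> H" by (simp cong: restrict_cong)
    moreover have "(\<lambda>j\<in>I. x j) = x" using x(1) by (auto simp: PiE_def extensional_restrict)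
    ultimately show ?thesis by simp
  qed
  let ?c = "\<lambda>x. \<lambda>i\<in>I. K i #>\<^bsub>G i\<^esub> x i"
  show ?thesis
  proof (rule P.finite_index_subgroupI[where c = ?c, OF H])
    have "?c ` carrier ?P \<subseteq> (\<Pi>\<^sub>E i\<in>I. (\<lambda>g. K i #>\<^bsub>G i\<^esub> g) ` carrier (G i))" by auto
    then show "finite (?c ` carrier ?P)"
      by (rule finite_subset) (intro finite_PiE I group.finite_rcos_image G K)
  next
    fix x y assume x: "x \<in> carrier ?P" and y: "y \<in> carrier ?P" and eq: "?c x = ?c y"
    show "x \<otimes>\<^bsub>?P\<^esub> inv\<^bsub>?P\<^esub> y \<in> H"
    proof (rule mem)
      show "x \<otimes>\<^bsub>?P\<^esub> inv\<^bsub>?P\<^esub> y \<in> carrier ?P" using x y by (intro P.m_closed P.inv_closed)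
      fix i assume i: "i \<in> I"
      have "K i #>\<^bsub>G i\<^esub> x i = K i #>\<^bsub>G i\<^esub> y i" using fun_cong[OF eq, of i] i by simp
      moreover have "x i \<in> carrier (G i)" "y i \<in> carrier (G i)" using x y i by auto
      ultimately have "x i \<otimes>\<^bsub>G i\<^esub> inv\<^bsub>G i\<^esub> y i \<in> K i"
        using group.rcos_eq_imp_quotient[OF G[OF i] K(2)[OF i]] by blast
      then show "(x \<otimes>\<^bsub>?P\<^esub> inv\<^bsub>?P\<^esub> y) i \<in> K i" using i y G by simp
    qed
  qed
qed

section \<open>Free groups of rank at least four\<close>

context signed_covers
begin

abbreviation "SLs \<equiv> (\<lambda>i. SL ((t + 1) * i) :: int mat monoid)"

lemma repr_image_subgroup: "subgroup (repr ` \<Gamma>) target"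
proof -
  have "group target" by (intro product_group group_SL)
  moreover have "group (A\<lparr>carrier := \<Gamma>\<rparr>)"
    using subgroup.subgroup_is_group[OF finite_index_subgroupD[OF \<Gamma>_finite_index] group_Aut] .
  ultimately have "group_hom (A\<lparr>carrier := \<Gamma>\<rparr>) target repr"
    using repr_hom by (simp add: group_hom_def group_hom_axioms_def)
  from group_hom.img_is_subgroup[OF this] show ?thesis by simp
qed

definition image_factor :: "nat \<Rightarrow> int mat set" where
  "image_factor l = {g \<in> carrier (SLs l). single {1..k} SLs l g \<in> repr ` \<Gamma>}"

lemma image_factor_subgroup: "l \<in> {1..k} \<Longrightarrow> subgroup (image_factor l) (SLs l)"
  unfolding image_factor_def by (rule factor_subgroup[OF group_SL repr_image_subgroup])

lemma realizes_image_factor: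
  assumes r: "realizes \<phi> l p q x" and l: "l \<in> {1..k}" and pq: "p \<noteq> q"
  shows "emat ((t + 1) * l) p q x \<in> image_factor l"
proof -
  have rho: "rho t i \<phi> = (if i = l then emat ((t + 1) * i) p q x else 1\<^sub>m ((t + 1) * i))" if "i \<in> {1..k}" for i
    using r that by (simp add: realizes_def)
  have "\<phi> \<in> \<Gamma>" using r rho det_elem[OF pq] by (auto simp: \<Gamma>_def realizes_def)
  moreover have "repr \<phi> = single {1..k} SLs l (emat ((t + 1) * l) p q x)"
    using rho by (auto simp: repr_def single_def)
  ultimately show ?thesis unfolding image_factor_def using elem_SL[OF pq] by (metis (mono_tags, lifting) imageI mem_Collect_eq)
qed

text \<open>Nontrivial elementary matrices at \<open>(p, q)\<close> and \<open>(q, r)\<close> give one at \<open>(p, r)\<close>. So it is enough to reach every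
coordinate of a trivial block from outside this block, and every coordinate of the last block from a trivial one.\<close>

lemma repr_image_finite_index:
  assumes n: "n = t + 2" and t2: "t \<ge> 2"
  shows "finite_index_subgroup (repr ` \<Gamma>) target"
proof (rule product_finite_index[OF _ group_SL repr_image_subgroup])
  fix l assume l: "l \<in> {1..k}"
  let ?m = "(t + 1) * l"
  define R where "R p q \<longleftrightarrow> (\<exists>x. x \<noteq> 0 \<and> emat ?m p q x \<in> image_factor l)" for p q
  have trans: "R p r" if "R p q" "R q r" "p \<noteq> q" "q \<noteq> r" "p \<noteq> r" "p < ?m" "q < ?m" "r < ?m" for p q r
    using that elem_commutator_mem[OF image_factor_subgroup[OF l] that(3-8)] unfolding R_def by (metis mult_eq_0_iff)
  have l0: "l > 0" using l by simp
  have blk: "q div l \<le> t" if "q < ?m" for q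
    using that l0 by (metis Suc_eq_plus1 less_Suc_eq_le less_mult_imp_div_less)
  have qd: "q div l * l + q mod l = q" "q mod l < l" for q using l0 by auto
  have into: "R p q" if pq: "p < ?m" "q div l < t" "p div l \<noteq> q div l" for p q
  proof -
    obtain \<phi> x where "x \<noteq> 0" "realizes \<phi> l p q x"
      using realize_to_trivial_block[OF pq(2) n l pq(1,3) qd(2)[of q]] qd(1)[of q] by auto
    then show ?thesis using realizes_image_factor[of \<phi> l p q x] l pq(3) by (auto simp: R_def)
  qed
  have out_of: "R p q" if pq: "q < ?m" "q div l = t" "p div l < t" for p q
  proof -
    obtain \<phi> x where "x \<noteq> 0" "realizes \<phi> l p q x"
      using realize_from_trivial_block[OF n t2 l pq(3) qd(2)[of p] pq(1,2)] qd(1)[of p] by auto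
    then show ?thesis using realizes_image_factor[of \<phi> l p q x] l pq by (auto simp: R_def)
  qed
  have "R p q" if pq: "p < ?m" "q < ?m" "p \<noteq> q" for p q
  proof -
    consider "q div l < t" "p div l \<noteq> q div l" | "q div l < t" "p div l = q div l"
      | "q div l = t" "p div l < t" | "q div l = t" "p div l = t"
      using blk[OF pq(1)] blk[OF pq(2)] by linarith
    then show ?thesis
    proof cases
      case 2
      define c where "c = (if q div l = 0 then 1 else 0 :: nat)"
      have c: "c < t" "c \<noteq> q div l" using t2 by (auto simp: c_def)
      have d: "(c * l) div l = c" using l0 by simp
      have cm: "c * l < ?m" using c l0 by (intro mult_strict_right_mono) auto
      have "R p (c * l)" using into[OF pq(1), of "c * l"] c d 2 by simp
      moreover have "R (c * l) q" using into[OF cm 2(1)] c d by simp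
      ultimately show ?thesis using trans[of p "c * l" q] pq cm c d 2 by metis
    next
      case 4
      have "0 < ?m" using l0 by simp
      moreover have "R p 0" using into[OF pq(1), of 0] 4 t2 by simp
      moreover have "R 0 q" using out_of[OF pq(2) 4(1), of 0] t2 by simp
      moreover have "p \<noteq> 0" "q \<noteq> 0" using 4 t2 by (metis div_0 not_numeral_le_zero)+
      ultimately show ?thesis using trans[of p 0 q] pq by simp
    qed (use into[OF pq(1)] out_of[OF pq(2)] in auto)
  qed
  moreover have "?m \<ge> 3"
  proof -
    have "3 * 1 \<le> ?m" using t2 l0 by (intro mult_le_mono) auto
    then show ?thesis by simp
  qed
  ultimately have "finite_index_subgroup (image_factor l) (SLs l)"
    using elementary_finite_index[OF _ image_factor_subgroup[OF l]] by (auto simp: R_def)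
  then show "finite_index_subgroup {g \<in> carrier (SLs l). single {1..k} SLs l g \<in> repr ` \<Gamma>} (SLs l)"
    by (simp only: image_factor_def)
qed simp

end

section \<open>Free groups of rank two and three\<close>

text \<open>In degree \<open>1\<close> the automorphisms that multiply one of the generators \<open>0\<close> and \<open>1\<close> by the other act as the two elementary
matrices. In rank \<open>3\<close> the generator \<open>2\<close> carries the sign, in rank \<open>2\<close> there is none.\<close>

lemma small_rank_SL2:
  assumes "n = 2 \<or> n = (3 :: nat)"
  obtains \<Gamma> \<sigma> where "finite_index_subgroup \<Gamma> (AutoGroup (free_group {..<n}))"
    "\<sigma> \<in> hom (AutoGroup (free_group {..<n})\<lparr>carrier := \<Gamma>\<rparr>) (SLZ 2)" "elem_group 2 \<subseteq> \<sigma> ` \<Gamma>"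
proof -
  interpret signed_covers n 1 1 using assms by unfold_locales auto
  interpret c: signed_cover n 1 1 by (rule cover) simp
  have one: "(1::nat) \<in> {1..1}" by simp
  have rc: "rho 1 1 \<chi> \<in> carrier_mat 2 2" for \<chi> using rho_carrier[of 1 1 \<chi>] by (simp add: numeral_2_eq_2)
  have det: "rho 1 1 \<phi> = emat 2 p q 1 \<Longrightarrow> p \<noteq> q \<Longrightarrow> \<phi> \<in> lift_stab n 1 1 \<Longrightarrow> \<phi> \<in> \<Gamma>" for \<phi> p q
    by (simp add: \<Gamma>_def det_elem del: One_nat_def)
  have hom: "rho 1 1 \<in> hom (A\<lparr>carrier := \<Gamma>\<rparr>) (SLZ 2)"
  proof (rule homI)
    fix \<phi> assume "\<phi> \<in> carrier (A\<lparr>carrier := \<Gamma>\<rparr>)"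
    then have "det (rho 1 1 \<phi>) = 1" by (simp add: \<Gamma>_def del: One_nat_def)
    then show "rho 1 1 \<phi> \<in> carrier (SLZ 2)" using rc[of \<phi>] by (simp add: SL_def)
  next
    fix \<phi> \<psi> assume "\<phi> \<in> carrier (A\<lparr>carrier := \<Gamma>\<rparr>)" "\<psi> \<in> carrier (A\<lparr>carrier := \<Gamma>\<rparr>)"
    then have "\<phi> \<in> lift_stab n 1 1" "\<psi> \<in> lift_stab n 1 1" by (simp_all add: \<Gamma>_def del: One_nat_def)
    then show "rho 1 1 (\<phi> \<otimes>\<^bsub>A\<lparr>carrier := \<Gamma>\<rparr>\<^esub> \<psi>) = rho 1 1 \<phi> \<otimes>\<^bsub>SLZ 2\<^esub> rho 1 1 \<psi>"
      using rho_mult[OF one] by simp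
  qed
  have y: "gen 1 \<in> deck_trivial 0" using t_less by (auto simp: deck_trivial_def same_lift_def gen_sign_def simp del: One_nat_def intro!: gen_closed)
  obtain \<phi> where \<phi>0: "\<phi> \<in> lift_stab n 1 1"
    "\<And>i p q. i \<in> {1..1} \<Longrightarrow> p < (1 + 1) * i \<Longrightarrow> q < (1 + 1) * i \<Longrightarrow>
      rho 1 i \<phi> $$ (p, q) = (if p = q then 1 else 0) + (if q div i = 0 then coord 1 i p (gen 1) (basepoint i q) else 0)"
    by (rule rho_right_transvection[of 0 "gen 1"]) (simp, rule y, blast)
  have \<phi>: "\<phi> \<in> lift_stab n 1 1"
    "\<And>p q. p < 2 \<Longrightarrow> q < 2 \<Longrightarrow> rho 1 1 \<phi> $$ (p, q) = (if p = q then 1 else 0) + (if q = 0 then coord 1 1 p (gen 1) (basepoint 1 q) else 0)"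
    using \<phi>0(1) \<phi>0(2)[OF one] by (simp_all add: one_add_one del: One_nat_def)
  have y_value: "coord 1 1 p (gen 1) s = (if p = 1 then 1 else 0)" for p s
    using c.coord_shift_gen[of p s] by (simp add: cong_def del: gen_cocycle_gen One_nat_def)
  have e1: "rho 1 1 \<phi> = emat 2 1 0 1"
  proof (rule square_mat_eqI[of _ 2])
    fix i j :: nat assume "i < 2" "j < 2"
    then show "rho 1 1 \<phi> $$ (i, j) = emat 2 1 0 1 $$ (i, j)"
      using \<phi>(2)[of i j] unfolding y_value by (auto simp: elem_index)
  qed (use rc in auto)
  obtain \<psi> where \<psi>0: "\<psi> \<in> lift_stab n 1 1"
    "\<And>i p q. i \<in> {1..1} \<Longrightarrow> p < (1 + 1) * i \<Longrightarrow> q < (1 + 1) * i \<Longrightarrow>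
      rho 1 i \<psi> $$ (p, q) = (if p = q then 1 else 0) + (if q = 1 * i \<and> p div i = 0 then 1 else 0)"
    by (rule rho_shift_transvection[of 0]) (simp, blast)
  have \<psi>: "\<psi> \<in> lift_stab n 1 1"
    "\<And>p q. p < 2 \<Longrightarrow> q < 2 \<Longrightarrow> rho 1 1 \<psi> $$ (p, q) = (if p = q then 1 else 0) + (if q = 1 \<and> p = 0 then 1 else 0)"
    using \<psi>0(1) \<psi>0(2)[OF one] by (simp_all add: one_add_one del: One_nat_def)
  have e2: "rho 1 1 \<psi> = emat 2 0 1 1"
  proof (rule square_mat_eqI[of _ 2])
    fix i j :: nat assume "i < 2" "j < 2"
    then show "rho 1 1 \<psi> $$ (i, j) = emat 2 0 1 1 $$ (i, j)"
      using \<psi>(2)[of i j] by (auto simp: elem_index)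
  qed (use rc in auto)
  have "{emat 2 p q 1 | p q. p < 2 \<and> q < 2 \<and> p \<noteq> q} \<subseteq> rho 1 1 ` \<Gamma>"
  proof
    fix B assume "B \<in> {emat 2 p q 1 | p q. p < 2 \<and> q < 2 \<and> p \<noteq> q}"
    then obtain p q :: nat where pq: "B = emat 2 p q 1" "p < 2" "q < 2" "p \<noteq> q" by blast
    then have "p = 1 \<and> q = 0 \<or> p = 0 \<and> q = 1" by auto
    then show "B \<in> rho 1 1 ` \<Gamma>" using pq(1) e1 e2 det[OF e1 _ \<phi>(1)] det[OF e2 _ \<psi>(1)] by (metis imageI zero_neq_one)
  qed
  moreover have "subgroup (rho 1 1 ` \<Gamma>) (SLZ 2)"
  proof -
    have "group (A\<lparr>carrier := \<Gamma>\<rparr>)"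
      using subgroup.subgroup_is_group[OF finite_index_subgroupD[OF \<Gamma>_finite_index] group_Aut] .
    then have "group_hom (A\<lparr>carrier := \<Gamma>\<rparr>) (SLZ 2) (rho 1 1)"
      using hom group_SL by (auto simp: group_hom_def group_hom_axioms_def)
    from group_hom.img_is_subgroup[OF this] show ?thesis by simp
  qed
  ultimately have "elem_group 2 \<subseteq> rho 1 1 ` \<Gamma>"
    unfolding elem_group_def by (rule group.generate_subgroup_incl[OF group_SL])
  then show ?thesis using that[OF \<Gamma>_finite_index hom] by blast
qed

lemma small_rank:
  fixes n k :: nat and m :: "nat \<Rightarrow> nat"
  assumes n: "n = 2 \<or> n = (3 :: nat)"
  shows "\<exists>\<Gamma> \<rho>. finite_index_subgroup \<Gamma> (AutoGroup (free_group {..<n})) \<and>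
    \<rho> \<in> hom (AutoGroup (free_group {..<n}) \<lparr>carrier := \<Gamma>\<rparr>) (product_group {1..k} (\<lambda>i. SL (m i) :: int mat monoid)) \<and>
    finite_index_subgroup (\<rho> ` \<Gamma>) (product_group {1..k} (\<lambda>i. SL (m i) :: int mat monoid))"
proof -
  let ?A = "AutoGroup (free_group {..<n})" and ?G = "\<lambda>i. SL (m i) :: int mat monoid"
  let ?P = "product_group {1..k} ?G"
  interpret A: group ?A by (rule group_Aut)
  interpret P: group ?P by (intro product_group group_SL)
  obtain \<Gamma> \<sigma> where \<Gamma>: "finite_index_subgroup \<Gamma> ?A" "\<sigma> \<in> hom (?A\<lparr>carrier := \<Gamma>\<rparr>) (SLZ 2)" "elem_group 2 \<subseteq> \<sigma> ` \<Gamma>"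
    using small_rank_SL2[OF n] by blast
  define T where "T = (\<Union>i\<in>{1..k}. \<Union>p\<in>{..<m i}. \<Union>q\<in>{..<m i} - {p}. {single {1..k} ?G i (emat (m i) p q 1)})"
  have "finite T" unfolding T_def by (intro finite_UN_I finite_Diff) auto
  then obtain xs where xs: "set xs = T" using finite_list by blast
  have Tc: "T \<subseteq> carrier ?P"
    using elem_SL group.is_monoid[OF group_SL] by (auto simp: T_def single_def SL_def)
  \<comment> \<open>An enumeration of \<open>T\<close>; the identity pads it, so that the number of values is positive even if \<open>T\<close> is empty.\<close>
  define x where "x j = (if j < length xs then xs ! j else \<one>\<^bsub>?P\<^esub>)" for j
  have xc: "x j \<in> carrier ?P" for j
    using xs Tc nth_mem[of j xs] P.one_closed by (auto simp: x_def simp del: carrier_product_group one_product_group)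
  obtain K \<theta> where K: "finite_index_subgroup K (SLZ 2)" "\<theta> \<in> hom (SLZ 2\<lparr>carrier := K\<rparr>) ?P"
    "\<And>j. j < Suc (length xs) \<Longrightarrow> \<exists>g\<in>K \<inter> elem_group 2. \<theta> g = x j"
    using SL2_large[where x = x and d = "Suc (length xs)", OF P.is_group xc] by fastforce
  define \<Delta> where "\<Delta> = {\<phi> \<in> \<Gamma>. \<sigma> \<phi> \<in> K}"
  have \<Delta>: "finite_index_subgroup \<Delta> ?A"
    unfolding \<Delta>_def by (rule A.finite_index_preimage[OF \<Gamma>(1) group_SL \<Gamma>(2) K(1)])
  have hom: "\<theta> \<circ> \<sigma> \<in> hom (?A\<lparr>carrier := \<Delta>\<rparr>) ?P"
    using \<Gamma>(2) K(2) unfolding hom_def by (auto simp: \<Delta>_def Pi_iff simp del: carrier_product_group mult_product_group)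
  have "group (?A\<lparr>carrier := \<Delta>\<rparr>)"
    using subgroup.subgroup_is_group[OF finite_index_subgroupD[OF \<Delta>] A.is_group] .
  then have "group_hom (?A\<lparr>carrier := \<Delta>\<rparr>) ?P (\<theta> \<circ> \<sigma>)"
    using hom P.is_group unfolding group_hom_def group_hom_axioms_def by blast
  from group_hom.img_is_subgroup[OF this] have H: "subgroup ((\<theta> \<circ> \<sigma>) ` \<Delta>) ?P" by simp
  have T: "T \<subseteq> (\<theta> \<circ> \<sigma>) ` \<Delta>"
  proof
    fix y assume "y \<in> T"
    then obtain j where j: "j < length xs" "y = x j" using xs by (auto simp: x_def in_set_conv_nth)
    obtain g where g: "g \<in> K" "g \<in> elem_group 2" "\<theta> g = x j" using K(3)[of j] j by auto
    then obtain \<phi> where "\<phi> \<in> \<Gamma>" "\<sigma> \<phi> = g" using \<Gamma>(3) by blast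
    then show "y \<in> (\<theta> \<circ> \<sigma>) ` \<Delta>" using g j by (intro image_eqI[of _ _ \<phi>]) (auto simp: \<Delta>_def)
  qed
  have "finite_index_subgroup ((\<theta> \<circ> \<sigma>) ` \<Delta>) ?P"
  proof (rule product_finite_index[OF _ group_SL H])
    fix i assume i: "i \<in> {1..k}"
    let ?K = "{g \<in> carrier (?G i). single {1..k} ?G i g \<in> (\<theta> \<circ> \<sigma>) ` \<Delta>}"
    have sub: "subgroup ?K (?G i)" by (rule factor_subgroup[OF group_SL H i])
    have "{emat (m i) p q 1 | p q. p < m i \<and> q < m i \<and> p \<noteq> q} \<subseteq> ?K"
    proof
      fix B assume "B \<in> {emat (m i) p q 1 | p q. p < m i \<and> q < m i \<and> p \<noteq> q}"
      then obtain p q where pq: "B = emat (m i) p q 1" "p < m i" "q < m i" "p \<noteq> q" by blast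
      then have "single {1..k} ?G i B \<in> T" unfolding T_def using i
        by (intro UN_I[of i] UN_I[of p] UN_I[of q]) auto
      then show "B \<in> ?K" using T elem_SL[OF pq(4)] pq(1) by auto
    qed
    then have "elem_group (m i) \<subseteq> ?K"
      unfolding elem_group_def by (rule group.generate_subgroup_incl[OF group_SL _ sub])
    then show "finite_index_subgroup ?K (?G i)"
      using group.finite_index_mono[OF group_SL elem_group_finite_index _ sub] by blast
  qed simp
  then show ?thesis using \<Delta> hom by blast
qed

theorem corollary1p2:
  fixes n k :: nat
  assumes "n \<ge> 2" and "k \<ge> 1"
  shows "\<exists>\<Gamma> \<rho>.
    finite_index_subgroup \<Gamma> (AutoGroup (free_group {..<n})) \<and>
    \<rho> \<in> hom (AutoGroup (free_group {..<n}) \<lparr>carrier := \<Gamma>\<rparr>)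
            (product_group {1..k} (\<lambda>i. SL ((n - 1) * i) :: int mat monoid)) \<and>
    finite_index_subgroup (\<rho> ` \<Gamma>)
            (product_group {1..k} (\<lambda>i. SL ((n - 1) * i) :: int mat monoid))"
proof (cases "n \<ge> 4")
  case True
  define t where "t = n - 2"
  have n: "n = t + 2" "t \<ge> 2" "n - 1 = t + 1" using True by (auto simp: t_def)
  interpret signed_covers n t k using n(1) by unfold_locales simp
  show ?thesis unfolding n(3)
    using \<Gamma>_finite_index repr_hom repr_image_finite_index[OF n(1,2)] by blast
next
  case False
  then have "n = 2 \<or> n = 3" using assms(1) by auto
  then show ?thesis by (rule small_rank)
qed

end
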